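(* Fix $p\in(0,1/2]$, an integer $k\ge 1$, and $\epsilon>0$. Let $M_n$ be an $n\times n$ random matrix whose entries are independent $\operatorname{Ber}(p)$ random variables (each entry equals $1$ with probability $p$ and $0$ with probability $1-p$). Then there exists $n_0=n_0(p,k,\epsilon)$ such that for all $n\ge n_0$, \[\mathbb{P}[\operatorname{corank}M_n\ge k]\le (1-p+\epsilon)^{kn}.\]
   Context: $\operatorname{corank}M_n = n-\operatorname{rank}M_n$. *)

theory Defs
  imports "HOL-Probability.Probability" "Jordan_Normal_Form.DL_Rank"
begin

definition real_rank :: "real mat \<Rightarrow> nat" where
  "real_rank A = vec_space.rank (dim_row A) A"

definition corank :: "nat \<Rightarrow> real mat \<Rightarrow> nat" where
  "corank n A = n - real_rank A"

definition bernoulli_matrix :: "nat \<Rightarrow> real \<Rightarrow> real mat pmf" where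
  "bernoulli_matrix n p =
     map_pmf (\<lambda>f. mat n n (\<lambda>(i,j). if f (i,j) then 1 else 0))
       (Pi_pmf ({..<n} \<times> {..<n}) False (\<lambda>_. bernoulli_pmf p))"

end

theory Submission
  imports Defs "HOL-Real_Asymp.Real_Asymp"
begin

text \<open>If the corank is at least \<open>k\<close>, then some \<open>k\<close> columns are orthogonal to every vector \<open>v\<close> of the left
  kernel of the other \<open>n - k\<close> columns. As the \<open>k\<close> columns are independent of \<open>v\<close>, this has probability at
  most \<open>\<alpha> ^ k\<close> where \<open>\<alpha>\<close> is the probability that a random column is orthogonal to \<open>v\<close>. So it suffices that
  outside an event of probability about \<open>(1 - p) ^ (k * n)\<close> some \<open>v\<close> has \<open>\<alpha> \<le> n (1 - p') ^ n\<close>, with \<open>p' < p\<close>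
  arbitrarily close to \<open>p\<close>.

  Suppose that a kernel vector \<open>v\<close> violates this and is spread out, that is, its \<open>l\<^sup>1\<close> norm is comparable
  to the maximal possible one. At a suitable scale \<open>N\<close>, the smoothed concentration of \<open>N v\<close> is of
  order \<open>L / N\<close>, for a large factor \<open>L\<close>, and a random rounding of \<open>N v\<close> gives an integer point of the same
  concentration that is still almost annihilated by the \<open>n - k\<close> columns. By Tikhomirov's inversion of
  randomness, only a fraction \<open>n ^ (- c n)\<close> of the integer points of a cube are so badly anticoncentrated, which
  beats the factor \<open>C ^ n\<close> lost elsewhere in the union bound.

  If no kernel vector of this kind exists and all kernel vectors violate the bound, then there is a triangular
  system of \<open>k\<close> kernel vectors of small \<open>l\<^sup>1\<close> norm. A random column is almost orthogonal to
  all of them with probability at most \<open>(1 - p) ^ k + \<epsilon>\<close>, and up to rounding there are only \<open>(1 + \<epsilon>) ^ n\<close> such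
  systems.\<close>

section \<open>Random subsets and random 0/1 matrices\<close>

text \<open>The obstacle is the exponent \<open>k * n\<close>. A given row vanishes with probability
  \<open>(1 - p) ^ n\<close>, so for k \<ge> 2 a single structured kernel vector is far too frequent
  to be discarded. What can be discarded at a cost near \<open>(1 - p) ^ (k * n)\<close> is a whole
  system of k structured vectors, and the bound \<open>(1 - p) ^ k\<close> per column requires these
  to be independent in a quantitative sense. The triangular shape provides this: each pivot entry is
  1, later vectors vanish at it, and all entries are bounded by 1. For spread vectors a single one
  suffices, since the gain n ^ (- c n) beats every exponential. This includes the factor
  \<open>N ^ k\<close> that remains because only n - k columns are available to pay for the
  \<open>N ^ n\<close> integer points at scale N \<le> \<open>2 ^ n\<close>. Rounding is controlled
  in mean square only. This is why concentration is measured by the weight 1 / (1 + x^2 / n) and not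
  by an indicator: a perturbation of that kind changes the smoothed quantity by a bounded
  factor.\<close>

definition bern_weight :: "('a \<Rightarrow> real) \<Rightarrow> 'a set \<Rightarrow> 'a set \<Rightarrow> real" where
  "bern_weight \<pi> J S = (\<Prod>j\<in>J. if j \<in> S then \<pi> j else 1 - \<pi> j)"

text \<open>Expectation of \<open>F\<close> over a random subset of \<open>J\<close> that contains
  each j independently with probability \<open>\<pi> j\<close>. Values in a real vector space let
  the same operator serve for probabilities and for complex characteristic functions.\<close>

definition bexp :: "('a \<Rightarrow> real) \<Rightarrow> 'a set \<Rightarrow> ('a set \<Rightarrow> 'b::real_vector) \<Rightarrow> 'b" where
  "bexp \<pi> J F = (\<Sum>S\<in>Pow J. bern_weight \<pi> J S *\<^sub>R F S)"

lemma bexp_empty [simp]: "bexp \<pi> {} F = F {}"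
  by (simp add: bexp_def bern_weight_def)

lemma bern_weight_insert:
  assumes "finite J" "j \<notin> J" "S \<subseteq> J"
  shows "bern_weight \<pi> (insert j J) S = (1 - \<pi> j) * bern_weight \<pi> J S"
    and "bern_weight \<pi> (insert j J) (insert j S) = \<pi> j * bern_weight \<pi> J S"
proof -
  have "j \<notin> S" using assms by auto
  then show "bern_weight \<pi> (insert j J) S = (1 - \<pi> j) * bern_weight \<pi> J S"
    using assms by (simp add: bern_weight_def)
  have "(\<Prod>i\<in>J. if i \<in> insert j S then \<pi> i else 1 - \<pi> i) = (\<Prod>i\<in>J. if i \<in> S then \<pi> i else 1 - \<pi> i)"
    using assms by (intro prod.cong) auto
  then show "bern_weight \<pi> (insert j J) (insert j S) = \<pi> j * bern_weight \<pi> J S"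
    using assms by (simp add: bern_weight_def)
qed

lemma bexp_insert:
  assumes "finite J" "j \<notin> J"
  shows "bexp \<pi> (insert j J) F
    = (1 - \<pi> j) *\<^sub>R bexp \<pi> J F + \<pi> j *\<^sub>R bexp \<pi> J (\<lambda>S. F (insert j S))"
proof -
  have inj: "inj_on (insert j) (Pow J)"
    using assms(2) by (intro inj_onI) (metis Diff_insert_absorb PowD in_mono)
  have disj: "Pow J \<inter> insert j ` Pow J = {}" using assms by auto
  have "bexp \<pi> (insert j J) F =
     (\<Sum>S\<in>Pow J. bern_weight \<pi> (insert j J) S *\<^sub>R F S)
     + (\<Sum>S\<in>Pow J. bern_weight \<pi> (insert j J) (insert j S) *\<^sub>R F (insert j S))"
    unfolding bexp_def Pow_insert
    by (subst sum.union_disjoint) (use assms disj in \<open>auto simp: sum.reindex[OF inj]\<close>)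
  also have "(\<Sum>S\<in>Pow J. bern_weight \<pi> (insert j J) S *\<^sub>R F S) = (1 - \<pi> j) *\<^sub>R bexp \<pi> J F"
    unfolding bexp_def scaleR_sum_right
    by (intro sum.cong) (use assms bern_weight_insert in \<open>auto simp: scaleR_scaleR\<close>)
  also have "(\<Sum>S\<in>Pow J. bern_weight \<pi> (insert j J) (insert j S) *\<^sub>R F (insert j S))
     = \<pi> j *\<^sub>R bexp \<pi> J (\<lambda>S. F (insert j S))"
    unfolding bexp_def scaleR_sum_right
    by (intro sum.cong) (use assms bern_weight_insert in \<open>auto simp: scaleR_scaleR\<close>)
  finally show ?thesis .
qed

lemma bexp_cong:
  assumes "\<And>S. S \<subseteq> J \<Longrightarrow> F S = G S"
  shows "bexp \<pi> J F = bexp \<pi> J G"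
  unfolding bexp_def by (intro sum.cong) (use assms in auto)

lemma bexp_add: "bexp \<pi> J (\<lambda>S. F S + G S) = bexp \<pi> J F + bexp \<pi> J G"
  unfolding bexp_def by (simp add: scaleR_add_right sum.distrib)

lemma bexp_cmult: fixes c :: "'b::real_algebra" shows "bexp \<pi> J (\<lambda>S. c * F S) = c * bexp \<pi> J F"
  unfolding bexp_def sum_distrib_left by simp

lemma bexp_sum: "bexp \<pi> J (\<lambda>S. \<Sum>x\<in>X. F x S) = (\<Sum>x\<in>X. bexp \<pi> J (F x))"
  unfolding bexp_def scaleR_sum_right by (rule sum.swap)

lemma bexp_swap: "bexp \<pi> J (\<lambda>S. bexp \<rho> K (\<lambda>T. F S T)) = bexp \<rho> K (\<lambda>T. bexp \<pi> J (\<lambda>S. F S T))"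
  unfolding bexp_def scaleR_sum_right
  by (subst sum.swap) (simp add: mult.commute)

lemma bexp_const: "finite J \<Longrightarrow> bexp \<pi> J (\<lambda>_. c) = c"
proof (induction J rule: finite_induct)
  case (insert j J)
  then show ?case by (simp add: bexp_insert flip: scaleR_add_left)
qed simp

lemma bern_weight_nonneg: "(\<And>j. j \<in> J \<Longrightarrow> 0 \<le> \<pi> j \<and> \<pi> j \<le> 1) \<Longrightarrow> bern_weight \<pi> J S \<ge> 0"
  unfolding bern_weight_def by (intro prod_nonneg) auto

lemma bexp_mono:
  fixes F G :: "'a set \<Rightarrow> real"
  assumes "\<And>j. j \<in> J \<Longrightarrow> 0 \<le> \<pi> j \<and> \<pi> j \<le> 1" "\<And>S. S \<subseteq> J \<Longrightarrow> F S \<le> G S"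
  shows "bexp \<pi> J F \<le> bexp \<pi> J G"
  unfolding bexp_def
  using assms(2) bern_weight_nonneg[OF assms(1)] by (intro sum_mono) (auto intro!: mult_left_mono)

lemma bexp_nonneg:
  fixes F :: "'a set \<Rightarrow> real"
  assumes "\<And>j. j \<in> J \<Longrightarrow> 0 \<le> \<pi> j \<and> \<pi> j \<le> 1" "\<And>S. S \<subseteq> J \<Longrightarrow> 0 \<le> F S"
  shows "0 \<le> bexp \<pi> J F"
  unfolding bexp_def
  using assms(2) bern_weight_nonneg[OF assms(1)] by (intro sum_nonneg) (auto intro!: mult_nonneg_nonneg)

lemma bexp_le_const:
  fixes F :: "'a set \<Rightarrow> real"
  assumes "finite J" "\<And>j. j \<in> J \<Longrightarrow> 0 \<le> \<pi> j \<and> \<pi> j \<le> 1" "\<And>S. S \<subseteq> J \<Longrightarrow> F S \<le> c"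
  shows "bexp \<pi> J F \<le> c"
  using bexp_mono[of J \<pi> F "\<lambda>_. c"] assms by (simp add: bexp_const)

lemma bexp_Un:
  assumes "finite J" "finite K" "J \<inter> K = {}"
  shows "bexp \<pi> (J \<union> K) F = bexp \<pi> J (\<lambda>S. bexp \<pi> K (\<lambda>T. F (S \<union> T)))"
  using assms
proof (induction J arbitrary: F rule: finite_induct)
  case (insert j J)
  have "bexp \<pi> (insert j J \<union> K) F = bexp \<pi> (insert j (J \<union> K)) F" by simp
  also have "\<dots> = (1 - \<pi> j) *\<^sub>R bexp \<pi> (J \<union> K) F + \<pi> j *\<^sub>R bexp \<pi> (J \<union> K) (\<lambda>S. F (insert j S))"
    using insert by (intro bexp_insert) auto
  finally show ?case using insert by (simp add: bexp_insert)
qed simp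

lemma bexp_prod:
  fixes f g :: "'a \<Rightarrow> 'b::{real_algebra_1,comm_ring_1}"
  assumes "finite J"
  shows "bexp \<pi> J (\<lambda>S. \<Prod>j\<in>J. if j \<in> S then f j else g j) = (\<Prod>j\<in>J. \<pi> j *\<^sub>R f j + (1 - \<pi> j) *\<^sub>R g j)"
  using assms
proof (induction J rule: finite_induct)
  case (insert j J)
  have 1: "bexp \<pi> J (\<lambda>S. \<Prod>i\<in>insert j J. if i \<in> S then f i else g i)
     = bexp \<pi> J (\<lambda>S. g j * (\<Prod>i\<in>J. if i \<in> S then f i else g i))"
    using insert by (intro bexp_cong) auto
  have "(\<Prod>i\<in>J. if i = j \<or> i \<in> S then f i else g i) = (\<Prod>i\<in>J. if i \<in> S then f i else g i)" for S
    using insert by (intro prod.cong) auto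
  then have 2: "bexp \<pi> J (\<lambda>S. \<Prod>i\<in>insert j J. if i \<in> insert j S then f i else g i)
     = bexp \<pi> J (\<lambda>S. f j * (\<Prod>i\<in>J. if i \<in> S then f i else g i))"
    using insert by (intro bexp_cong) auto
  show ?case unfolding bexp_insert[OF insert(1,2)] 1 2 bexp_cmult insert.IH
    using insert by (simp add: algebra_simps)
qed simp

lemma bexp_exists_le:
  fixes F :: "'a set \<Rightarrow> real"
  assumes "finite J" "\<And>j. j \<in> J \<Longrightarrow> 0 \<le> \<pi> j \<and> \<pi> j \<le> 1" "bexp \<pi> J F \<le> c"
  shows "\<exists>S\<subseteq>J. F S \<le> c"
proof (rule ccontr)
  assume "\<not> ?thesis"
  then have *: "\<And>S. S \<in> Pow J \<Longrightarrow> F S > c" by auto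
  define d where "d = Min (F ` Pow J)"
  have "d \<in> F ` Pow J" unfolding d_def using assms(1) by (intro Min_in) auto
  then have "d > c" using * by auto
  have "bexp \<pi> J (\<lambda>_. d) \<le> bexp \<pi> J F"
    using assms by (intro bexp_mono) (auto simp: d_def)
  then show False using \<open>d > c\<close> assms by (simp add: bexp_const)
qed

text \<open>The inner product of v with the 0/1 vector of support S, so \<open>ssum S v = 0\<close>
  reads as orthogonality of a random column to v.\<close>

definition ssum :: "'a set \<Rightarrow> ('a \<Rightarrow> 'b::comm_monoid_add) \<Rightarrow> 'b" where
  "ssum S v = (\<Sum>j\<in>S. v j)"

text \<open>A family \<open>B \<in> PiE I (\<lambda>_. Pow J)\<close> stands for a 0/1 matrix with rows indexed by \<open>I\<close>,
  each row being given by its support.\<close>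

definition mat_weight :: "('a \<Rightarrow> real) \<Rightarrow> 'i set \<Rightarrow> 'a set \<Rightarrow> ('i \<Rightarrow> 'a set) \<Rightarrow> real" where
  "mat_weight \<pi> I J B = (\<Prod>i\<in>I. bern_weight \<pi> J (B i))"

definition mexp :: "('a \<Rightarrow> real) \<Rightarrow> 'i set \<Rightarrow> 'a set \<Rightarrow> (('i \<Rightarrow> 'a set) \<Rightarrow> real) \<Rightarrow> real" where
  "mexp \<pi> I J F = (\<Sum>B\<in>PiE I (\<lambda>_. Pow J). mat_weight \<pi> I J B * F B)"

lemma mexp_prod:
  assumes "finite I" "finite J"
  shows "mexp \<pi> I J (\<lambda>B. \<Prod>i\<in>I. f i (B i)) = (\<Prod>i\<in>I. bexp \<pi> J (f i))"
  unfolding mexp_def mat_weight_def bexp_def prod.distrib[symmetric] real_scaleR_def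
  using prod_sum_PiE[of I "\<lambda>_. Pow J" "\<lambda>i S. bern_weight \<pi> J S * f i S"] assms by simp

lemma mat_weight_nonneg:
  "(\<And>j. j \<in> J \<Longrightarrow> 0 \<le> \<pi> j \<and> \<pi> j \<le> 1) \<Longrightarrow> mat_weight \<pi> I J B \<ge> 0"
  unfolding mat_weight_def by (intro prod_nonneg ballI bern_weight_nonneg) auto

lemma mexp_mono:
  assumes "\<And>j. j \<in> J \<Longrightarrow> 0 \<le> \<pi> j \<and> \<pi> j \<le> 1"
    "\<And>B. B \<in> PiE I (\<lambda>_. Pow J) \<Longrightarrow> F B \<le> G B"
  shows "mexp \<pi> I J F \<le> mexp \<pi> I J G"
  unfolding mexp_def using assms mat_weight_nonneg[OF assms(1)]
  by (intro sum_mono mult_left_mono) auto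

lemma mexp_sum: "mexp \<pi> I J (\<lambda>B. \<Sum>x\<in>X. F x B) = (\<Sum>x\<in>X. mexp \<pi> I J (F x))"
  unfolding mexp_def sum_distrib_left by (rule sum.swap)

lemma mexp_add: "mexp \<pi> I J (\<lambda>B. F B + G B) = mexp \<pi> I J F + mexp \<pi> I J G"
  unfolding mexp_def by (simp add: distrib_left sum.distrib)

lemma mexp_cmult: "mexp \<pi> I J (\<lambda>B. c * F B) = c * mexp \<pi> I J F"
  unfolding mexp_def sum_distrib_left by (simp add: mult_ac)

lemma mexp_const: "finite I \<Longrightarrow> finite J \<Longrightarrow> mexp \<pi> I J (\<lambda>_. c) = c"
  using mexp_prod[of I J \<pi> "\<lambda>_ _. 1"] mexp_cmult[of \<pi> I J c "\<lambda>_. 1"] by (simp add: bexp_const)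

text \<open>Odlyzko's bound.\<close>

lemma bexp_determined_le:
  assumes "finite J" "K \<subseteq> J" "0 \<le> p" "p \<le> 1 / 2"
    and det: "\<And>S T. S \<subseteq> J \<Longrightarrow> T \<subseteq> J \<Longrightarrow> Q S \<Longrightarrow> Q T \<Longrightarrow> S \<inter> K = T \<inter> K \<Longrightarrow> S = T"
  shows "bexp (\<lambda>_. p) J (\<lambda>S. of_bool (Q S)) \<le> (1 - p) ^ card (J - K)"
proof -
  have fin: "finite K" "finite (J - K)" using assms finite_subset by auto
  have "bexp (\<lambda>_. p) J (\<lambda>S. of_bool (Q S)) =
    bexp (\<lambda>_. p) K (\<lambda>S. bexp (\<lambda>_. p) (J - K) (\<lambda>T. of_bool (Q (S \<union> T))))"
    using bexp_Un[of K "J - K" "\<lambda>_. p" "\<lambda>S. of_bool (Q S)"] fin assms(2)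
    by (simp add: Un_absorb1)
  also have "\<dots> \<le> (1 - p) ^ card (J - K)"
  proof (rule bexp_le_const[OF fin(1)])
    fix S assume S: "S \<subseteq> K"
    show "bexp (\<lambda>_. p) (J - K) (\<lambda>T. of_bool (Q (S \<union> T)) :: real) \<le> (1 - p) ^ card (J - K)"
    proof (cases "\<exists>T. T \<subseteq> J - K \<and> Q (S \<union> T)")
      case True
      then obtain T where T: "T \<subseteq> J - K" "Q (S \<union> T)" by auto
      have un: "T' = T" if "T' \<subseteq> J - K" "Q (S \<union> T')" for T'
      proof -
        have "S \<union> T' = S \<union> T" using det[of "S \<union> T'" "S \<union> T"] that T S assms(2) by blast
        then show ?thesis using that T S by blast
      qed
      have "bexp (\<lambda>_. p) (J - K) (\<lambda>T. of_bool (Q (S \<union> T)) :: real)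
         = (\<Sum>T'\<in>Pow (J - K). if T' = T then bern_weight (\<lambda>_. p) (J - K) T' else 0)"
        unfolding bexp_def
      proof (intro sum.cong refl)
        fix T' assume "T' \<in> Pow (J - K)"
        then have "Q (S \<union> T') \<longleftrightarrow> T' = T" using un T by blast
        then show "bern_weight (\<lambda>_. p) (J - K) T' *\<^sub>R (of_bool (Q (S \<union> T')) :: real)
          = (if T' = T then bern_weight (\<lambda>_. p) (J - K) T' else 0)" by simp
      qed
      also have "\<dots> = bern_weight (\<lambda>_. p) (J - K) T"
        using T fin by (subst sum.delta) auto
      \<comment> \<open>This is where \<open>p \<le> 1 / 2\<close> enters: the larger of p and 1 - p
        is 1 - p, which bounds the weight of the single admissible completion coordinate by
        coordinate.\<close>
      also have "\<dots> \<le> (\<Prod>j\<in>J-K. 1 - p)"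
        unfolding bern_weight_def using assms by (intro prod_mono) auto
      finally show ?thesis by simp
    next
      case False
      then have "bexp (\<lambda>_. p) (J - K) (\<lambda>T. of_bool (Q (S \<union> T)) :: real) = 0"
        unfolding bexp_def by (intro sum.neutral) auto
      then show ?thesis using assms by simp
    qed
  qed (use assms in auto)
  finally show ?thesis .
qed

section \<open>Kernel vectors and the moment bound\<close>

text \<open>A solved linear system: \<open>Sel\<close> lists independent 0/1 rows, \<open>K\<close>
  their pivot coordinates, and for each free coordinate i the vector \<open>u i\<close> is the
  solution with entry 1 at i and 0 at the other free coordinates. The last clause says that the
  square system of \<open>Sel\<close> on the coordinates \<open>K\<close> is nonsingular.\<close>

definition echelon :: "'a set \<Rightarrow> 'a set list \<Rightarrow> 'a set \<Rightarrow> ('a \<Rightarrow> 'a \<Rightarrow> real) \<Rightarrow> bool" where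
  "echelon J Sel K u \<longleftrightarrow> K \<subseteq> J \<and> card K = length Sel \<and> (\<forall>S\<in>set Sel. S \<subseteq> J)
     \<and> (\<forall>i\<in>J - K. u i i = 1 \<and> (\<forall>j. j \<notin> K \<longrightarrow> j \<noteq> i \<longrightarrow> u i j = 0) \<and> (\<forall>S\<in>set Sel. ssum S (u i) = 0))
     \<and> (\<forall>v::'a \<Rightarrow> real. (\<forall>j. j \<notin> K \<longrightarrow> v j = 0) \<longrightarrow> (\<forall>S\<in>set Sel. ssum S v = 0) \<longrightarrow> (\<forall>j. v j = 0))"

lemma echelonD:
  assumes "echelon J Sel K u"
  shows "K \<subseteq> J" "card K = length Sel" "\<And>S. S \<in> set Sel \<Longrightarrow> S \<subseteq> J"
    "\<And>i. i \<in> J - K \<Longrightarrow> u i i = 1" "\<And>i j. i \<in> J - K \<Longrightarrow> j \<notin> K \<Longrightarrow> j \<noteq> i \<Longrightarrow> u i j = 0"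
    "\<And>i S. i \<in> J - K \<Longrightarrow> S \<in> set Sel \<Longrightarrow> ssum S (u i) = 0"
  using assms unfolding echelon_def by simp_all

lemma echelon_inj:
  assumes "echelon J Sel K u" "\<And>j. j \<notin> K \<Longrightarrow> v j = 0" "\<And>S. S \<in> set Sel \<Longrightarrow> ssum S v = 0"
  shows "v j = (0::real)"
proof -
  have "(\<forall>j. j \<notin> K \<longrightarrow> v j = 0) \<longrightarrow> (\<forall>S\<in>set Sel. ssum S v = 0) \<longrightarrow> (\<forall>j. v j = 0)"
    using assms(1) unfolding echelon_def by (elim conjE) (erule spec)
  then show ?thesis using assms(2,3) by simp
qed

lemma ssum_diff: "ssum S (\<lambda>j. v j - w j :: 'b::ab_group_add) = ssum S v - ssum S w"
  by (simp add: ssum_def sum_subtractf)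

lemma ssum_cmult: "ssum S (\<lambda>j. c * v j :: 'b::semiring_0) = c * ssum S v"
  by (simp add: ssum_def sum_distrib_left)

lemma echelon_Nil: "echelon J [] {} (\<lambda>i j. if i = j then 1 else 0)"
  by (auto simp: echelon_def)

text \<open>One step of Gaussian elimination. A row not orthogonal to \<open>u i\<close> turns i
  into a pivot, and subtracting the right multiple of \<open>u i\<close> makes the other solutions
  orthogonal to the new row. Their free entries survive because \<open>u i\<close> vanishes at the
  other free coordinates.\<close>

lemma echelon_Cons:
  assumes e: "echelon J Sel K u" and "finite J" "S \<subseteq> J" "i \<in> J - K" "ssum S (u i) \<noteq> 0"
  shows "echelon J (S # Sel) (insert i K) (\<lambda>l j. u l j - ssum S (u l) / ssum S (u i) * u i j)"
proof -
  have fK: "finite K" using finite_subset[OF echelonD(1)[OF e] assms(2)] .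
  have sub: "ssum T (\<lambda>j. u l j - ssum S (u l) / ssum S (u i) * u i j)
    = ssum T (u l) - ssum S (u l) / ssum S (u i) * ssum T (u i)" for T l
    by (simp only: ssum_diff ssum_cmult)
  have 1: "v j = 0"
    if v: "\<And>j. j \<notin> insert i K \<Longrightarrow> v j = (0::real)" "\<And>T. T \<in> set (S # Sel) \<Longrightarrow> ssum T v = 0" for v j
  proof -
    \<comment> \<open>Subtracting \<open>v i\<close> times \<open>u i\<close> clears the new pivot
      and leaves a vector supported on \<open>K\<close>, to which the old nonsingularity
      applies.\<close>
    have z: "v l - v i * u i l = 0" for l
    proof -
      have ui: "u i i = 1" "\<And>j. j \<notin> K \<Longrightarrow> j \<noteq> i \<Longrightarrow> u i j = 0"
        "\<And>T. T \<in> set Sel \<Longrightarrow> ssum T (u i) = 0"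
        using echelonD[OF e] assms(4) by auto
      show ?thesis
      proof (rule echelon_inj[OF e, of "\<lambda>l. v l - v i * u i l"])
        fix j assume j: "j \<notin> K"
        show "v j - v i * u i j = 0"
          using ui(1) ui(2)[OF j] v(1)[of j] j by (cases "j = i") auto
      next
        fix T assume "T \<in> set Sel"
        then show "ssum T (\<lambda>j. v j - v i * u i j) = 0"
          using v(2) ui(3) by (simp add: ssum_diff ssum_cmult)
      qed
    qed
    then have "v l = v i * u i l" for l using iffD1[OF right_minus_eq] by blast
    then have v_eq: "v = (\<lambda>j. v i * u i j)" by (rule ext)
    have "ssum S v = v i * ssum S (u i)" by (subst v_eq) (rule ssum_cmult)
    moreover have "ssum S v = 0" using v(2) by simp
    ultimately have "v i = 0" using assms(5) by simp
    then show ?thesis using z[of j] by simp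
  qed
  show ?thesis
    unfolding echelon_def
  proof (intro conjI)
    show "card (insert i K) = length (S # Sel)"
      using echelonD(2)[OF e] assms(4) fK by simp
    show "\<forall>v. (\<forall>j. j \<notin> insert i K \<longrightarrow> v j = (0::real)) \<longrightarrow> (\<forall>S\<in>set (S # Sel). ssum S v = 0) \<longrightarrow> (\<forall>j. v j = 0)"
      using 1 by blast
    show "\<forall>l\<in>J - insert i K.
       u l l - ssum S (u l) / ssum S (u i) * u i l = 1 \<and>
       (\<forall>j. j \<notin> insert i K \<longrightarrow> j \<noteq> l \<longrightarrow> u l j - ssum S (u l) / ssum S (u i) * u i j = 0) \<and>
       (\<forall>T\<in>set (S # Sel). ssum T (\<lambda>j. u l j - ssum S (u l) / ssum S (u i) * u i j) = 0)"
      unfolding sub using echelonD[OF e] assms(4,5) by auto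
  qed (use echelonD(1,3)[OF e] assms(3,4) in auto)
qed

text \<open>The inner product of a row with \<open>u i\<close> is the contribution of the pivots
  plus the indicator of i. If it vanishes for every free i, that is, if the row depends on the
  selected ones, then the part of the row on \<open>K\<close> decides membership of each free
  coordinate. This is the input for the bound on the probability of a dependent row.\<close>

lemma echelon_dependent_determined:
  assumes e: "echelon J Sel K u" and "finite J" "S \<subseteq> J" "T \<subseteq> J"
    and "\<forall>i\<in>J - K. ssum S (u i) = 0" "\<forall>i\<in>J - K. ssum T (u i) = 0" "S \<inter> K = T \<inter> K"
  shows "S = T"
proof -
  have *: "ssum S (u i) = (\<Sum>j\<in>S\<inter>K. u i j) + of_bool (i \<in> S)" if "S \<subseteq> J" "i \<in> J - K" for S i
  proof -
    have fS: "finite S" using that assms(2) finite_subset by blast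
    have "ssum S (u i) = (\<Sum>j\<in>S\<inter>K. u i j) + (\<Sum>j\<in>S-K. u i j)"
      unfolding ssum_def using fS sum.Int_Diff by blast
    also have "(\<Sum>j\<in>S-K. u i j) = (\<Sum>j\<in>S-K. if j = i then 1 else 0)"
      using echelonD[OF e] that by (intro sum.cong) auto
    also have "\<dots> = of_bool (i \<in> S)"
      using fS that by (subst sum.delta) auto
    finally show ?thesis .
  qed
  have "i \<in> S \<longleftrightarrow> i \<in> T" if "i \<in> J - K" for i
    using *[OF assms(3) that] *[OF assms(4) that] assms(5,6,7) that by (auto split: if_splits)
  then show ?thesis using assms(3,4,7) by blast
qed

lemma ex_echelon:
  assumes "finite J" "\<And>S. S \<in> set L \<Longrightarrow> S \<subseteq> J"
  shows "\<exists>Sel K u. echelon J Sel K u \<and> length Sel \<le> length L \<and>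
    (\<forall>S\<in>set L. \<forall>i\<in>J - K. ssum S (u i) = 0)"
  using assms(2)
proof (induction L)
  case Nil
  then show ?case using echelon_Nil by fastforce
next
  case (Cons S L)
  then obtain Sel K u where *: "echelon J Sel K u" "length Sel \<le> length L"
    "\<forall>S\<in>set L. \<forall>i\<in>J - K. ssum S (u i) = 0" by (metis list.set_intros(2))
  show ?case
  proof (cases "\<forall>i\<in>J - K. ssum S (u i) = 0")
    case True
    then show ?thesis using * by (intro exI[of _ Sel] exI[of _ K] exI[of _ u]) auto
  next
    case False
    then obtain i where i: "i \<in> J - K" "ssum S (u i) \<noteq> 0" by auto
    have "echelon J (S # Sel) (insert i K) (\<lambda>l j. u l j - ssum S (u l) / ssum S (u i) * u i j)"
      using echelon_Cons[OF *(1) assms(1)] i Cons.prems by simp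
    moreover have "\<forall>T\<in>set (S # L). \<forall>l\<in>J - insert i K.
       ssum T (\<lambda>j. u l j - ssum S (u l) / ssum S (u i) * u i j) = 0"
      using *(3) i echelonD(6)[OF *(1)] by (simp only: ssum_diff ssum_cmult) auto
    ultimately show ?thesis using *(2)
      by (intro exI[of _ "S # Sel"] exI[of _ "insert i K"]
        exI[of _ "\<lambda>l j. u l j - ssum S (u l) / ssum S (u i) * u i j"]) simp
  qed
qed

lemma ex_nonzero_kernel_vector:
  assumes "finite J" "\<And>S. S \<in> set L \<Longrightarrow> S \<subseteq> J" "length L < card J"
  shows "\<exists>u::'a \<Rightarrow> real. (\<exists>j\<in>J. u j \<noteq> 0) \<and> (\<forall>j. j \<notin> J \<longrightarrow> u j = 0) \<and> (\<forall>S\<in>set L. ssum S u = 0)"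
proof -
  obtain Sel K u where *: "echelon J Sel K u" "length Sel \<le> length L"
    "\<forall>S\<in>set L. \<forall>i\<in>J - K. ssum S (u i) = 0" using ex_echelon[OF assms(1,2)] by blast
  have "card K < card J" "K \<subseteq> J" using echelonD(1,2)[OF *(1)] *(2) assms(3) by auto
  then obtain i where i: "i \<in> J - K" by (metis Diff_eq_empty_iff ex_in_conv less_irrefl subset_antisym)
  have "u i i \<noteq> 0" "\<forall>j. j \<notin> J \<longrightarrow> u i j = 0"
    using echelonD(4,5)[OF *(1) i] i \<open>K \<subseteq> J\<close> by (simp, metis DiffD1 subsetD)
  then show ?thesis using i *(3) by (intro exI[of _ "u i"]) auto
qed

section \<open>Counting integer points of cubes by moments\<close>

definition cube :: "'a set \<Rightarrow> ('a \<Rightarrow> int) \<Rightarrow> nat \<Rightarrow> ('a \<Rightarrow> int) set" where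
  "cube J c H = PiE J (\<lambda>j. {c j..<c j + int H})"

lemma finite_cube: "finite J \<Longrightarrow> finite (cube J c H)"
  unfolding cube_def by (intro finite_PiE) auto

lemma card_cube: "finite J \<Longrightarrow> card (cube J c H) = H ^ card J"
  unfolding cube_def by (simp add: card_PiE)

text \<open>Fix the coordinates outside \<open>K\<close>. As the pivot block is nonsingular, the
  pivot coordinates are determined by the values of the linear forms in \<open>Sel\<close>, and each
  form takes values in a window of s H consecutive integers. So the sum over a fibre is at most a
  product of one-dimensional sums, \<open>G1 ^ card K\<close>, and there are
  \<open>H ^ (card J - card K)\<close> fibres.\<close>

lemma sum_cube_echelon_le:
  fixes g :: "int \<Rightarrow> real"
  assumes e: "echelon J Sel K u" and J: "finite J" and H: "H > 0" and ks: "card K \<le> s"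
    and g0: "\<And>x. g x \<ge> 0" and G1: "\<And>a. (\<Sum>z\<in>{a..<a + int (s * H)}. g z) \<le> G1"
  shows "(\<Sum>w\<in>cube J c H. \<Prod>S\<leftarrow>Sel. g (y + ssum S w)) \<le> real H ^ (card J - card K) * G1 ^ card K"
proof -
  let ?T = "cube (J - K) c H"
  let ?P = "\<lambda>w. \<Prod>S\<leftarrow>Sel. g (y + ssum S w)"
  define r where "r = length Sel"
  have K: "K \<subseteq> J" "card K = r" "\<And>S. S \<in> set Sel \<Longrightarrow> S \<subseteq> J" using echelonD[OF e] by (auto simp: r_def)
  have fK: "finite K" using K J finite_subset by auto
  have fib: "(\<Sum>w\<in>{w \<in> cube J c H. restrict w (J - K) = x}. ?P w) \<le> G1 ^ r" if x: "x \<in> ?T" for x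
  proof -
    let ?F = "{w \<in> cube J c H. restrict w (J - K) = x}"
    define a where "a l = y + ssum (Sel ! l - K) x + ssum (Sel ! l \<inter> K) c" for l
    define \<Phi> where "\<Phi> w = (\<lambda>l\<in>{..<r}. y + ssum (Sel ! l) w)" for w :: "'a \<Rightarrow> int"
    let ?Z = "PiE {..<r} (\<lambda>l. {a l..<a l + int (s * H)})"
    have im: "\<Phi> ` ?F \<subseteq> ?Z"
    proof
      fix z assume "z \<in> \<Phi> ` ?F"
      then obtain w where w: "w \<in> ?F" "z = \<Phi> w" by auto
      have "y + ssum (Sel ! l) w \<in> {a l..<a l + int (s * H)}" if l: "l < r" for l
      proof -
        let ?S = "Sel ! l"
        have S: "?S \<subseteq> J" using K(3) l by (auto simp: r_def)
        have fS: "finite ?S" using S J finite_subset by auto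
        have "ssum ?S w = ssum (?S \<inter> K) w + ssum (?S - K) w"
          unfolding ssum_def using fS sum.Int_Diff by blast
        also have "ssum (?S - K) w = ssum (?S - K) x"
        proof -
          have "w j = x j" if "j \<in> ?S - K" for j using w that S by force
          then show ?thesis unfolding ssum_def by (intro sum.cong) auto
        qed
        finally have 1: "ssum ?S w = ssum (?S \<inter> K) w + ssum (?S - K) x" .
        have wj: "c j \<le> w j \<and> w j \<le> c j + (int H - 1)" if "j \<in> ?S \<inter> K" for j
          using w(1) that S unfolding cube_def by (force simp: PiE_iff)
        have 2: "ssum (?S \<inter> K) c \<le> ssum (?S \<inter> K) w"
          unfolding ssum_def using wj by (intro sum_mono) auto
        have "ssum (?S \<inter> K) w \<le> (\<Sum>j\<in>?S \<inter> K. c j + (int H - 1))"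
          unfolding ssum_def using wj by (intro sum_mono) auto
        also have "\<dots> = ssum (?S \<inter> K) c + int (card (?S \<inter> K)) * (int H - 1)"
          by (simp add: ssum_def sum.distrib)
        also have "int (card (?S \<inter> K)) * (int H - 1) \<le> int s * (int H - 1)"
          using H ks card_mono[OF fK, of "?S \<inter> K"] by (intro mult_right_mono) auto
        \<comment> \<open>Strictness needs s > 0, which holds because l < card K \<le> s; it places
          the value in the half-open window of length s H.\<close>
        also have "int s * (int H - 1) < int (s * H)"
          using l K(2) ks by (simp add: algebra_simps)
        finally show ?thesis using 1 2 by (auto simp: a_def)
      qed
      then show "z \<in> ?Z" by (auto simp: w(2) \<Phi>_def)
    qed
    have inj: "inj_on \<Phi> ?F"
    proof (rule inj_onI)
      fix w w' assume w: "w \<in> ?F" "w' \<in> ?F" and ww: "\<Phi> w = \<Phi> w'"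
      have eqo: "w j = w' j" if "j \<notin> K" for j
      proof (cases "j \<in> J")
        case True
        then show ?thesis 
        proof -
          have "restrict w (J - K) = restrict w' (J - K)" using w(1,2) by simp
          then have "restrict w (J - K) j = restrict w' (J - K) j" by simp
          then show ?thesis using True that by simp
        qed
      next
        case False
        
        have "w \<in> cube J c H" "w' \<in> cube J c H" using w(1,2) by simp_all
        then show ?thesis using PiE_arb[OF _ False] unfolding cube_def by metis
      qed
      have "ssum S (\<lambda>j. real_of_int (w j - w' j)) = 0" if "S \<in> set Sel" for S
      proof -
        obtain l where l: "l < r" "S = Sel ! l" using \<open>S \<in> set Sel\<close>
          by (auto simp: r_def in_set_conv_nth)
        have "ssum S w = ssum S w'" using fun_cong[OF ww, of l] l by (simp add: \<Phi>_def)
        then have "ssum S (\<lambda>j. w j - w' j) = 0" by (simp add: ssum_diff)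
        then have "real_of_int (\<Sum>j\<in>S. w j - w' j) = 0" by (simp only: ssum_def of_int_0)
        then show ?thesis by (simp only: ssum_def of_int_sum)
      qed
      note orth = this
      have "real_of_int (w j - w' j) = 0" for j
      proof (rule echelon_inj[OF e, of "\<lambda>j. real_of_int (w j - w' j)"])
        show "real_of_int (w j - w' j) = 0" if "j \<notin> K" for j using eqo[OF that] by simp
      qed (use orth in auto)
      then have "w j = w' j" for j by (metis of_int_eq_0_iff right_minus_eq)
      then show "w = w'" by (rule ext)
    qed
    have "(\<Sum>w\<in>?F. ?P w) = (\<Sum>w\<in>?F. \<Prod>l<r. g (\<Phi> w l))"
      by (intro sum.cong refl) (simp add: prod.list_conv_set_nth r_def \<Phi>_def atLeast0LessThan)
    also have "\<dots> = (\<Sum>z\<in>\<Phi> ` ?F. \<Prod>l<r. g (z l))"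
      by (simp add: sum.reindex[OF inj])
    also have "\<dots> \<le> (\<Sum>z\<in>?Z. \<Prod>l<r. g (z l))"
      using im g0 by (intro sum_mono2 finite_PiE prod_nonneg) auto
    also have "\<dots> = (\<Prod>l<r. \<Sum>z\<in>{a l..<a l + int (s * H)}. g z)"
      by (subst prod_sum_PiE) auto
    also have "\<dots> \<le> (\<Prod>l<r. G1)" using G1 g0 by (intro prod_mono conjI sum_nonneg) auto
    finally show ?thesis by simp
  qed
  have "(\<Sum>w\<in>cube J c H. ?P w) = (\<Sum>x\<in>?T. \<Sum>w\<in>{w \<in> cube J c H. restrict w (J - K) = x}. ?P w)"
    using J by (intro sum.group[symmetric] finite_cube) (auto simp: cube_def PiE_iff)
  also have "\<dots> \<le> (\<Sum>x\<in>?T. G1 ^ r)" using fib by (intro sum_mono) auto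
  also have "\<dots> = real H ^ (card J - card K) * G1 ^ card K"
    using J K fK by (simp add: card_cube card_Diff_subset)
  finally show ?thesis .
qed

text \<open>A new row is dependent on the previous ones with probability at most \<open>(1 - p) ^ (card J - s)\<close>;
  an independent row contributes a factor \<open>G1 / H\<close>.\<close>

lemma moment_bound:
  fixes g :: "int \<Rightarrow> real"
  assumes J: "finite J" and H: "H > 0" and p: "0 \<le> p" "p \<le> 1 / 2" and sJ: "s \<le> card J"
    and g0: "\<And>x. g x \<ge> 0" and gG: "\<And>x. g x \<le> G"
    and G1: "\<And>a. (\<Sum>z\<in>{a..<a + int (s * H)}. g z) \<le> G1"
  shows "(\<Sum>w\<in>cube J c H. (bexp (\<lambda>_. p) J (\<lambda>S. g (y + ssum S w))) ^ s)
    \<le> real H ^ card J * (G1 / real H + G * (1 - p) ^ (card J - s)) ^ s"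
proof -
  let ?E = "\<lambda>w. bexp (\<lambda>_. p) J (\<lambda>S. g (y + ssum S w))"
  define a where "a = G1 / real H"
  define b where "b = (1 - p) ^ (card J - s)"
  \<comment> \<open>The s-th power stands for s independent copies of the random row, and
    \<open>V t Sel\<close> is the moment after some of them have been exposed: the independent ones
    are recorded in \<open>Sel\<close>, the dependent ones have been paid for by the factor G, and t
    copies are still averaged.\<close>
  define V where "V t Sel = (\<Sum>w\<in>cube J c H. (\<Prod>S\<leftarrow>Sel. g (y + ssum S w)) * ?E w ^ t)" for t Sel
  have p01: "0 \<le> p \<and> p \<le> 1" using p by auto
  have E0: "?E w \<ge> 0" for w using p01 g0 by (intro bexp_nonneg) auto
  have G10: "G1 \<ge> 0" using order_trans[OF sum_nonneg G1[of 0]] g0 by simp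
  have a0: "a \<ge> 0" using G10 by (simp add: a_def)
  have b0: "b \<ge> 0" using p by (simp add: b_def)
  have G0: "G \<ge> 0" using order_trans[OF g0 gG] .
  have V0: "V t Sel \<ge> 0" for t Sel
    unfolding V_def using E0 g0 by (intro sum_nonneg mult_nonneg_nonneg prod_list_nonneg) auto
  have main: "V t Sel \<le> real H ^ card J * a ^ card K * (a + G * b) ^ t"
    if "echelon J Sel K u" "card K + t \<le> s" for t Sel K u
    using that
  proof (induction t arbitrary: Sel K u)
    case 0
    have "V 0 Sel \<le> real H ^ (card J - card K) * G1 ^ card K"
      unfolding V_def using sum_cube_echelon_le[OF 0(1) J H _ g0 G1] 0 by simp
    also have "\<dots> = real H ^ card J * a ^ card K"
    proof -
      have "card K \<le> card J" using 0 sJ by simp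
      then have "real H ^ card J = real H ^ (card J - card K) * real H ^ card K"
        by (simp flip: power_add)
      then show ?thesis using H by (simp add: a_def power_divide)
    qed
    finally show ?case by simp
  next
    case (Suc t)
    let ?dep = "\<lambda>S. S \<subseteq> J \<and> (\<forall>i\<in>J - K. ssum S (u i) = 0)"
    let ?X = "real H ^ card J * a ^ card K * (a + G * b) ^ t"
    have X0: "?X \<ge> 0" using a0 b0 G0 by simp
    have K: "K \<subseteq> J" "finite K" using echelonD(1)[OF Suc.prems(1)] finite_subset[OF _ J] by auto
    have key: "V t (S # Sel) \<le> (G * ?X) * of_bool (?dep S) + a * ?X" if S: "S \<subseteq> J" for S
      proof (cases "?dep S")
        case True
        have "V t (S # Sel) \<le> (\<Sum>w\<in>cube J c H. G * ((\<Prod>S\<leftarrow>Sel. g (y + ssum S w)) * ?E w ^ t))"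
          unfolding V_def
        proof (rule sum_mono)
          fix w
          have "0 \<le> (\<Prod>S\<leftarrow>Sel. g (y + ssum S w)) * ?E w ^ t"
            using E0 g0 by (intro mult_nonneg_nonneg prod_list_nonneg) auto
          then show "(\<Prod>S\<leftarrow>S # Sel. g (y + ssum S w)) * ?E w ^ t \<le> G * ((\<Prod>S\<leftarrow>Sel. g (y + ssum S w)) * ?E w ^ t)"
            using mult_right_mono[OF gG] by (simp add: mult.assoc)
        qed
        also have "\<dots> = G * V t Sel" by (simp add: V_def sum_distrib_left)
        also have "\<dots> \<le> G * ?X" using Suc.IH[OF Suc.prems(1)] Suc.prems(2) G0 by (intro mult_left_mono) auto
        finally show ?thesis using True a0 X0 by (simp add: add_increasing2)
      next
        case False
        then obtain i where i: "i \<in> J - K" "ssum S (u i) \<noteq> 0" using S by auto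
        have "V t (S # Sel) \<le> real H ^ card J * a ^ card (insert i K) * (a + G * b) ^ t"
          using Suc.IH[OF echelon_Cons[OF Suc.prems(1) J S i]] Suc.prems(2) i K by simp
        also have "\<dots> = a * ?X" using i K by simp
        finally have "V t (S # Sel) \<le> a * ?X" .
        moreover have "of_bool (?dep S) = (0::real)" unfolding of_bool_eq_0_iff by (rule False)
        ultimately show ?thesis by (simp only: mult_zero_right add_0)
      qed
    have "V (Suc t) Sel = (\<Sum>w\<in>cube J c H. bexp (\<lambda>_. p) J (\<lambda>S. (\<Prod>S\<leftarrow>Sel. g (y + ssum S w)) * ?E w ^ t * g (y + ssum S w)))"
      unfolding V_def bexp_cmult by (intro sum.cong) (simp_all add: mult_ac)
    also have "\<dots> = bexp (\<lambda>_. p) J (\<lambda>S. V t (S # Sel))"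
      unfolding V_def bexp_sum[symmetric] by (intro bexp_cong sum.cong) (simp_all add: mult_ac)
    also have "\<dots> \<le> bexp (\<lambda>_. p) J (\<lambda>S. (G * ?X) * of_bool (?dep S) + a * ?X)"
      using p01 key by (intro bexp_mono)
    also have "\<dots> = (G * ?X) * bexp (\<lambda>_. p) J (\<lambda>S. of_bool (?dep S)) + a * ?X"
      using J by (simp add: bexp_add bexp_cmult bexp_const)
    also have "\<dots> \<le> (G * ?X) * b + a * ?X"
    proof -
      have "bexp (\<lambda>_. p) J (\<lambda>S. of_bool (?dep S)) \<le> (1 - p) ^ card (J - K)"
        using echelon_dependent_determined[OF Suc.prems(1) J] K J p
        by (intro bexp_determined_le) blast+
      also have "\<dots> \<le> b"
        unfolding b_def using p K J Suc.prems(2)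
        by (intro power_decreasing) (auto simp: card_Diff_subset)
      finally show ?thesis using mult_nonneg_nonneg[OF G0 X0] by (intro add_right_mono mult_left_mono)
    qed
    also have "\<dots> = real H ^ card J * a ^ card K * (a + G * b) ^ Suc t"
      by (simp add: algebra_simps)
    finally show ?case .
  qed
  show ?thesis using main[OF echelon_Nil[of J], of s] by (simp add: V_def a_def b_def)
qed

section \<open>Fourier analysis modulo \<open>q\<close>\<close>

definition chi :: "nat \<Rightarrow> int \<Rightarrow> complex" where
  "chi q x = cis (2 * pi * real_of_int x / real q)"

lemma chi_add: "chi q (x + y) = chi q x * chi q y"
  by (simp add: chi_def cis_mult add_divide_distrib distrib_left)

lemma chi_0 [simp]: "chi q 0 = 1" by (simp add: chi_def)

lemma norm_chi [simp]: "norm (chi q x) = 1" by (simp add: chi_def)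

lemma cnj_chi: "cnj (chi q x) = chi q (- x)" by (simp add: chi_def cis_cnj)

lemma chi_mult_nat: "chi q (int j * x) = chi q x ^ j"
proof (induction j)
  case (Suc j)
  have "int (Suc j) * x = x + int j * x" by (simp add: algebra_simps)
  then show ?case using Suc by (simp add: chi_add)
qed simp

lemma chi_dvd: "int q dvd x \<Longrightarrow> chi q x = 1"
proof (cases "q = 0")
  case False
  assume "int q dvd x"
  then obtain k where "x = int q * k" by (elim dvdE)
  then have "2 * pi * real_of_int x / real q = 2 * pi * real_of_int k" using False by simp
  then have "chi q x = cis (2 * pi * real_of_int k)" unfolding chi_def by (rule arg_cong)
  then show ?thesis using cis_multiple_2pi[OF Ints_of_int, of k] by (rule trans)
qed (simp add: chi_def)

lemma chi_eq_1_imp: "q > 0 \<Longrightarrow> chi q x = 1 \<Longrightarrow> int q dvd x"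
proof -
  assume q: "q > 0" and "chi q x = 1"
  then have "cos (2 * pi * real_of_int x / real q) = 1" by (simp add: chi_def complex_eq_iff)
  then obtain k :: int where "2 * pi * real_of_int x / real q = real_of_int k * 2 * pi"
    using cos_one_2pi_int by auto
  then have "real_of_int x = real_of_int k * real q" using q by (simp add: field_simps)
  then have "real_of_int x = real_of_int (k * int q)" by simp
  then have "x = k * int q" by (simp only: of_int_eq_iff)
  then show ?thesis by simp
qed

lemma sum_chi:
  assumes "q > 0"
  shows "(\<Sum>j<q. chi q (int j * x)) = (if int q dvd x then of_nat q else 0)"
proof (cases "int q dvd x")
  case True
  then show ?thesis by (simp add: chi_dvd)
next
  case False
  then have 1: "chi q x \<noteq> 1" using chi_eq_1_imp assms by blast
  have 2: "chi q x ^ q = 1" using chi_dvd[of q "int q * x"] by (simp add: chi_mult_nat)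
  show ?thesis unfolding chi_mult_nat using sum_gp_strict[of "chi q x" q] 1 2 False by simp
qed

lemma plancherel:
  assumes "q > 0"
  shows "(\<Sum>y<q. (norm (\<Sum>j<q. a j * chi q (int j * int y)))\<^sup>2) = real q * (\<Sum>j<q. (norm (a j))\<^sup>2)"
proof -
  have "complex_of_real (\<Sum>y<q. (norm (\<Sum>j<q. a j * chi q (int j * int y)))\<^sup>2)
     = (\<Sum>y<q. (\<Sum>j<q. a j * chi q (int j * int y)) * cnj (\<Sum>j<q. a j * chi q (int j * int y)))"
    by (simp only: of_real_sum complex_norm_square)
  also have "\<dots> = (\<Sum>y<q. \<Sum>j<q. \<Sum>l<q. (a j * cnj (a l)) * chi q (int y * (int j - int l)))"
    by (intro sum.cong refl) (simp add: sum_product cnj_chi chi_add[symmetric] mult_ac algebra_simps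
        flip: chi_add)
  also have "\<dots> = (\<Sum>j<q. \<Sum>l<q. (a j * cnj (a l)) * (\<Sum>y<q. chi q (int y * (int j - int l))))"
    unfolding sum_distrib_left
    by (rule trans[OF sum.swap], rule sum.cong[OF refl], rule sum.swap)
  also have "\<dots> = (\<Sum>j<q. \<Sum>l<q. if l = j then (a j * cnj (a j)) * of_nat q else 0)"
  proof (intro sum.cong refl)
    fix j l assume "j \<in> {..<q}" "l \<in> {..<q}"
    then have "int q dvd int j - int l \<longleftrightarrow> l = j"
      by (simp flip: mod_eq_dvd_iff) (auto simp: zmod_int)
    then show "a j * cnj (a l) * (\<Sum>y<q. chi q (int y * (int j - int l)))
        = (if l = j then (a j * cnj (a j)) * of_nat q else 0)"
      using sum_chi[OF assms, of "int j - int l"] by auto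
  qed
  also have "\<dots> = complex_of_real (real q * (\<Sum>j<q. (norm (a j))\<^sup>2))"
    by (simp add: sum.delta complex_norm_square[symmetric] sum_distrib_left mult_ac)
  finally show ?thesis by (simp only: of_real_eq_iff)
qed

section \<open>Fourier coefficients of residue probabilities\<close>

definition phi :: "nat \<Rightarrow> real \<Rightarrow> 'a set \<Rightarrow> ('a \<Rightarrow> int) \<Rightarrow> nat \<Rightarrow> complex" where
  "phi q p J w j = bexp (\<lambda>_. p) J (\<lambda>S. chi q (int j * ssum S w))"

definition avg_chi :: "nat \<Rightarrow> nat \<Rightarrow> nat \<Rightarrow> complex" where
  "avg_chi q r j = (\<Sum>a<r. chi q (int j * int a)) / of_nat r"

text \<open>A moving average over r consecutive integers. Its Fourier multiplier is
  \<open>avg_chi\<close>, which decays away from frequency 0; iterating it h times suppresses the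
  high frequencies, at the price of replacing exact residues by windows.\<close>

definition avg :: "nat \<Rightarrow> (int \<Rightarrow> real) \<Rightarrow> int \<Rightarrow> real" where
  "avg r g y = (\<Sum>a<r. g (y + int a)) / real r"

text \<open>The probability that the inner product is congruent to -y modulo q. Modulo q the Fourier
  expansion is finite, and the probability of an exact value is at most that of its residue
  class.\<close>

definition res_prob :: "nat \<Rightarrow> real \<Rightarrow> 'a set \<Rightarrow> ('a \<Rightarrow> int) \<Rightarrow> int \<Rightarrow> real" where
  "res_prob q p J w y = bexp (\<lambda>_. p) J (\<lambda>S. of_bool (int q dvd y + ssum S w))"

definition fourier_rep :: "nat \<Rightarrow> (int \<Rightarrow> real) \<Rightarrow> (nat \<Rightarrow> complex) \<Rightarrow> bool" where
  "fourier_rep q g c \<longleftrightarrow> (\<forall>y. complex_of_real (g y) = (\<Sum>j<q. c j * chi q (int j * y)))"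

lemma bexp_of_real: "complex_of_real (bexp \<pi> J F) = bexp \<pi> J (\<lambda>S. complex_of_real (F S))"
  by (simp add: bexp_def scaleR_conv_of_real)

text \<open>Averaging over a random shift is a convolution, so it multiplies the Fourier
  coefficients by the characteristic function.\<close>

lemma fourier_rep_bexp:
  assumes "fourier_rep q g c"
  shows "fourier_rep q (\<lambda>y. bexp (\<lambda>_. p) J (\<lambda>S. g (y + ssum S w))) (\<lambda>j. c j * phi q p J w j)"
  unfolding fourier_rep_def
proof
  fix y
  have "complex_of_real (bexp (\<lambda>_. p) J (\<lambda>S. g (y + ssum S w)))
     = bexp (\<lambda>_. p) J (\<lambda>S. \<Sum>j<q. (c j * chi q (int j * y)) * chi q (int j * ssum S w))"
    using assms by (simp add: bexp_of_real fourier_rep_def distrib_left chi_add mult_ac)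
  also have "\<dots> = (\<Sum>j<q. c j * phi q p J w j * chi q (int j * y))"
    unfolding bexp_sum bexp_cmult phi_def by (simp add: mult_ac)
  finally show "complex_of_real (bexp (\<lambda>_. p) J (\<lambda>S. g (y + ssum S w)))
    = (\<Sum>j<q. c j * phi q p J w j * chi q (int j * y))" .
qed

lemma fourier_rep_avg:
  assumes "fourier_rep q g c"
  shows "fourier_rep q (avg r g) (\<lambda>j. c j * avg_chi q r j)"
  unfolding fourier_rep_def
proof
  fix y
  have "complex_of_real (avg r g y) = (\<Sum>a<r. \<Sum>j<q. (c j * chi q (int j * y)) * chi q (int j * int a)) / of_nat r"
    using assms by (simp add: avg_def fourier_rep_def distrib_left chi_add mult_ac)
  also have "\<dots> = (\<Sum>j<q. c j * avg_chi q r j * chi q (int j * y))"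
    by (subst sum.swap)
      (simp add: avg_chi_def sum_distrib_left sum_divide_distrib mult_ac sum_distrib_right)
  finally show "complex_of_real (avg r g y) = (\<Sum>j<q. c j * avg_chi q r j * chi q (int j * y))" .
qed

lemma fourier_rep_avg_pow:
  assumes "fourier_rep q g c"
  shows "fourier_rep q ((avg r ^^ h) g) (\<lambda>j. c j * avg_chi q r j ^ h)"
proof (induction h)
  case (Suc h)
  then show ?case using fourier_rep_avg[OF Suc] by (simp add: mult_ac)
qed (use assms in simp)

lemma fourier_rep_dvd:
  assumes "q > 0"
  shows "fourier_rep q (\<lambda>y. of_bool (int q dvd y)) (\<lambda>_. 1 / of_nat q)"
  unfolding fourier_rep_def
  using sum_chi[OF assms] assms by (auto simp flip: sum_divide_distrib)

lemma fourier_rep_res_prob: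
  assumes "q > 0"
  shows "fourier_rep q (res_prob q p J w) (\<lambda>j. phi q p J w j / of_nat q)"
  using fourier_rep_bexp[OF fourier_rep_dvd[OF assms], of p J w]
  by (simp add: res_prob_def[abs_def])

lemma fourier_rep_plancherel:
  assumes "q > 0" "fourier_rep q g c"
  shows "(\<Sum>y<q. (g (int y))\<^sup>2) = real q * (\<Sum>j<q. (norm (c j))\<^sup>2)"
proof -
  have "(g (int y))\<^sup>2 = (norm (\<Sum>j<q. c j * chi q (int j * int y)))\<^sup>2" for y
  proof -
    have "norm (complex_of_real (g (int y))) = norm (\<Sum>j<q. c j * chi q (int j * int y))"
      using assms(2) unfolding fourier_rep_def by (simp only:)
    then show ?thesis by (metis norm_of_real power2_abs)
  qed
  then show ?thesis using plancherel[OF assms(1), of c] by simp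
qed

lemma sum_res_prob:
  assumes "q > 0" "finite J"
  shows "(\<Sum>y<q. res_prob q p J w (int y)) = 1"
proof -
  have "(\<Sum>y<q. of_bool (int q dvd int y + x)) = (1::real)" for x
  proof -
    have "int q dvd int y + x \<longleftrightarrow> y = nat ((- x) mod int q)" if "y < q" for y
    proof -
      have "int q dvd int y + x \<longleftrightarrow> int y mod int q = (- x) mod int q"
        by (simp add: mod_eq_dvd_iff)
      also have "\<dots> \<longleftrightarrow> int y = (- x) mod int q" using that by simp
      also have "\<dots> \<longleftrightarrow> y = nat ((- x) mod int q)" using assms(1) by auto
      finally show ?thesis .
    qed
    then have "(\<Sum>y<q. of_bool (int q dvd int y + x)) = (\<Sum>y<q. if y = nat ((- x) mod int q) then 1 else (0::real))"
      by (intro sum.cong) auto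
    also have "\<dots> = 1" using assms(1) by (subst sum.delta) (auto simp: nat_less_iff)
    finally show ?thesis .
  qed
  then show ?thesis using assms(2) by (simp add: res_prob_def bexp_const flip: bexp_sum)
qed

lemma res_prob_nonneg: "0 \<le> p \<Longrightarrow> p \<le> 1 \<Longrightarrow> res_prob q p J w y \<ge> 0"
  unfolding res_prob_def by (intro bexp_nonneg) auto

section \<open>Distance to the multiples of q, and the decay of characteristic functions\<close>

definition cdist :: "nat \<Rightarrow> int \<Rightarrow> int" where
  "cdist q x = min (x mod int q) (int q - x mod int q)"

text \<open>Taylor expansion up to the cubic term with remainder. The number 8/5 is a rational bound
  just above pi / 2, the range of half of an angle in [0, pi].\<close>

lemma half_le_sin:
  fixes y :: real assumes "0 \<le> y" "y \<le> 8 / 5" shows "y / 2 \<le> sin y"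
proof -
  have "\<bar>sin y - (\<Sum>m<5. sin_coeff m * y ^ m)\<bar> \<le> inverse (fact 5) * \<bar>y\<bar> ^ 5"
    by (rule Maclaurin_sin_bound)
  moreover have "(\<Sum>m<5. sin_coeff m * y ^ m) = y - y ^ 3 / 6"
  proof -
    have "{..<5::nat} = {0, 1, 2, 3, 4}" by auto
    then show ?thesis by (simp add: sin_coeff_def fact_numeral power3_eq_cube)
  qed
  moreover have "inverse (fact 5) * \<bar>y\<bar> ^ 5 = y ^ 5 / 120"
    using assms by (simp add: fact_numeral)
  ultimately have "sin y \<ge> y - y ^ 3 / 6 - y ^ 5 / 120" by linarith
  moreover have "y ^ 3 / 6 + y ^ 5 / 120 \<le> y / 2"
  proof -
    have "y\<^sup>2 \<le> (8/5)\<^sup>2" using assms by (intro power_mono)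
    moreover have "y ^ 4 \<le> (8/5) ^ 4" using assms by (intro power_mono)
    ultimately have "y\<^sup>2 / 6 + y ^ 4 / 120 \<le> 1 / 2" by (simp add: power2_eq_square power4_eq_xxxx)
    then have "y * (y\<^sup>2 / 6 + y ^ 4 / 120) \<le> y * (1 / 2)" using assms by (intro mult_left_mono)
    moreover have "y * (y\<^sup>2 / 6 + y ^ 4 / 120) = y ^ 3 / 6 + y ^ 5 / 120"
      by (simp add: algebra_simps numeral_eq_Suc)
    ultimately show ?thesis by linarith
  qed
  ultimately show ?thesis by linarith
qed

text \<open>By the half-angle formula 1 - cos x = 2 (sin (x / 2))^2, which is at least 2 (x /
  4)^2.\<close>

lemma one_minus_cos_ge:
  fixes x :: real assumes "\<bar>x\<bar> \<le> pi" shows "x\<^sup>2 / 8 \<le> 1 - cos x"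
proof -
  define y where "y = \<bar>x\<bar> / 2"
  have y: "0 \<le> y" "y \<le> 8 / 5" using assms pi_approx(2) by (auto simp: y_def)
  have "1 - cos x = 2 * (sin y)\<^sup>2" using cos_double_sin[of y] by (simp add: y_def)
  moreover have "(y / 2)\<^sup>2 \<le> (sin y)\<^sup>2" using half_le_sin[OF y] y by (intro power_mono) auto
  moreover have "x\<^sup>2 / 8 = 2 * (y / 2)\<^sup>2" by (simp add: y_def power_divide)
  ultimately show ?thesis by simp
qed

lemma cdist_props:
  assumes "q > 0"
  shows "0 \<le> cdist q x" "2 * cdist q x \<le> int q" "\<exists>m. cdist q x = \<bar>x - m * int q\<bar>"
proof -
  have x: "0 \<le> x mod int q" "x mod int q < int q" using assms by auto
  show "0 \<le> cdist q x" using x unfolding cdist_def min_def by simp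
  show "2 * cdist q x \<le> int q" using x unfolding cdist_def
    by (cases "x mod int q \<le> int q - x mod int q") (simp_all add: min_def)
  have e: "x = x div int q * int q + x mod int q" by simp
  show "\<exists>m. cdist q x = \<bar>x - m * int q\<bar>"
  proof (cases "x mod int q \<le> int q - x mod int q")
    case True
    have "x - (x div int q) * int q = x mod int q" using e by linarith
    then show ?thesis using True x by (intro exI[of _ "x div int q"]) (simp only: cdist_def min_def if_True abs_of_nonneg)
  next
    case False
    have "x - (x div int q + 1) * int q = x mod int q - int q" using e by (simp add: algebra_simps)
    then show ?thesis using False x by (intro exI[of _ "x div int q + 1"]) (simp add: cdist_def)
  qed
qed

lemma cdist_eqI:
  assumes "q > 0" "2 * \<bar>x - m * int q\<bar> \<le> int q"
  shows "cdist q x = \<bar>x - m * int q\<bar>"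
proof -
  define y where "y = x - m * int q"
  have xy: "x = y + m * int q" by (simp add: y_def)
  have y: "2 * \<bar>y\<bar> \<le> int q" using assms by (simp add: y_def)
  have "cdist q x = cdist q y" unfolding xy cdist_def by simp
  also have "\<dots> = \<bar>y\<bar>"
  proof (cases "y \<ge> 0")
    case True
    then have "y mod int q = y" using y assms by (intro mod_pos_pos_trivial) auto
    then show ?thesis using True y by (simp add: cdist_def)
  next
    case False
    have "y mod int q = (y + int q) mod int q" by simp
    also have "\<dots> = y + int q" using False y assms by (intro mod_pos_pos_trivial) auto
    finally show ?thesis using False y by (simp add: cdist_def)
  qed
  finally show ?thesis by (simp add: y_def)
qed

lemma Re_chi_le:
  assumes "q > 0"
  shows "Re (chi q x) \<le> 1 - 4 * (real_of_int (cdist q x) / real q)\<^sup>2"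
proof -
  obtain m where m: "cdist q x = \<bar>x - m * int q\<bar>" using cdist_props[OF assms] by blast
  define z where "z = 2 * pi * real_of_int (x - m * int q) / real q"
  define d where "d = real_of_int (cdist q x) / real q"
  have d: "0 \<le> d" "d \<le> 1 / 2"
    using cdist_props(1,2)[OF assms, of x] assms by (auto simp: d_def field_simps)
  have z: "\<bar>z\<bar> = 2 * pi * d" using m by (simp add: z_def d_def abs_mult)
  have "chi q x = chi q (x - m * int q) * chi q (int q * m)"
    unfolding chi_add[symmetric] by (simp add: mult.commute)
  then have "chi q x = cis z" using chi_dvd[of q "int q * m"] by (simp add: chi_def z_def)
  then have "Re (chi q x) = cos z" by simp
  moreover have "z\<^sup>2 / 8 \<le> 1 - cos z" using z d by (intro one_minus_cos_ge) (simp add: field_simps)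
  moreover have "4 * d\<^sup>2 \<le> z\<^sup>2 / 8"
  proof -
    have "z\<^sup>2 = (2 * pi * d)\<^sup>2" unfolding z[symmetric] by simp
    then have "z\<^sup>2 = 4 * (pi\<^sup>2 * d\<^sup>2)" by (simp add: power_mult_distrib)
    moreover have "9 * d\<^sup>2 \<le> pi\<^sup>2 * d\<^sup>2"
      using pi_approx(1) power_mono[of 3 pi 2] by (intro mult_right_mono) auto
    moreover have "0 \<le> d\<^sup>2" by simp
    ultimately show ?thesis by linarith
  qed
  ultimately show ?thesis by (simp add: d_def)
qed

lemma phi_prod:
  assumes "finite J"
  shows "phi q p J w j = (\<Prod>i\<in>J. of_real p * chi q (int j * w i) + of_real (1 - p))"
proof -
  have "chi q (int j * ssum S w) = (\<Prod>i\<in>J. if i \<in> S then chi q (int j * w i) else 1)" if "S \<subseteq> J" for S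
  proof -
    have fS: "finite S" using that assms finite_subset by blast
    have "chi q (\<Sum>i\<in>S. int j * w i) = (\<Prod>i\<in>S. chi q (int j * w i))"
      using fS by (induction S rule: finite_induct) (auto simp: chi_add)
    also have "\<dots> = (\<Prod>i\<in>J. if i \<in> S then chi q (int j * w i) else 1)"
      using that assms by (simp add: prod.If_cases Int_absorb1)
    finally show ?thesis by (simp add: ssum_def sum_distrib_left)
  qed
  then have "phi q p J w j = bexp (\<lambda>_. p) J (\<lambda>S. \<Prod>i\<in>J. if i \<in> S then chi q (int j * w i) else 1)"
    unfolding phi_def by (intro bexp_cong)
  then show ?thesis by (simp add: bexp_prod[OF assms] scaleR_conv_of_real)
qed

definition ffac :: "nat \<Rightarrow> real \<Rightarrow> int \<Rightarrow> real" where
  "ffac q p x = norm (of_real p * chi q x + of_real (1 - p))"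

lemma norm_phi: "finite J \<Longrightarrow> norm (phi q p J w j) = (\<Prod>i\<in>J. ffac q p (int j * w i))"
  by (simp add: phi_prod ffac_def prod_norm)

text \<open>For z on the unit circle, the squared modulus of p z + 1 - p is 1 - 2 p (1 - p) (1 - Re
  z). It remains to use 1 + x \<le> exp x and the quadratic bound for the real part of a
  character.\<close>

lemma ffac_le_exp:
  assumes "q > 0" "0 \<le> p" "p \<le> 1 / 2"
  shows "ffac q p x \<le> exp (- p * (real_of_int (cdist q x) / real q)\<^sup>2)"
proof -
  let ?d = "(real_of_int (cdist q x) / real q)\<^sup>2"
  define c where "c = Re (chi q x)"
  have n1: "(Re (chi q x))\<^sup>2 + (Im (chi q x))\<^sup>2 = 1"
    using norm_chi[of q x] cmod_power2[of "chi q x"] by simp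
  have "(ffac q p x)\<^sup>2 = (p * c + (1 - p))\<^sup>2 + (p * Im (chi q x))\<^sup>2"
    unfolding ffac_def cmod_power2 c_def by simp
  also have "\<dots> = p\<^sup>2 * ((Re (chi q x))\<^sup>2 + (Im (chi q x))\<^sup>2) + 2 * p * (1 - p) * c + (1 - p)\<^sup>2"
    unfolding c_def by (simp add: power2_eq_square algebra_simps)
  also have "\<dots> = 1 + (- (2 * p * (1 - p) * (1 - c)))"
    unfolding n1 by (simp add: power2_eq_square algebra_simps)
  also have "\<dots> \<le> exp (- (2 * p * (1 - p) * (1 - c)))" by (rule exp_ge_add_one_self)
  also have "\<dots> \<le> exp (- (2 * p * ?d))"
  proof -
    have "2 * p * ?d = 2 * p * ((1/4) * (4 * ?d))" by simp
    also have "\<dots> \<le> 2 * p * ((1 - p) * (1 - c))"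
    proof (intro mult_left_mono mult_mono)
      show "4 * ?d \<le> 1 - c" using Re_chi_le[OF assms(1), of x] by (simp add: c_def)
      then show "0 \<le> 4 * ?d" by simp
    qed (use assms in auto)
    finally show ?thesis by (simp add: mult.assoc)
  qed
  also have "\<dots> = (exp (- p * ?d))\<^sup>2" by (simp add: exp_double[symmetric])
  finally show ?thesis by (rule power2_le_imp_le) simp
qed

lemma ffac_nonneg: "ffac q p x \<ge> 0" by (simp add: ffac_def)

lemma ffac_le_1: "q > 0 \<Longrightarrow> 0 \<le> p \<Longrightarrow> p \<le> 1 / 2 \<Longrightarrow> ffac q p x \<le> 1"
  using ffac_le_exp[of q p x] by (auto elim!: order_trans)

lemma norm_phi_le_1: "q > 0 \<Longrightarrow> finite J \<Longrightarrow> 0 \<le> p \<Longrightarrow> p \<le> 1 / 2 \<Longrightarrow> norm (phi q p J w j) \<le> 1"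
  unfolding norm_phi by (intro prod_le_1) (auto simp: ffac_nonneg ffac_le_1)

lemma norm_avg_chi_le_1: "r > 0 \<Longrightarrow> norm (avg_chi q r j) \<le> 1"
proof -
  assume "r > 0"
  moreover have "norm (\<Sum>a<r. chi q (int j * int a)) \<le> real r"
    by (rule order_trans[OF sum_norm_le[of _ _ "\<lambda>_. 1"]]) auto
  ultimately show ?thesis by (simp add: avg_chi_def norm_divide)
qed

text \<open>A geometric sum: the numerator has modulus at most 2, and the denominator is at least
  twice the distance of j / q from the integers.\<close>

lemma norm_avg_chi_le:
  assumes "q > 0" "r > 0" "cdist q (int j) > 0"
  shows "norm (avg_chi q r j) \<le> real q / (real r * real_of_int (cdist q (int j)))"
proof -
  define z where "z = chi q (int j)"
  define d where "d = real_of_int (cdist q (int j)) / real q"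
  have d: "d > 0" using assms by (simp add: d_def)
  have n1: "(Re z)\<^sup>2 + (Im z)\<^sup>2 = 1"
    using norm_chi[of q "int j"] cmod_power2[of z] by (simp add: z_def)
  have "(norm (1 - z))\<^sup>2 = 1 - 2 * Re z + ((Re z)\<^sup>2 + (Im z)\<^sup>2)"
    unfolding cmod_power2 by (simp add: power2_eq_square algebra_simps)
  then have "(norm (1 - z))\<^sup>2 = 2 * (1 - Re z)" using n1 by simp
  then have "(2 * d)\<^sup>2 \<le> (norm (1 - z))\<^sup>2"
    using Re_chi_le[OF assms(1), of "int j"] unfolding z_def[symmetric] d_def[symmetric]
    by (simp add: power_mult_distrib) (smt (verit) zero_le_power2)
  then have nz: "2 * d \<le> norm (1 - z)" by (rule power2_le_imp_le) simp
  then have "z \<noteq> 1" using d by auto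
  have "(\<Sum>a<r. chi q (int j * int a)) = (\<Sum>a<r. z ^ a)"
    unfolding z_def by (intro sum.cong) (simp_all flip: chi_mult_nat add: mult.commute)
  also have "\<dots> = (1 - z ^ r) / (1 - z)" using \<open>z \<noteq> 1\<close> by (simp add: sum_gp_strict)
  finally have "norm (\<Sum>a<r. chi q (int j * int a)) = norm (1 - z ^ r) / norm (1 - z)"
    by (simp add: norm_divide)
  also have "\<dots> \<le> 2 / (2 * d)"
  proof (rule frac_le)
    have "norm (1 - z ^ r) \<le> norm (1::complex) + norm (z ^ r)" by (rule norm_triangle_ineq4)
    then show "norm (1 - z ^ r) \<le> 2" by (simp add: norm_power z_def)
  qed (use nz d in auto)
  finally have "norm (\<Sum>a<r. chi q (int j * int a)) \<le> 1 / d" using d by simp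
  then have "norm (avg_chi q r j) \<le> (1 / d) / real r"
    unfolding avg_chi_def norm_divide by (simp only: norm_of_nat divide_right_mono of_nat_0_le_iff)
  then show ?thesis by (simp add: d_def mult.commute)
qed

lemma card_int_open_interval:
  fixes a b :: real assumes "a \<le> b"
  shows "finite {x::int. a < real_of_int x \<and> real_of_int x < b}"
    and "real (card {x::int. a < real_of_int x \<and> real_of_int x < b}) \<le> b - a + 1"
proof -
  have sub: "{x::int. a < real_of_int x \<and> real_of_int x < b} \<subseteq> {\<lfloor>a\<rfloor> + 1..\<lceil>b\<rceil> - 1}"
  proof
    fix x :: int assume "x \<in> {x. a < real_of_int x \<and> real_of_int x < b}"
    then have "\<lfloor>a\<rfloor> < x" "x < \<lceil>b\<rceil>" by (simp_all add: floor_less_iff less_ceiling_iff)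
    then show "x \<in> {\<lfloor>a\<rfloor> + 1..\<lceil>b\<rceil> - 1}" by simp
  qed
  show "finite {x::int. a < real_of_int x \<and> real_of_int x < b}" using sub finite_subset by blast
  have "card {x::int. a < real_of_int x \<and> real_of_int x < b} \<le> card {\<lfloor>a\<rfloor> + 1..\<lceil>b\<rceil> - 1}"
    by (rule card_mono[OF _ sub]) simp
  also have "\<dots> = nat (\<lceil>b\<rceil> - 1 - \<lfloor>a\<rfloor>)" by simp
  finally have "real (card {x::int. a < real_of_int x \<and> real_of_int x < b}) \<le> real (nat (\<lceil>b\<rceil> - 1 - \<lfloor>a\<rfloor>))" by simp
  also have "\<dots> \<le> b - a + 1"
  proof (cases "\<lceil>b\<rceil> - 1 - \<lfloor>a\<rfloor> \<ge> 0")
    case True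
    then have "real (nat (\<lceil>b\<rceil> - 1 - \<lfloor>a\<rfloor>)) = real_of_int \<lceil>b\<rceil> - 1 - real_of_int \<lfloor>a\<rfloor>" by simp
    then show ?thesis by linarith
  qed (use assms in simp)
  finally show "real (card {x::int. a < real_of_int x \<and> real_of_int x < b}) \<le> b - a + 1" .
qed

lemma cdist_mult_dvd_eq:
  assumes "q > 0"
  shows "cdist q (- x) = cdist q x"
proof -
  obtain m where m: "cdist q x = \<bar>x - m * int q\<bar>" "2 * cdist q x \<le> int q" using cdist_props[OF assms] by metis
  have "cdist q (- x) = \<bar>- x - (- m) * int q\<bar>"
    by (rule cdist_eqI[OF assms]) (use m in \<open>simp add: abs_minus_commute\<close>)
  then show ?thesis using m by (simp add: abs_minus_commute)
qed

lemma cdist_add_mult: "cdist q (x + m * int q) = cdist q x"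
  by (simp add: cdist_def)

text \<open>Neither the sign of x nor a multiple of q affects the distance. A frequency j can thus
  be replaced by the nonnegative integer \<open>cdist q (int j)\<close>, which is at most q /
  2.\<close>

lemma cdist_mult_reduce:
  assumes "q > 0"
  shows "cdist q (x * y) = cdist q (cdist q x * y)"
proof -
  obtain m where m: "cdist q x = \<bar>x - m * int q\<bar>" using cdist_props[OF assms] by metis
  have "cdist q ((x - m * int q) * y) = cdist q (x * y + (- m * y) * int q)"
    by (simp add: algebra_simps)
  also have "\<dots> = cdist q (x * y)" by (rule cdist_add_mult)
  finally have 1: "cdist q ((x - m * int q) * y) = cdist q (x * y)" .
  show ?thesis
  proof (cases "x - m * int q \<ge> 0")
    case True
    then show ?thesis using 1 m by simp
  next
    case False
    then have e: "cdist q x = m * int q - x" using m by simp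
    have "cdist q x * y = - ((x - m * int q) * y)" unfolding e by (simp add: algebra_simps)
    then show ?thesis using 1 cdist_mult_dvd_eq[OF assms] by metis
  qed
qed

text \<open>Writing \<open>\<theta> = \<delta> / q\<close>, an integer \<open>x\<close> of the interval for which \<open>x \<theta>\<close> is \<open>t\<close>-close to an integer \<open>z\<close>
  lies in an interval of length \<open>2 t / \<theta>\<close> around \<open>z / \<theta>\<close>; there are about \<open>H \<theta>\<close> choices of \<open>z\<close>.\<close>

lemma card_near_multiples:
  fixes t :: real
  assumes q: "q > 0" and d: "\<delta> > 0" and t: "t \<ge> 0"
  shows "real (card {x\<in>{c..<c + int H}. real_of_int (cdist q (\<delta> * x)) < t * real q})
    \<le> (real H * (real_of_int \<delta> / real q) + 2 * t + 1) * (2 * t / (real_of_int \<delta> / real q) + 1)"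
proof -
  let ?A = "{x\<in>{c..<c + int H}. real_of_int (cdist q (\<delta> * x)) < t * real q}"
  define \<theta> where "\<theta> = real_of_int \<delta> / real q"
  have th: "\<theta> > 0" using q d by (simp add: \<theta>_def)
  let ?Z = "{z::int. real_of_int c * \<theta> - t < real_of_int z \<and> real_of_int z < real_of_int (c + int H) * \<theta> + t}"
  let ?X = "\<lambda>z::int. {x::int. (real_of_int z - t) / \<theta> < real_of_int x \<and> real_of_int x < (real_of_int z + t) / \<theta>}"
  have sub: "?A \<subseteq> (\<Union>z\<in>?Z. ?X z)"
  proof
    fix x assume x: "x \<in> ?A"
    obtain z where z: "cdist q (\<delta> * x) = \<bar>\<delta> * x - z * int q\<bar>" using cdist_props[OF q] by blast
    have "real_of_int \<bar>\<delta> * x - z * int q\<bar> < t * real q" using x z by simp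
    then have "\<bar>real_of_int x * \<theta> - real_of_int z\<bar> * real q < t * real q"
    proof -
      have "real_of_int (\<delta> * x - z * int q) = (real_of_int x * \<theta> - real_of_int z) * real q"
        using q by (simp add: \<theta>_def field_simps)
      then have "real_of_int \<bar>\<delta> * x - z * int q\<bar> = \<bar>real_of_int x * \<theta> - real_of_int z\<bar> * real q"
        by (simp only: of_int_abs abs_mult)
      then show ?thesis using \<open>real_of_int \<bar>\<delta> * x - z * int q\<bar> < t * real q\<close> by simp
    qed
    then have 1: "\<bar>real_of_int x * \<theta> - real_of_int z\<bar> < t" using q by simp
    have xc: "real_of_int c \<le> real_of_int x" "real_of_int x \<le> real_of_int (c + int H)"
      unfolding of_int_le_iff using x by auto
    have 2: "real_of_int c * \<theta> \<le> real_of_int x * \<theta>" "real_of_int x * \<theta> \<le> real_of_int (c + int H) * \<theta>"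
      using xc th by (simp_all only: mult_le_cancel_right_pos)
    have "z \<in> ?Z" using 1 2 by (simp only: mem_Collect_eq) linarith
    moreover have "x \<in> ?X z" using 1 th by (simp add: field_simps) linarith
    ultimately show "x \<in> (\<Union>z\<in>?Z. ?X z)" by blast
  qed
  have ab: "real_of_int c * \<theta> - t \<le> real_of_int (c + int H) * \<theta> + t"
    using th t by (simp add: algebra_simps)
  have finZ: "finite ?Z" and cZ: "real (card ?Z) \<le> real H * \<theta> + 2 * t + 1"
    using card_int_open_interval[OF ab] by (simp_all add: algebra_simps)
  have X: "finite (?X z)" "real (card (?X z)) \<le> 2 * t / \<theta> + 1" for z
  proof -
    have "(real_of_int z - t) / \<theta> \<le> (real_of_int z + t) / \<theta>" using th t by (simp add: divide_right_mono)
    from card_int_open_interval[OF this] show "finite (?X z)" "real (card (?X z)) \<le> 2 * t / \<theta> + 1"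
      by (simp_all add: diff_divide_distrib add_divide_distrib)
  qed
  have "card ?A \<le> card (\<Union>z\<in>?Z. ?X z)" using finZ X by (intro card_mono[OF _ sub]) auto
  also have "\<dots> \<le> (\<Sum>z\<in>?Z. card (?X z))" by (rule card_UN_le[OF finZ])
  finally have "real (card ?A) \<le> (\<Sum>z\<in>?Z. real (card (?X z)))" by (simp flip: of_nat_sum)
  also have "\<dots> \<le> (\<Sum>z\<in>?Z. 2 * t / \<theta> + 1)" using X by (intro sum_mono) auto
  also have "\<dots> = real (card ?Z) * (2 * t / \<theta> + 1)" by simp
  also have "\<dots> \<le> (real H * \<theta> + 2 * t + 1) * (2 * t / \<theta> + 1)"
    using cZ th t by (intro mult_right_mono) auto
  finally show ?thesis unfolding \<theta>_def .
qed

text \<open>If j x is within t q of a multiple of q, the factor is bounded by 1, and such x are few;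
  otherwise the factor is at most exp (- p t^2), whose K-th power is the last term. The hypothesis
  \<open>far\<close> says that j x makes a definite fraction of a turn modulo q while x runs through
  the interval, so the points near the multiples cannot fill it.\<close>

lemma sum_ffac_power_le:
  fixes t A :: real
  assumes q: "q > 0" and H: "H > 0" and p: "0 \<le> p" "p \<le> 1 / 2" and A: "A \<ge> 1" and t: "0 \<le> t" "t \<le> 1"
    and far: "2 * A * real H * real_of_int (cdist q (int j)) > real q"
  shows "(\<Sum>x\<in>{c..<c + int H}. ffac q p (int j * x) ^ K)
    \<le> real H * (14 * A * (t + real_of_int (cdist q (int j)) / real q) + exp (- p * real K * t\<^sup>2))"
proof -
  define \<delta> where "\<delta> = cdist q (int j)"
  define \<theta> where "\<theta> = real_of_int \<delta> / real q"
  have "real_of_int \<delta> > 0"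
  proof (rule ccontr)
    assume "\<not> ?thesis"
    then have "real_of_int \<delta> = 0" using cdist_props(1)[OF q, of "int j"] by (simp add: \<delta>_def)
    then show False using far by (simp add: \<delta>_def)
  qed
  then have d: "\<delta> > 0" by simp
  have th: "\<theta> > 0" using d q by (simp add: \<theta>_def)
  have AH: "2 * A * real H * \<theta> > 1" using far q by (simp add: \<theta>_def \<delta>_def field_simps)
  let ?near = "\<lambda>x. real_of_int (cdist q (\<delta> * x)) < t * real q"
  have trm: "ffac q p (int j * x) ^ K \<le> of_bool (?near x) + exp (- p * real K * t\<^sup>2)" for x
  proof (cases "?near x")
    case True
    have "ffac q p (int j * x) ^ K \<le> 1" using ffac_le_1[OF q p] by (intro power_le_one) (auto simp: ffac_nonneg)
    then show ?thesis using True by (simp add: add_increasing2)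
  next
    case False
    have "ffac q p (int j * x) \<le> exp (- p * (real_of_int (cdist q (int j * x)) / real q)\<^sup>2)"
      by (rule ffac_le_exp[OF q p])
    also have "\<dots> \<le> exp (- p * t\<^sup>2)"
    proof -
      have "t \<le> real_of_int (cdist q (int j * x)) / real q"
        using False q cdist_mult_reduce[OF q, of "int j" x] by (simp add: \<delta>_def field_simps)
      then have "t\<^sup>2 \<le> (real_of_int (cdist q (int j * x)) / real q)\<^sup>2" using t by (intro power_mono)
      then show ?thesis using p by (simp add: mult_left_mono)
    qed
    finally have "ffac q p (int j * x) ^ K \<le> exp (- p * t\<^sup>2) ^ K" by (rule power_mono) (simp add: ffac_nonneg)
    also have "\<dots> = exp (- p * real K * t\<^sup>2)" by (simp add: exp_of_nat_mult[symmetric] mult_ac)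
    finally show ?thesis by (simp add: add_increasing)
  qed
  have "(\<Sum>x\<in>{c..<c + int H}. ffac q p (int j * x) ^ K)
    \<le> (\<Sum>x\<in>{c..<c + int H}. of_bool (?near x) + exp (- p * real K * t\<^sup>2))"
    by (intro sum_mono trm)
  also have "\<dots> = real (card {x\<in>{c..<c + int H}. ?near x}) + real H * exp (- p * real K * t\<^sup>2)"
    by (simp add: sum.distrib of_bool_def sum.If_cases Int_def)
  also have "real (card {x\<in>{c..<c + int H}. ?near x}) \<le> (real H * \<theta> + 2 * t + 1) * (2 * t / \<theta> + 1)"
    unfolding \<theta>_def by (rule card_near_multiples[OF q d t(1)])
  \<comment> \<open>By \<open>far\<close>, 1 \<le> 2 A H \<theta>, which makes every term
    proportional to H. With 2 t + 1 \<le> 3 the coefficients are 12 + 2 for t and 6 + 8 for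
    \<theta>, hence 14.\<close>
  also have "\<dots> \<le> real H * (14 * A * (t + \<theta>))"
  proof -
    have inv: "1 / \<theta> \<le> 2 * A * real H" using AH th by (simp add: field_simps)
    have one: "1 \<le> 2 * A * real H * \<theta>" using AH by simp
    have e1: "t / \<theta> \<le> 2 * A * real H * t" using mult_left_mono[OF inv t(1)] by (simp add: mult_ac)
    have "(real H * \<theta> + 2 * t + 1) * (2 * t / \<theta> + 1)
       = 2 * t * real H + real H * \<theta> + (2 * t + 1) * (2 * (t / \<theta>) + 1)"
      using th by (simp add: field_simps)
    also have "\<dots> \<le> 2 * t * real H + real H * \<theta> + 3 * (2 * (2 * A * real H * t) + 2 * A * real H * \<theta>)"
      using t e1 one th A by (intro add_left_mono mult_mono add_mono mult_left_mono) auto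
    also have "\<dots> = real H * (2 * t + \<theta> + A * (12 * t + 6 * \<theta>))" by (simp add: algebra_simps)
    also have "\<dots> \<le> real H * (14 * A * (t + \<theta>))"
    proof (rule mult_left_mono)
      have "2 * t + \<theta> \<le> A * (2 * t + 8 * \<theta>)"
        using mult_mono[of 1 A "2 * t + \<theta>" "2 * t + 8 * \<theta>"] A t th by simp
      then show "2 * t + \<theta> + A * (12 * t + 6 * \<theta>) \<le> 14 * A * (t + \<theta>)" by (simp add: algebra_simps)
    qed simp
    finally show ?thesis .
  qed
  finally show ?thesis by (simp add: \<theta>_def \<delta>_def algebra_simps)
qed

lemma card_Markov:
  fixes F :: "'b \<Rightarrow> real"
  assumes "finite X" "\<And>x. x \<in> X \<Longrightarrow> F x \<ge> 0" "a > 0"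
  shows "real (card {x\<in>X. F x > a}) \<le> (\<Sum>x\<in>X. F x ^ s) / a ^ s"
proof -
  have "real (card {x\<in>X. F x > a}) * a ^ s = (\<Sum>x\<in>{x\<in>X. F x > a}. a ^ s)" by simp
  also have "\<dots> \<le> (\<Sum>x\<in>{x\<in>X. F x > a}. F x ^ s)" using assms by (intro sum_mono power_mono) auto
  also have "\<dots> \<le> (\<Sum>x\<in>X. F x ^ s)" using assms by (intro sum_mono2) auto
  finally show ?thesis using assms by (simp add: field_simps)
qed

text \<open>The modulus of \<open>phi\<close> is a product over the coordinates and the cube is a
  product set, so the K-th moment factors into the one-dimensional sums; Markov's inequality does
  the rest.\<close>

lemma card_phi_large:
  fixes t A \<tau> :: real
  assumes q: "q > 0" and H: "H > 0" and p: "0 \<le> p" "p \<le> 1 / 2" and A: "A \<ge> 1" and t: "0 \<le> t" "t \<le> 1"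
    and J: "finite J" and far: "2 * A * real H * real_of_int (cdist q (int j)) > real q" and \<tau>: "\<tau> > 0"
  shows "real (card {w\<in>cube J c H. norm (phi q p J w j) > \<tau>})
    \<le> real H ^ card J * ((14 * A * (t + real_of_int (cdist q (int j)) / real q) + exp (- p * real K * t\<^sup>2)) ^ card J / \<tau> ^ K)"
proof -
  have "real (card {w\<in>cube J c H. norm (phi q p J w j) > \<tau>}) \<le> (\<Sum>w\<in>cube J c H. norm (phi q p J w j) ^ K) / \<tau> ^ K"
    using finite_cube[OF J] \<tau> by (intro card_Markov) auto
  also have "(\<Sum>w\<in>cube J c H. norm (phi q p J w j) ^ K) = (\<Sum>w\<in>cube J c H. \<Prod>i\<in>J. ffac q p (int j * w i) ^ K)"
    by (simp add: norm_phi[OF J] prod_power_distrib)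
  also have "\<dots> = (\<Prod>i\<in>J. \<Sum>x\<in>{c i..<c i + int H}. ffac q p (int j * x) ^ K)"
    unfolding cube_def by (rule prod_sum_PiE[symmetric]) (use J in auto)
  also have "\<dots> \<le> (\<Prod>i\<in>J. real H * (14 * A * (t + real_of_int (cdist q (int j)) / real q) + exp (- p * real K * t\<^sup>2)))"
    using sum_ffac_power_le[OF q H p A t far]
    by (intro prod_mono conjI sum_nonneg) (auto simp: ffac_nonneg)
  finally show ?thesis using \<tau> by (simp add: divide_right_mono power_mult_distrib)
qed

text \<open>At low frequencies nothing wraps around modulo q: the product of \<delta> =
  \<open>cdist q (int j)\<close> with a coordinate is at most q / 2 in modulus, hence equals its
  distance to the multiples of q. The lower bound on the coordinates then makes every factor small,
  without any averaging over w.\<close>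

lemma phi_small_deterministic:
  fixes A W :: real
  assumes q: "q > 0" and p: "0 \<le> p" "p \<le> 1 / 2" and J: "finite J" and W: "W \<ge> 0"
    and near: "2 * A * real H * real_of_int (cdist q (int j)) \<le> real q"
    and big: "W \<le> real_of_int (cdist q (int j))"
    and w: "\<And>i. i \<in> J \<Longrightarrow> real H \<le> \<bar>real_of_int (w i)\<bar> \<and> \<bar>real_of_int (w i)\<bar> \<le> A * real H"
  shows "norm (phi q p J w j) \<le> exp (- p * real (card J) * (real H * W / real q)\<^sup>2)"
proof -
  define \<delta> where "\<delta> = cdist q (int j)"
  have d0: "\<delta> \<ge> 0" using cdist_props(1)[OF q] by (simp add: \<delta>_def)
  have "ffac q p (int j * w i) \<le> exp (- p * (real H * W / real q)\<^sup>2)" if i: "i \<in> J" for i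
  proof -
    have "real_of_int (2 * \<bar>\<delta> * w i\<bar>) = 2 * real_of_int \<delta> * \<bar>real_of_int (w i)\<bar>"
      using d0 by (simp add: abs_mult)
    also have "\<dots> \<le> 2 * real_of_int \<delta> * (A * real H)" using w[OF i] d0 by (intro mult_left_mono) auto
    also have "\<dots> \<le> real q" using near by (simp add: \<delta>_def mult_ac)
    finally have "real_of_int (2 * \<bar>\<delta> * w i\<bar>) \<le> real_of_int (int q)" unfolding of_int_of_nat_eq .
    then have "2 * \<bar>\<delta> * w i\<bar> \<le> int q" by (simp only: of_int_le_iff)
    then have "2 * \<bar>\<delta> * w i - 0 * int q\<bar> \<le> int q" by simp
    then have "cdist q (\<delta> * w i) = \<bar>\<delta> * w i\<bar>" using cdist_eqI[OF q, of "\<delta> * w i" 0] by simp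
    then have "real_of_int (cdist q (int j * w i)) = real_of_int \<delta> * \<bar>real_of_int (w i)\<bar>"
      using cdist_mult_reduce[OF q, of "int j" "w i"] d0 by (simp add: \<delta>_def abs_mult)
    also have "\<dots> \<ge> W * real H" using w[OF i] big W d0 by (intro mult_mono) (auto simp: \<delta>_def)
    finally have "real H * W / real q \<le> real_of_int (cdist q (int j * w i)) / real q"
      using q by (intro divide_right_mono) (simp_all add: mult.commute)
    then have "(real H * W / real q)\<^sup>2 \<le> (real_of_int (cdist q (int j * w i)) / real q)\<^sup>2"
      using W q by (intro power_mono) auto
    then have "exp (- p * (real_of_int (cdist q (int j * w i)) / real q)\<^sup>2) \<le> exp (- p * (real H * W / real q)\<^sup>2)"
      using p by (simp add: mult_left_mono)
    then show ?thesis using ffac_le_exp[OF q p, of "int j * w i"] by linarith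
  qed
  then have "(\<Prod>i\<in>J. ffac q p (int j * w i)) \<le> (\<Prod>i\<in>J. exp (- p * (real H * W / real q)\<^sup>2))"
    by (intro prod_mono) (auto simp: ffac_nonneg)
  also have "\<dots> = exp (- p * real (card J) * (real H * W / real q)\<^sup>2)"
    by (simp add: exp_of_nat_mult[symmetric] mult_ac)
  finally show ?thesis by (simp add: norm_phi[OF J])
qed

section \<open>Badly anticoncentrated integer points of cubes\<close>

text \<open>Counts fibre by fibre, so that an estimate that varies the coordinates of one block only
  can be used in the whole cube.\<close>

lemma card_cube_Un_le:
  assumes "finite K" "finite L" "K \<inter> L = {}"
    and B: "\<And>x. x \<in> cube K c H \<Longrightarrow> real (card {z\<in>cube L c H. P (\<lambda>j. if j \<in> K then x j else z j)}) \<le> B"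
  shows "real (card {w\<in>cube (K \<union> L) c H. P w}) \<le> real H ^ card K * B"
proof -
  let ?X = "{w\<in>cube (K \<union> L) c H. P w}"
  let ?m = "\<lambda>x z. (\<lambda>j. if j \<in> K then x j else z j)"
  have sub: "?X \<subseteq> (\<Union>x\<in>cube K c H. ?m x ` {z\<in>cube L c H. P (?m x z)})"
  proof
    fix w assume w: "w \<in> ?X"
    have eq: "w = ?m (restrict w K) (restrict w L)"
    proof (rule ext)
      fix j
      show "w j = ?m (restrict w K) (restrict w L) j"
      proof (cases "j \<in> K \<union> L")
        case False
        have "w \<in> PiE (K \<union> L) (\<lambda>j. {c j..<c j + int H})" using w by (simp add: cube_def)
        then show ?thesis using PiE_arb[of w "K \<union> L" _ j] False by simp
      qed auto
    qed
    have "restrict w K \<in> cube K c H" "restrict w L \<in> cube L c H" using w by (auto simp: cube_def PiE_iff)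
    moreover have "P (?m (restrict w K) (restrict w L))" using w eq by simp
    ultimately have "w \<in> ?m (restrict w K) ` {z\<in>cube L c H. P (?m (restrict w K) z)}"
      using eq by blast
    then show "w \<in> (\<Union>x\<in>cube K c H. ?m x ` {z\<in>cube L c H. P (?m x z)})"
      using \<open>restrict w K \<in> cube K c H\<close> by blast
  qed
  have fin: "finite (cube K c H)" "finite (cube L c H)" using assms finite_cube by blast+
  have "card ?X \<le> card (\<Union>x\<in>cube K c H. ?m x ` {z\<in>cube L c H. P (?m x z)})"
    using fin by (intro card_mono[OF _ sub]) auto
  also have "\<dots> \<le> (\<Sum>x\<in>cube K c H. card (?m x ` {z\<in>cube L c H. P (?m x z)}))"
    by (rule card_UN_le[OF fin(1)])
  also have "\<dots> \<le> (\<Sum>x\<in>cube K c H. card {z\<in>cube L c H. P (?m x z)})"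
    using fin by (intro sum_mono card_image_le) auto
  finally have "real (card ?X) \<le> (\<Sum>x\<in>cube K c H. real (card {z\<in>cube L c H. P (?m x z)}))"
    by (simp flip: of_nat_sum)
  also have "\<dots> \<le> (\<Sum>x\<in>cube K c H. B)" by (intro sum_mono B)
  also have "\<dots> = real H ^ card K * B" using assms by (simp add: card_cube)
  finally show ?thesis .
qed

lemma ssum_cong: "(\<And>j. j \<in> S \<Longrightarrow> v j = w j) \<Longrightarrow> ssum S v = ssum S w"
  unfolding ssum_def by (intro sum.cong) auto

lemma res_prob_cong:
  assumes "\<And>j. j \<in> J \<Longrightarrow> w j = w' j"
  shows "res_prob q p J w = res_prob q p J w'"
proof (rule ext)
  fix y
  have "ssum S w = ssum S w'" if "S \<subseteq> J" for S using that assms by (intro ssum_cong) auto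
  then show "res_prob q p J w y = res_prob q p J w' y"
    unfolding res_prob_def by (intro bexp_cong) simp
qed

lemma phi_cong:
  assumes "\<And>j. j \<in> J \<Longrightarrow> w j = w' j"
  shows "phi q p J w = phi q p J w'"
proof (rule ext)
  fix y
  have "ssum S w = ssum S w'" if "S \<subseteq> J" for S using that assms by (intro ssum_cong) auto
  then show "phi q p J w y = phi q p J w' y"
    unfolding phi_def by (intro bexp_cong) simp
qed

lemma avg_bounds:
  assumes "r > 0" "\<And>y. 0 \<le> g y \<and> g y \<le> \<rho>"
  shows "0 \<le> avg r g y \<and> avg r g y \<le> \<rho>"
proof
  show "0 \<le> avg r g y" unfolding avg_def using assms by (intro divide_nonneg_nonneg sum_nonneg) auto
  have "(\<Sum>a<r. g (y + int a)) \<le> (\<Sum>a<r. \<rho>)" using assms by (intro sum_mono) auto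
  then show "avg r g y \<le> \<rho>" using assms by (simp add: avg_def field_simps)
qed

lemma avg_pow_bounds:
  assumes "r > 0" "\<And>y. 0 \<le> g y \<and> g y \<le> \<rho>"
  shows "0 \<le> (avg r ^^ h) g y \<and> (avg r ^^ h) g y \<le> \<rho>"
  using assms
proof (induction h arbitrary: y)
  case (Suc h)
  then show ?case using avg_bounds[of r "(avg r ^^ h) g" \<rho> y] by simp
qed simp

lemma avg_bexp:
  "avg r (\<lambda>y. bexp \<pi> J (\<lambda>S. g (y + ssum S w))) = (\<lambda>y. bexp \<pi> J (\<lambda>S. avg r g (y + ssum S w)))"
proof (rule ext)
  fix y
  have "bexp \<pi> J (\<lambda>S. avg r g (y + ssum S w))
     = bexp \<pi> J (\<lambda>S. (1 / real r) * (\<Sum>a<r. g (y + int a + ssum S w)))"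
    unfolding avg_def by (intro bexp_cong) (simp add: add_ac)
  then show "avg r (\<lambda>y. bexp \<pi> J (\<lambda>S. g (y + ssum S w))) y = bexp \<pi> J (\<lambda>S. avg r g (y + ssum S w))"
    unfolding bexp_cmult bexp_sum by (simp add: avg_def)
qed

lemma avg_pow_bexp:
  "(avg r ^^ h) (\<lambda>y. bexp \<pi> J (\<lambda>S. g (y + ssum S w))) = (\<lambda>y. bexp \<pi> J (\<lambda>S. (avg r ^^ h) g (y + ssum S w)))"
  by (induction h) (simp_all add: avg_bexp)

lemma res_prob_Un:
  assumes "finite J" "finite K" "J \<inter> K = {}"
  shows "res_prob q p (J \<union> K) w y = bexp (\<lambda>_. p) K (\<lambda>S. res_prob q p J w (y + ssum S w))"
proof -
  have "res_prob q p (K \<union> J) w y = bexp (\<lambda>_. p) K (\<lambda>S. bexp (\<lambda>_. p) J (\<lambda>T. of_bool (int q dvd y + ssum (S \<union> T) w)))"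
    unfolding res_prob_def using assms by (intro bexp_Un) auto
  also have "\<dots> = bexp (\<lambda>_. p) K (\<lambda>S. res_prob q p J w (y + ssum S w))"
    unfolding res_prob_def
  proof (intro bexp_cong)
    fix S T assume "S \<subseteq> K" "T \<subseteq> J"
    then have "ssum (S \<union> T) w = ssum S w + ssum T w"
      unfolding ssum_def using assms by (intro sum.union_disjoint) (auto intro: finite_subset)
    then show "of_bool (int q dvd y + ssum (S \<union> T) w) = (of_bool (int q dvd y + ssum S w + ssum T w) :: real)"
      by (simp add: add.assoc)
  qed
  finally show ?thesis by (simp add: Un_commute)
qed

section \<open>Low and high frequencies\<close>

definition tail_set :: "nat \<Rightarrow> real \<Rightarrow> nat set" where
  "tail_set q W = {j. j < q \<and> W \<le> real_of_int (cdist q (int j))}"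

definition tail_norm :: "nat \<Rightarrow> real \<Rightarrow> (nat \<Rightarrow> complex) \<Rightarrow> int \<Rightarrow> real" where
  "tail_norm q W cc y = norm (\<Sum>j\<in>tail_set q W. cc j * chi q (int j * y))"

lemma card_main_set:
  assumes "W \<ge> 0"
  shows "real (card {j. j < q \<and> real_of_int (cdist q (int j)) < W}) \<le> 2 * W + 2"
proof -
  define k where "k = nat \<lceil>W\<rceil>"
  have k: "W \<le> real k" "real k \<le> W + 1" using assms by (simp_all add: k_def of_nat_ceiling) 
  have "{j. j < q \<and> real_of_int (cdist q (int j)) < W} \<subseteq> {..<k} \<union> {q - k..<q}"
  proof
    fix j assume j: "j \<in> {j. j < q \<and> real_of_int (cdist q (int j)) < W}"
    then have "int j mod int q = int j" by simp
    then have "real_of_int (min (int j) (int q - int j)) < real k" using j k by (simp only: cdist_def) simp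
    then have "min (int j) (int q - int j) < int k" by (simp add: min_def split: if_splits)
    then show "j \<in> {..<k} \<union> {q - k..<q}" using j by auto
  qed
  then have "card {j. j < q \<and> real_of_int (cdist q (int j)) < W} \<le> card ({..<k} \<union> {q - k..<q})"
    by (intro card_mono) auto
  also have "\<dots> \<le> k + k" by (rule order_trans[OF card_Un_le]) auto
  finally show ?thesis using k by linarith
qed

lemma tail_norm_mod: "tail_norm q W cc (y mod int q) = tail_norm q W cc y"
proof -
  have "chi q (int j * y) = chi q (int j * (y mod int q))" for j
  proof -
    have "int j * y = int j * (y mod int q) + int q * (int j * (y div int q))"
      using div_mult_mod_eq[of y "int q"] by (metis distrib_left mult.left_commute mult.commute add.commute)
    then have "chi q (int j * y) = chi q (int j * (y mod int q)) * chi q (int q * (int j * (y div int q)))"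
      by (simp only: chi_add)
    then show ?thesis using chi_dvd[of q "int q * (int j * (y div int q))"] by simp
  qed
  then show ?thesis unfolding tail_norm_def by simp
qed

lemma res_prob_mod: "res_prob q p J w (y mod int q) = res_prob q p J w y"
proof -
  have "int q dvd y mod int q + x \<longleftrightarrow> int q dvd y + x" for x
    by (metis dvd_eq_mod_eq_0 mod_add_left_eq)
  then show ?thesis by (simp add: res_prob_def)
qed

text \<open>The low frequencies number at most 2 W + 2 and have coefficients at most 1 / q. In the
  tail each coefficient is at most \<tau> times that of the residue distribution of
  \<open>J1\<close>, whose values have square sum at most \<rho> because they are bounded by \<rho>
  and add up to 1. Plancherel and Cauchy-Schwarz over one period give the bound on window sums; the
  pointwise bound is the triangle inequality.\<close>

lemma tail_estimates:
  assumes q: "q > 0" and r: "r > 0" and p: "0 \<le> p" "p \<le> 1 / 2" and fin: "finite J1" "finite J2" and W: "W \<ge> 0"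
    and \<rho>: "\<And>y. res_prob q p J1 w y \<le> \<rho>" and \<tau>0: "\<tau> \<ge> 0"
    and \<tau>: "\<And>j. j \<in> tail_set q W \<Longrightarrow> norm (phi q p J2 w j) * norm (avg_chi q r j) ^ h \<le> \<tau>"
  defines "F \<equiv> (avg r ^^ h) (\<lambda>y. bexp (\<lambda>_. p) J2 (\<lambda>S. res_prob q p J1 w (y + ssum S w)))"
  defines "T \<equiv> tail_norm q W (\<lambda>j. phi q p J1 w j / of_nat q * phi q p J2 w j * avg_chi q r j ^ h)"
  shows "F y \<le> (2 * W + 2) / real q + T y"
    and "T y \<le> \<rho> + (2 * W + 2) / real q"
    and "L \<le> q \<Longrightarrow> (\<Sum>z\<in>{a..<a + int L}. T z) \<le> \<tau> * sqrt (real q * \<rho>)"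
proof -
  define cc where "cc j = phi q p J1 w j / of_nat q * phi q p J2 w j * avg_chi q r j ^ h" for j
  have p01: "0 \<le> p" "p \<le> 1" using p by auto
  have rep1: "fourier_rep q (res_prob q p J1 w) (\<lambda>j. phi q p J1 w j / of_nat q)"
    by (rule fourier_rep_res_prob[OF q])
  have rep: "fourier_rep q F cc"
    unfolding F_def cc_def[abs_def] by (intro fourier_rep_avg_pow fourier_rep_bexp rep1)
  have r0: "0 \<le> res_prob q p J1 w y" for y by (rule res_prob_nonneg[OF p01])
  have \<rho>0: "\<rho> \<ge> 0" using order_trans[OF r0 \<rho>] .
  have F: "0 \<le> F y \<and> F y \<le> \<rho>" for y
    unfolding F_def using r
  proof (rule avg_pow_bounds)
    fix y
    show "0 \<le> bexp (\<lambda>_. p) J2 (\<lambda>S. res_prob q p J1 w (y + ssum S w)) \<and>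
      bexp (\<lambda>_. p) J2 (\<lambda>S. res_prob q p J1 w (y + ssum S w)) \<le> \<rho>"
      using r0 \<rho> p01 fin by (intro conjI bexp_nonneg bexp_le_const) auto
  qed
  let ?M = "{j. j < q \<and> real_of_int (cdist q (int j)) < W}"
  have ccle: "norm (cc j) \<le> 1 / real q" for j
  proof -
    have "norm (cc j) = norm (phi q p J1 w j) * norm (phi q p J2 w j) * norm (avg_chi q r j) ^ h / real q"
      by (simp add: cc_def norm_mult norm_divide norm_power)
    also have "\<dots> \<le> 1 * 1 * 1 / real q"
      using q r p fin by (intro divide_right_mono mult_mono norm_phi_le_1 power_le_one norm_avg_chi_le_1) auto
    finally show ?thesis by simp
  qed
  have main: "norm (\<Sum>j\<in>?M. cc j * chi q (int j * y)) \<le> (2 * W + 2) / real q" for y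
  proof -
    have "norm (\<Sum>j\<in>?M. cc j * chi q (int j * y)) \<le> (\<Sum>j\<in>?M. 1 / real q)"
      using ccle by (intro sum_norm_le) (simp add: norm_mult)
    also have "\<dots> \<le> (2 * W + 2) / real q"
      using card_main_set[OF W, of q] by (simp add: divide_right_mono)
    finally show ?thesis .
  qed
  have split: "complex_of_real (F y) = (\<Sum>j\<in>?M. cc j * chi q (int j * y)) + (\<Sum>j\<in>tail_set q W. cc j * chi q (int j * y))" for y
  proof -
    have "{..<q} = ?M \<union> tail_set q W" "?M \<inter> tail_set q W = {}" by (auto simp: tail_set_def)
    then have "(\<Sum>j<q. cc j * chi q (int j * y)) = (\<Sum>j\<in>?M. cc j * chi q (int j * y)) + (\<Sum>j\<in>tail_set q W. cc j * chi q (int j * y))"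
      by (simp only:, intro sum.union_disjoint) (auto simp: tail_set_def)
    then show ?thesis using rep by (simp add: fourier_rep_def)
  qed
  have T: "T = tail_norm q W cc" by (simp add: T_def cc_def[abs_def])
  have T': "T y = norm (\<Sum>j\<in>tail_set q W. cc j * chi q (int j * y))" for y by (simp add: T tail_norm_def)
  have nF: "norm (complex_of_real (F y)) = F y" using F by simp
  show "F y \<le> (2 * W + 2) / real q + T y"
  proof -
    have "norm (complex_of_real (F y)) \<le> norm (\<Sum>j\<in>?M. cc j * chi q (int j * y)) + T y"
      unfolding split T' by (rule norm_triangle_ineq)
    then show ?thesis using main[of y] unfolding nF by linarith
  qed
  show "T y \<le> \<rho> + (2 * W + 2) / real q"
  proof -
    have e: "(\<Sum>j\<in>tail_set q W. cc j * chi q (int j * y)) = complex_of_real (F y) - (\<Sum>j\<in>?M. cc j * chi q (int j * y))"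
      using split[of y] by simp
    have "T y \<le> norm (complex_of_real (F y)) + norm (\<Sum>j\<in>?M. cc j * chi q (int j * y))"
      unfolding T' e by (rule norm_triangle_ineq4)
    then show ?thesis using main[of y] F[of y] unfolding nF by linarith
  qed
  assume L: "L \<le> q"
  have sq: "(\<Sum>y<q. (T (int y))\<^sup>2) \<le> \<tau>\<^sup>2 * \<rho>"
  proof -
    define a where "a j = (if j \<in> tail_set q W then cc j else 0)" for j
    have "(\<Sum>j<q. a j * chi q (int j * int y)) = (\<Sum>j\<in>tail_set q W. cc j * chi q (int j * int y))" for y
      unfolding a_def by (rule sum.mono_neutral_cong_right) (auto simp: tail_set_def)
    then have "(\<Sum>y<q. (T (int y))\<^sup>2) = (\<Sum>y<q. (norm (\<Sum>j<q. a j * chi q (int j * int y)))\<^sup>2)"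
      by (simp add: T')
    also have "\<dots> = real q * (\<Sum>j<q. (norm (a j))\<^sup>2)" by (rule plancherel[OF q])
    also have "\<dots> \<le> real q * (\<Sum>j<q. \<tau>\<^sup>2 * (norm (phi q p J1 w j / of_nat q))\<^sup>2)"
    proof (intro mult_left_mono sum_mono)
      fix j
      have "norm (a j) \<le> \<tau> * norm (phi q p J1 w j / of_nat q)"
      proof (cases "j \<in> tail_set q W")
        case True
        have "norm (a j) = (norm (phi q p J2 w j) * norm (avg_chi q r j) ^ h) * norm (phi q p J1 w j / of_nat q)"
          using True by (simp add: a_def cc_def norm_mult norm_divide norm_power)
        then show ?thesis using \<tau>[OF True] by (metis mult_right_mono norm_ge_zero)
      qed (simp add: a_def \<tau>0)
      then have "(norm (a j))\<^sup>2 \<le> (\<tau> * norm (phi q p J1 w j / of_nat q))\<^sup>2" by (intro power_mono) auto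
      then show "(norm (a j))\<^sup>2 \<le> \<tau>\<^sup>2 * (norm (phi q p J1 w j / of_nat q))\<^sup>2" by (simp only: power_mult_distrib)
    qed simp
    also have "\<dots> = \<tau>\<^sup>2 * (\<Sum>y<q. (res_prob q p J1 w (int y))\<^sup>2)"
      unfolding fourier_rep_plancherel[OF q rep1] sum_distrib_left[symmetric] by simp
    also have "\<dots> \<le> \<tau>\<^sup>2 * (\<Sum>y<q. \<rho> * res_prob q p J1 w (int y))"
      unfolding power2_eq_square[of "res_prob q p J1 w _"] using r0 \<rho>
      by (intro mult_left_mono sum_mono mult_right_mono) auto
    also have "\<dots> = \<tau>\<^sup>2 * \<rho>" by (simp add: sum_res_prob[OF q fin(1)] flip: sum_distrib_left)
    finally show ?thesis .
  qed
  have T0: "T z \<ge> 0" for z by (simp add: T tail_norm_def)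
  \<comment> \<open>A window of length at most q is enlarged to a full period, which meets each
    residue class once.\<close>
  have "(\<Sum>z\<in>{a..<a + int L}. T z) \<le> (\<Sum>z\<in>{a..<a + int q}. T z)"
    using L T0 by (intro sum_mono2) auto
  also have "\<dots> = (\<Sum>z\<in>{a..<a + int q}. T (int (nat (z mod int q))))"
    using q by (intro sum.cong) (auto simp: T tail_norm_mod)
  also have "\<dots> = (\<Sum>y\<in>(\<lambda>z. nat (z mod int q)) ` {a..<a + int q}. T (int y))"
  proof (rule sum.reindex[symmetric, unfolded o_def])
    show "inj_on (\<lambda>z. nat (z mod int q)) {a..<a + int q}"
    proof (rule inj_onI)
      fix x y assume x: "x \<in> {a..<a + int q}" "y \<in> {a..<a + int q}" "nat (x mod int q) = nat (y mod int q)"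
      then have "x mod int q = y mod int q" using q by (simp add: nat_eq_iff2)
      then have "int q dvd x - y" by (simp add: mod_eq_dvd_iff)
      then obtain k where k: "x - y = int q * k" by (elim dvdE)
      have "\<bar>int q * k\<bar> < int q * 1" using x(1,2) unfolding k[symmetric] by auto
      then have "\<bar>k\<bar> < 1" using q by (simp add: abs_mult)
      then show "x = y" using k by simp
    qed
  qed
  also have "\<dots> \<le> (\<Sum>y<q. T (int y))" using q T0 by (intro sum_mono2) (auto simp: nat_less_iff)
  also have "\<dots> \<le> sqrt (real q * (\<tau>\<^sup>2 * \<rho>))"
  proof (rule real_le_rsqrt)
    have "(\<Sum>y<q. T (int y))\<^sup>2 \<le> real q * (\<Sum>y<q. (T (int y))\<^sup>2)"
      using sum_squared_le_sum_of_squares[of "\<lambda>y. T (int y)" "{..<q}"] by (simp add: mult.commute)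
    also have "\<dots> \<le> real q * (\<tau>\<^sup>2 * \<rho>)" by (rule mult_left_mono[OF sq]) simp
    finally show "(\<Sum>y<q. T (int y))\<^sup>2 \<le> real q * (\<tau>\<^sup>2 * \<rho>)" .
  qed
  also have "\<dots> = \<tau> * sqrt (real q * \<rho>)" using \<tau>0 by (simp add: real_sqrt_mult mult_ac)
  finally show "(\<Sum>z\<in>{a..<a + int L}. T z) \<le> \<tau> * sqrt (real q * \<rho>)" .
qed

lemma ex_int_iff_ex_residue:
  fixes P :: "int \<Rightarrow> bool"
  assumes "q > 0" "\<And>y. P (y mod int q) \<longleftrightarrow> P y"
  shows "(\<exists>y. P y) \<longleftrightarrow> (\<exists>y<q. P (int y))"
proof
  assume "\<exists>y. P y"
  then obtain y where "P y" by auto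
  then have "P (int (nat (y mod int q)))" using assms by simp
  moreover have "nat (y mod int q) < q" using assms by (simp add: nat_less_iff)
  ultimately show "\<exists>y<q. P (int y)" by blast
qed auto

lemma card_ex_residue_le:
  fixes q :: nat
  assumes "finite X" "\<And>y. y < q \<Longrightarrow> real (card {x\<in>X. P x y}) \<le> B"
  shows "real (card {x\<in>X. \<exists>y<q. P x y}) \<le> real q * B"
proof -
  have "{x\<in>X. \<exists>y<q. P x y} = (\<Union>y<q. {x\<in>X. P x y})" by auto
  then have "card {x\<in>X. \<exists>y<q. P x y} \<le> (\<Sum>y<q. card {x\<in>X. P x y})" by (simp add: card_UN_le)
  then have "real (card {x\<in>X. \<exists>y<q. P x y}) \<le> (\<Sum>y<q. real (card {x\<in>X. P x y}))"
    by (simp flip: of_nat_sum)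
  also have "\<dots> \<le> (\<Sum>y<q. B)" using assms by (intro sum_mono) auto
  finally show ?thesis by simp
qed

text \<open>The index set is split into three parts. The first part spreads the distribution out up to a polynomial
  factor, the second one makes the Fourier tail small in \<open>L\<^sup>2\<close>, and the third one
  turns this into a pointwise bound. The first and the third step are instances of the moment bound.\<close>

theorem card_concentrated_cube_points:
  fixes A W t \<theta>\<^sub>0 \<rho> \<tau> \<sigma> :: real
  assumes q: "q > 0" and r: "r > 0" and H: "H > 0" and p: "0 \<le> p" "p \<le> 1 / 2"
    and fin: "finite (J1 :: 'a set)" "finite J2" "finite J3" and disj: "J1 \<inter> J2 = {}" "J1 \<inter> J3 = {}" "J2 \<inter> J3 = {}"
    and W: "W > 0" and A: "A \<ge> 1" and t: "0 \<le> t" "t \<le> 1"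
    and pos: "\<rho> > 0" "\<tau> > 0" "\<sigma> > 0" "\<theta>\<^sub>0 > 0"
    and s1: "s1 \<le> card J1" "s1 * H \<le> q" and s3: "s3 \<le> card J3" "s3 * H \<le> q"
    and good: "\<And>i x. i \<in> J2 \<Longrightarrow> x \<in> {c i..<c i + int H} \<Longrightarrow> real H \<le> \<bar>real_of_int x\<bar> \<and> \<bar>real_of_int x\<bar> \<le> A * real H"
    and det: "exp (- p * real (card J2) * (real H * W / real q)\<^sup>2) \<le> \<tau>"
    and high: "(1 / (real r * \<theta>\<^sub>0)) ^ h \<le> \<tau>"
  shows "real (card {w\<in>cube (J1 \<union> J2 \<union> J3) c H.
      \<exists>y. (avg r ^^ h) (res_prob q p (J1 \<union> J2 \<union> J3) w) y > (2 * W + 2) / real q + \<sigma>})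
    \<le> real H ^ card (J1 \<union> J2 \<union> J3) * (real q *
        (((1 / real H + (1 - p) ^ (card J1 - s1)) / \<rho>) ^ s1
         + (14 * A * (t + \<theta>\<^sub>0) + exp (- p * real K * t\<^sup>2)) ^ card J2 / \<tau> ^ K
         + ((\<tau> * sqrt (real q * \<rho>) / real H + (\<rho> + (2 * W + 2) / real q) * (1 - p) ^ (card J3 - s3)) / \<sigma>) ^ s3))"
    (is "real (card ?Bad) \<le> real H ^ card ?J * (real q * (?b1 + ?b2 + ?b3))")
proof -
  have p01: "0 \<le> p" "p \<le> 1" using p by auto
  \<comment> \<open>The tail frequencies fall into three ranges. At distance at least
    \<open>\<theta>\<^sub>0 * real q\<close> from 0 the averages decay; at distances too small for a
    wrap-around \<open>phi\<close> is small for every admissible w; only the range between,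
    \<open>mid\<close>, needs a count of exceptional w.\<close>
  define mid where "mid j \<longleftrightarrow> j \<in> tail_set q W \<and> real_of_int (cdist q (int j)) < \<theta>\<^sub>0 * real q
     \<and> real q < 2 * A * real H * real_of_int (cdist q (int j))" for j
  define P1 where "P1 w y \<longleftrightarrow> res_prob q p J1 w (int y) > \<rho>" for w y
  define P2 where "P2 w j \<longleftrightarrow> mid j \<and> norm (phi q p J2 w j) > \<tau>" for w j
  define Good where "Good w \<longleftrightarrow> (\<forall>y<q. \<not> P1 w y) \<and> (\<forall>j<q. \<not> P2 w j)
    \<and> (\<forall>i\<in>J2. real H \<le> \<bar>real_of_int (w i)\<bar> \<and> \<bar>real_of_int (w i)\<bar> \<le> A * real H)" for w
  define T where "T w = tail_norm q W (\<lambda>j. phi q p J1 w j / of_nat q * phi q p J2 w j * avg_chi q r j ^ h)" for w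
  \<comment> \<open>\<open>Good\<close> and \<open>T\<close> depend on the coordinates in
    \<open>J1\<close> and \<open>J2\<close> only. With these fixed, the third block faces the fixed
    function \<open>T w\<close>, to which the moment bound applies.\<close>
  define P3 where "P3 w y \<longleftrightarrow> Good w \<and> bexp (\<lambda>_. p) J3 (\<lambda>S. T w (int y + ssum S w)) > \<sigma>" for w y
  let ?C = "cube ?J c H"
  have finJ: "finite ?J" using fin by simp
  have finC: "finite ?C" by (rule finite_cube[OF finJ])
  have cJ: "card ?J = card J1 + card J2 + card J3"
    using fin disj by (simp add: card_Un_disjoint Int_Un_distrib2)
  have Good1: "res_prob q p J1 w y \<le> \<rho>" if "Good w" for w y
  proof (rule ccontr)
    assume "\<not> ?thesis"
    then have "\<exists>y. res_prob q p J1 w y > \<rho>" by (auto simp: not_le)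
    then have "\<exists>y<q. P1 w y"
      unfolding P1_def by (subst (asm) ex_int_iff_ex_residue[OF q]) (simp_all add: res_prob_mod)
    then show False using that by (auto simp: Good_def)
  qed
  have tail: "norm (phi q p J2 w j) * norm (avg_chi q r j) ^ h \<le> \<tau>" if G: "Good w" and j: "j \<in> tail_set q W" for w j
  proof (cases "real_of_int (cdist q (int j)) < \<theta>\<^sub>0 * real q")
    case True
    have "norm (phi q p J2 w j) \<le> \<tau>"
    proof (cases "real q < 2 * A * real H * real_of_int (cdist q (int j))")
      case far: True
      then have "mid j" using True j by (simp add: mid_def)
      then show ?thesis using G j by (auto simp: Good_def P2_def tail_set_def not_less)
    next
      case False
      have "norm (phi q p J2 w j) \<le> exp (- p * real (card J2) * (real H * W / real q)\<^sup>2)"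
        by (rule phi_small_deterministic[OF q p fin(2), of W A])
          (use False j G W in \<open>auto simp: tail_set_def Good_def\<close>)
      then show ?thesis using det by linarith
    qed
    then have "norm (phi q p J2 w j) * norm (avg_chi q r j) ^ h \<le> \<tau> * 1"
      using norm_avg_chi_le_1[OF r] pos by (intro mult_mono power_le_one) auto
    then show ?thesis by simp
  next
    case False
    have d: "cdist q (int j) > 0" using j W by (simp add: tail_set_def)
    have "norm (avg_chi q r j) \<le> real q / (real r * real_of_int (cdist q (int j)))"
      by (rule norm_avg_chi_le[OF q r d])
    also have "\<dots> \<le> real q / (real r * (\<theta>\<^sub>0 * real q))"
      using False q r pos by (intro divide_left_mono mult_left_mono mult_pos_pos) (auto simp: d)
    also have "\<dots> = 1 / (real r * \<theta>\<^sub>0)" using q by simp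
    finally have "norm (avg_chi q r j) ^ h \<le> (1 / (real r * \<theta>\<^sub>0)) ^ h" by (rule power_mono) simp
    then have "norm (avg_chi q r j) ^ h \<le> \<tau>" using high by linarith
    then have "norm (phi q p J2 w j) * norm (avg_chi q r j) ^ h \<le> 1 * \<tau>"
      using norm_phi_le_1[OF q fin(2) p] by (intro mult_mono) auto
    then show ?thesis by simp
  qed
  have te: "(avg r ^^ h) (\<lambda>y. bexp (\<lambda>_. p) J2 (\<lambda>S. res_prob q p J1 w (y + ssum S w))) y \<le> (2 * W + 2) / real q + T w y"
    "T w y \<le> \<rho> + (2 * W + 2) / real q"
    "\<And>L a. L \<le> q \<Longrightarrow> (\<Sum>z\<in>{a..<a + int L}. T w z) \<le> \<tau> * sqrt (real q * \<rho>)"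
    if G: "Good w" for w y
    using tail_estimates[OF q r p fin(1,2) less_imp_le[OF W] Good1[OF G] less_imp_le[OF pos(2)] tail[OF G], folded T_def]
    by blast+
  have sub: "?Bad \<subseteq> {w\<in>?C. \<exists>y<q. P1 w y} \<union> {w\<in>?C. \<exists>j<q. P2 w j} \<union> {w\<in>?C. \<exists>y<q. P3 w y}"
  proof
    fix w assume w: "w \<in> ?Bad"
    then obtain y where y: "(avg r ^^ h) (res_prob q p ?J w) y > (2 * W + 2) / real q + \<sigma>" by auto
    have wC: "w \<in> ?C" using w by simp
    have rng: "real H \<le> \<bar>real_of_int (w i)\<bar> \<and> \<bar>real_of_int (w i)\<bar> \<le> A * real H" if "i \<in> J2" for i
      by (rule good[OF that]) (use wC that in \<open>auto simp: cube_def PiE_iff\<close>)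
    show "w \<in> {w\<in>?C. \<exists>y<q. P1 w y} \<union> {w\<in>?C. \<exists>j<q. P2 w j} \<union> {w\<in>?C. \<exists>y<q. P3 w y}"
    proof (rule ccontr)
      assume n: "\<not> ?thesis"
      then have G: "Good w" using wC rng by (auto simp: Good_def)
      define F where "F = (avg r ^^ h) (\<lambda>y. bexp (\<lambda>_. p) J2 (\<lambda>S. res_prob q p J1 w (y + ssum S w)))"
      have "res_prob q p ?J w = (\<lambda>y. bexp (\<lambda>_. p) J3 (\<lambda>S. bexp (\<lambda>_. p) J2 (\<lambda>S'. res_prob q p J1 w (y + ssum S w + ssum S' w))))"
      proof (rule ext)
        fix y
        have "res_prob q p ?J w y = bexp (\<lambda>_. p) J3 (\<lambda>S. res_prob q p (J1 \<union> J2) w (y + ssum S w))"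
          using fin disj by (intro res_prob_Un) auto
        then show "res_prob q p ?J w y = bexp (\<lambda>_. p) J3 (\<lambda>S. bexp (\<lambda>_. p) J2 (\<lambda>S'. res_prob q p J1 w (y + ssum S w + ssum S' w)))"
          by (simp only: res_prob_Un[OF fin(1,2) disj(1)])
      qed
      then have "(avg r ^^ h) (res_prob q p ?J w) y = bexp (\<lambda>_. p) J3 (\<lambda>S. F (y + ssum S w))"
        unfolding F_def using avg_pow_bexp[of h r "\<lambda>_. p" J3 "\<lambda>y. bexp (\<lambda>_. p) J2 (\<lambda>S'. res_prob q p J1 w (y + ssum S' w))" w]
        by simp
      also have "\<dots> \<le> bexp (\<lambda>_. p) J3 (\<lambda>S. (2 * W + 2) / real q + T w (y + ssum S w))"
        unfolding F_def using te(1)[OF G] p01 by (intro bexp_mono) auto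
      also have "\<dots> = (2 * W + 2) / real q + bexp (\<lambda>_. p) J3 (\<lambda>S. T w (y + ssum S w))"
        by (simp add: bexp_add bexp_const fin)
      finally have "bexp (\<lambda>_. p) J3 (\<lambda>S. T w (y + ssum S w)) > \<sigma>" using y by linarith
      then have "\<exists>y. bexp (\<lambda>_. p) J3 (\<lambda>S. T w (y + ssum S w)) > \<sigma>" by blast
      moreover have Tm: "T w (y mod int q + x) = T w (y + x)" for y x
      proof -
        have "T w (y mod int q + x) = T w ((y mod int q + x) mod int q)" by (simp only: T_def tail_norm_mod)
        also have "\<dots> = T w ((y + x) mod int q)" by (simp only: mod_add_left_eq)
        also have "\<dots> = T w (y + x)" by (simp only: T_def tail_norm_mod)
        finally show ?thesis .
      qed
      have "(\<exists>y. bexp (\<lambda>_. p) J3 (\<lambda>S. T w (y + ssum S w)) > \<sigma>) \<longleftrightarrow> (\<exists>y<q. bexp (\<lambda>_. p) J3 (\<lambda>S. T w (int y + ssum S w)) > \<sigma>)"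
        by (rule ex_int_iff_ex_residue[OF q]) (simp only: Tm)
      ultimately have "\<exists>y<q. P3 w y" unfolding P3_def using G by blast
      then show False using n wC by blast
    qed
  qed
  have c1: "real (card {w\<in>?C. \<exists>y<q. P1 w y}) \<le> real q * (real H ^ card ?J * ?b1)"
  proof (rule card_ex_residue_le[OF finC])
    fix y assume "y < q"
    let ?a = "1 / real H + (1 - p) ^ (card J1 - s1)"
    \<comment> \<open>An interval of length at most q contains at most one multiple of q. This is
      the value 1 for \<open>G1\<close> in the moment bound.\<close>
    have iv: "(\<Sum>z\<in>{a..<a + int (s1 * H)}. of_bool (int q dvd z)) \<le> (1::real)" for a
    proof -
      have "card {z\<in>{a..<a + int (s1 * H)}. int q dvd z} \<le> 1"
      proof -
        let ?Z = "{z\<in>{a..<a + int (s1 * H)}. int q dvd z}"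
        have "finite ?Z" by (rule finite_subset[of _ "{a..<a + int (s1 * H)}"]) auto
        moreover have "x = y" if x: "x \<in> ?Z" "y \<in> ?Z" for x y
        proof -
          have "int q dvd x - y" using x by auto
          moreover have "\<bar>x - y\<bar> < int q" using x s1(2) by (auto simp flip: of_nat_mult)
          ultimately show "x = y" using zdvd_imp_le[of "int q" "\<bar>x - y\<bar>"] by (cases "x = y") auto
        qed
        ultimately show ?thesis using card_le_Suc0_iff_eq[of ?Z] by (metis One_nat_def)
      qed
      then show ?thesis by (simp add: of_bool_def sum.If_cases Int_def)
    qed
    have "real (card {w\<in>cube J1 c H. P1 w y}) \<le> (\<Sum>w\<in>cube J1 c H. res_prob q p J1 w (int y) ^ s1) / \<rho> ^ s1"
      unfolding P1_def using finite_cube[OF fin(1)] res_prob_nonneg[OF p01] pos by (intro card_Markov) auto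
    also have "\<dots> \<le> (real H ^ card J1 * ?a ^ s1) / \<rho> ^ s1"
      unfolding res_prob_def using moment_bound[OF fin(1) H p s1(1), of "\<lambda>x. of_bool (int q dvd x)" 1 1] iv pos
      by (intro divide_right_mono) auto
    also have "\<dots> = real H ^ card J1 * ?b1" by (simp add: power_divide)
    finally have b: "real (card {w\<in>cube J1 c H. P1 w y}) \<le> real H ^ card J1 * ?b1" .
    have "real (card {w\<in>cube ((J2 \<union> J3) \<union> J1) c H. P1 w y}) \<le> real H ^ card (J2 \<union> J3) * (real H ^ card J1 * ?b1)"
    proof (rule card_cube_Un_le)
      fix x :: "'a \<Rightarrow> int"
      have "P1 (\<lambda>j. if j \<in> J2 \<union> J3 then x j else z j) y \<longleftrightarrow> P1 z y" for z
      proof -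
        have "res_prob q p J1 (\<lambda>j. if j \<in> J2 \<union> J3 then x j else z j) = res_prob q p J1 z"
          by (rule res_prob_cong) (use disj in auto)
        then show ?thesis by (simp only: P1_def)
      qed
      then show "real (card {z\<in>cube J1 c H. P1 (\<lambda>j. if j \<in> J2 \<union> J3 then x j else z j) y}) \<le> real H ^ card J1 * ?b1"
        using b by simp
    qed (use fin disj in auto)
    also have "real H ^ card (J2 \<union> J3) * (real H ^ card J1 * ?b1) = real H ^ card ?J * ?b1"
      using fin disj by (simp add: cJ card_Un_disjoint power_add)
    finally show "real (card {w\<in>?C. P1 w y}) \<le> real H ^ card ?J * ?b1" by (simp add: Un_ac)
  qed
  have c2: "real (card {w\<in>?C. \<exists>j<q. P2 w j}) \<le> real q * (real H ^ card ?J * ?b2)"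
  proof (rule card_ex_residue_le[OF finC])
    fix j assume "j < q"
    have b: "real (card {w\<in>cube J2 c H. P2 w j}) \<le> real H ^ card J2 * ?b2"
    proof (cases "mid j")
      case True
      then have far: "real q < 2 * A * real H * real_of_int (cdist q (int j))"
        and lt: "real_of_int (cdist q (int j)) / real q \<le> \<theta>\<^sub>0" using q by (simp_all add: mid_def field_simps)
      have "real (card {w\<in>cube J2 c H. P2 w j}) \<le>
        real H ^ card J2 * ((14 * A * (t + real_of_int (cdist q (int j)) / real q) + exp (- p * real K * t\<^sup>2)) ^ card J2 / \<tau> ^ K)"
        using card_phi_large[OF q H p A t fin(2) far pos(2)] True by (simp add: P2_def)
      also have "\<dots> \<le> real H ^ card J2 * ?b2"
        using lt A t pos cdist_props(1)[OF q, of "int j"]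
        by (intro mult_left_mono divide_right_mono power_mono add_mono add_nonneg_nonneg mult_nonneg_nonneg) auto
      finally show ?thesis .
    next
      case False
      then have e: "{w\<in>cube J2 c H. P2 w j} = {}" by (simp add: P2_def)
      have "0 \<le> 14 * A * (t + \<theta>\<^sub>0) + exp (- p * real K * t\<^sup>2)"
        using A t pos by (intro add_nonneg_nonneg mult_nonneg_nonneg) auto
      then show ?thesis unfolding e using pos by simp
    qed
    have "real (card {w\<in>cube ((J1 \<union> J3) \<union> J2) c H. P2 w j}) \<le> real H ^ card (J1 \<union> J3) * (real H ^ card J2 * ?b2)"
    proof (rule card_cube_Un_le)
      fix x :: "'a \<Rightarrow> int"
      have "P2 (\<lambda>j. if j \<in> J1 \<union> J3 then x j else z j) j \<longleftrightarrow> P2 z j" for z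
      proof -
        have "phi q p J2 (\<lambda>j. if j \<in> J1 \<union> J3 then x j else z j) = phi q p J2 z"
          by (rule phi_cong) (use disj in auto)
        then show ?thesis by (simp only: P2_def)
      qed
      then show "real (card {z\<in>cube J2 c H. P2 (\<lambda>j. if j \<in> J1 \<union> J3 then x j else z j) j}) \<le> real H ^ card J2 * ?b2"
        using b by simp
    qed (use fin disj in auto)
    also have "real H ^ card (J1 \<union> J3) * (real H ^ card J2 * ?b2) = real H ^ card ?J * ?b2"
      using fin disj by (simp add: cJ card_Un_disjoint power_add)
    finally show "real (card {w\<in>?C. P2 w j}) \<le> real H ^ card ?J * ?b2" by (simp add: Un_ac)
  qed
  have c3: "real (card {w\<in>?C. \<exists>y<q. P3 w y}) \<le> real q * (real H ^ card ?J * ?b3)"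
  proof (rule card_ex_residue_le[OF finC])
    fix y assume "y < q"
    let ?G1 = "\<tau> * sqrt (real q * \<rho>)"
    let ?G = "\<rho> + (2 * W + 2) / real q"
    let ?a = "?G1 / real H + ?G * (1 - p) ^ (card J3 - s3)"
    have b30: "?b3 \<ge> 0" using pos W p01 by simp
    have "real (card {w\<in>cube ((J1 \<union> J2) \<union> J3) c H. P3 w y}) \<le> real H ^ card (J1 \<union> J2) * (real H ^ card J3 * ?b3)"
    proof (rule card_cube_Un_le)
      fix x :: "'a \<Rightarrow> int"
      let ?m = "\<lambda>z j. if j \<in> J1 \<union> J2 then x j else z j"
      have T_eq: "T (?m z) = T x" for z
        unfolding T_def using phi_cong[of J1 "?m z" x q p] phi_cong[of J2 "?m z" x q p] by simp
      have G_eq: "Good (?m z) = Good x" for z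
        unfolding Good_def P1_def P2_def using phi_cong[of J2 "?m z" x q p] res_prob_cong[of J1 "?m z" x q p] by simp
      have s_eq: "ssum S (?m z) = ssum S z" if "S \<subseteq> J3" for S z
        using that disj by (intro ssum_cong) auto
      have E_eq: "bexp (\<lambda>_. p) J3 (\<lambda>S. T x (int y + ssum S (?m z))) = bexp (\<lambda>_. p) J3 (\<lambda>S. T x (int y + ssum S z))" for z
        by (rule bexp_cong) (simp only: s_eq)
      show "real (card {z\<in>cube J3 c H. P3 (?m z) y}) \<le> real H ^ card J3 * ?b3"
      proof (cases "Good x")
        case True
        have T0: "T x z \<ge> 0" for z by (simp add: T_def tail_norm_def)
        have "real (card {z\<in>cube J3 c H. P3 (?m z) y}) \<le>
          real (card {z\<in>cube J3 c H. bexp (\<lambda>_. p) J3 (\<lambda>S. T x (int y + ssum S z)) > \<sigma>})"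
          unfolding P3_def T_eq G_eq E_eq using True by simp
        also have "\<dots> \<le> (\<Sum>z\<in>cube J3 c H. (bexp (\<lambda>_. p) J3 (\<lambda>S. T x (int y + ssum S z))) ^ s3) / \<sigma> ^ s3"
          using finite_cube[OF fin(3)] p01 T0 pos by (intro card_Markov bexp_nonneg) auto
        also have "\<dots> \<le> (real H ^ card J3 * ?a ^ s3) / \<sigma> ^ s3"
          using moment_bound[OF fin(3) H p s3(1) T0 te(2)[OF True] te(3)[OF True s3(2)]] pos
          by (intro divide_right_mono) auto
        also have "\<dots> = real H ^ card J3 * ?b3" by (simp add: power_divide)
        finally show ?thesis .
      next
        case False
        then have e: "{z\<in>cube J3 c H. P3 (?m z) y} = {}" by (simp only: P3_def G_eq) simp
        show ?thesis unfolding e using b30 by simp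
      qed
    qed (use fin disj in auto)
    also have "real H ^ card (J1 \<union> J2) * (real H ^ card J3 * ?b3) = real H ^ card ?J * ?b3"
      using fin disj by (simp add: cJ card_Un_disjoint power_add)
    finally show "real (card {w\<in>?C. P3 w y}) \<le> real H ^ card ?J * ?b3" .
  qed
  have "card ?Bad \<le> card ({w\<in>?C. \<exists>y<q. P1 w y} \<union> {w\<in>?C. \<exists>j<q. P2 w j} \<union> {w\<in>?C. \<exists>y<q. P3 w y})"
    using finC by (intro card_mono[OF _ sub]) auto
  also have "\<dots> \<le> card {w\<in>?C. \<exists>y<q. P1 w y} + card {w\<in>?C. \<exists>j<q. P2 w j} + card {w\<in>?C. \<exists>y<q. P3 w y}"
    by (meson add_le_mono card_Un_le order_refl order_trans)
  finally have "real (card ?Bad) \<le> real (card {w\<in>?C. \<exists>y<q. P1 w y}) + real (card {w\<in>?C. \<exists>j<q. P2 w j}) + real (card {w\<in>?C. \<exists>y<q. P3 w y})"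
    by linarith
  also have "\<dots> \<le> real q * (real H ^ card ?J * ?b1) + real q * (real H ^ card ?J * ?b2) + real q * (real H ^ card ?J * ?b3)"
    using c1 c2 c3 by linarith
  also have "\<dots> = real H ^ card ?J * (real q * (?b1 + ?b2 + ?b3))" by (simp only: distrib_left mult_ac)
  finally show ?thesis .
qed

section \<open>From averaged residue probabilities back to windows\<close>

lemma sum_le_sum_avg:
  fixes f :: "int \<Rightarrow> real"
  assumes r: "r > 0" and f: "\<And>x. f x \<ge> 0"
  shows "(\<Sum>z\<in>{a..<b}. f z) \<le> (\<Sum>y\<in>{a - int r..<b}. avg r f y)"
proof -
  have "real r * (\<Sum>z\<in>{a..<b}. f z) = (\<Sum>d<r. \<Sum>z\<in>{a..<b}. f z)" by simp
  also have "\<dots> \<le> (\<Sum>d<r. \<Sum>y\<in>{a - int r..<b}. f (y + int d))"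
  proof (rule sum_mono)
    fix d assume d: "d \<in> {..<r}"
    have "(\<Sum>z\<in>{a..<b}. f z) = (\<Sum>y\<in>{a - int d..<b - int d}. f (y + int d))"
      by (rule sum.reindex_bij_witness[of _ "\<lambda>y. y + int d" "\<lambda>z. z - int d"]) auto
    \<comment> \<open>Every shift by d < r keeps the interval inside the one extended by r to the
      left, and the additional terms are nonnegative.\<close>
    also have "\<dots> \<le> (\<Sum>y\<in>{a - int r..<b}. f (y + int d))"
      using d f by (intro sum_mono2) auto
    finally show "(\<Sum>z\<in>{a..<b}. f z) \<le> (\<Sum>y\<in>{a - int r..<b}. f (y + int d))" .
  qed
  also have "\<dots> = real r * (\<Sum>y\<in>{a - int r..<b}. avg r f y)"
    unfolding avg_def sum_distrib_left by (subst sum.swap) (use r in simp)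
  finally show ?thesis using r by simp
qed

lemma sum_le_sum_avg_pow:
  fixes f :: "int \<Rightarrow> real"
  assumes r: "r > 0" and f: "\<And>x. 0 \<le> f x \<and> f x \<le> M"
  shows "(\<Sum>z\<in>{a..<b}. f z) \<le> (\<Sum>y\<in>{a - int (h * r)..<b}. (avg r ^^ h) f y)"
proof (induction h)
  case (Suc h)
  have "(\<Sum>z\<in>{a..<b}. f z) \<le> (\<Sum>y\<in>{a - int (h * r) - int r..<b}. avg r ((avg r ^^ h) f) y)"
    using Suc sum_le_sum_avg[OF r, of "(avg r ^^ h) f" "a - int (h * r)" b] avg_pow_bounds[OF r f] by force
  then show ?case by (simp add: algebra_simps)
qed simp

definition window_prob :: "real \<Rightarrow> 'a set \<Rightarrow> nat \<Rightarrow> ('a \<Rightarrow> int) \<Rightarrow> int \<Rightarrow> real" where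
  "window_prob p J r w z = bexp (\<lambda>_. p) J (\<lambda>S. of_bool (ssum S w \<in> {z..<z + int r}))"

text \<open>The window contributes r residue probabilities, at -z - r + 1 up to -z, because
  \<open>res_prob\<close> at y concerns the value -y. Undoing each of the h averagings lengthens
  this range by r, hence the (h + 1) r terms.\<close>

lemma window_prob_le:
  assumes r: "r > 0" and p: "0 \<le> p" "p \<le> 1" and J: "finite J"
    and M: "\<And>y. (avg r ^^ h) (res_prob q p J w) y \<le> M"
  shows "window_prob p J r w z \<le> real ((h + 1) * r) * M"
proof -
  have b: "0 \<le> res_prob q p J w y \<and> res_prob q p J w y \<le> 1" for y
    using res_prob_nonneg[OF p] p J by (auto simp: res_prob_def intro!: bexp_le_const)
  have "window_prob p J r w z \<le> bexp (\<lambda>_. p) J (\<lambda>S. \<Sum>y\<in>{- z - int r + 1..<- z + 1}. of_bool (int q dvd y + ssum S w))"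
    unfolding window_prob_def
  proof (rule bexp_mono)
    fix S
    show "of_bool (ssum S w \<in> {z..<z + int r}) \<le> (\<Sum>y\<in>{- z - int r + 1..<- z + 1}. of_bool (int q dvd y + ssum S w) :: real)"
    proof (cases "ssum S w \<in> {z..<z + int r}")
      case True
      have "(of_bool (int q dvd (- ssum S w) + ssum S w) :: real) \<le> (\<Sum>y\<in>{- z - int r + 1..<- z + 1}. of_bool (int q dvd y + ssum S w))"
        using True by (intro member_le_sum[of "- ssum S w" _ "\<lambda>y. of_bool (int q dvd y + ssum S w)"]) auto
      then show ?thesis using True by simp
    next
      case False
      then have "of_bool (ssum S w \<in> {z..<z + int r}) = (0::real)" by (simp only: of_bool_def if_False)
      moreover have "0 \<le> (\<Sum>y\<in>{- z - int r + 1..<- z + 1}. of_bool (int q dvd y + ssum S w) :: real)"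
        by (intro sum_nonneg) simp
      ultimately show ?thesis by (simp only:)
    qed
  qed (use p in auto)
  also have "\<dots> = (\<Sum>y\<in>{- z - int r + 1..<- z + 1}. res_prob q p J w y)"
    unfolding res_prob_def by (rule bexp_sum)
  also have "\<dots> \<le> (\<Sum>y\<in>{- z - int r + 1 - int (h * r)..<- z + 1}. (avg r ^^ h) (res_prob q p J w) y)"
    by (rule sum_le_sum_avg_pow[OF r b])
  also have "\<dots> \<le> (\<Sum>y\<in>{- z - int r + 1 - int (h * r)..<- z + 1}. M)" by (intro sum_mono M)
  also have "\<dots> = real ((h + 1) * r) * M" by (simp add: algebra_simps)
  finally show ?thesis .
qed

section \<open>Choice of the parameters as powers of n\<close>

context
  fixes p \<delta> A :: real
  assumes p: "0 < p" "p \<le> 1 / 2" and \<delta>: "0 < \<delta>" "\<delta> < 1 / 5" and A: "A \<ge> 1"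
begin

lemma eventually_tail_decay: "eventually (\<lambda>n::nat. exp (- (p * \<delta> * real n powr (\<delta> / 16))) \<le> real n powr (-5)) at_top"
  using p \<delta> by real_asymp

lemma eventually_pointwise_step: "eventually (\<lambda>n::nat. 28 * A * real n powr (-1/4) + exp (- (p * real n powr (1/4))) \<le> real n powr (-1/5)) at_top"
  using p A by real_asymp

lemma eventually_l2_tail: "eventually (\<lambda>n::nat. real n powr (-4) + (real n + (2 * real n powr (\<delta> / 32 + 1/2) + 2) / real n) * exp ((\<delta> * real n - 1) * ln (1 - p))
   \<le> 2 * real n powr (-4)) at_top"
proof -
  define L where "L = ln (1 - p)"
  have "L < 0" using p by (simp add: L_def)
  define c C where "c = - (\<delta> * L)" and "C = exp (- L)"
  have c: "c > 0" "C > 0" using \<open>L < 0\<close> \<delta> by (simp_all add: c_def C_def mult_pos_neg)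
  have e: "exp ((\<delta> * real n - 1) * L) = exp (- (c * real n)) * C" for n
    by (simp add: c_def C_def algebra_simps flip: exp_add)
  show ?thesis unfolding L_def[symmetric] e using \<delta> c by real_asymp
qed

text \<open>Serves the first and the third block, which both contribute 2 / n to a power near
  \<delta> n. In logarithms \<delta> n ln n is available and a quarter of it is required, so the
  remaining (3 \<delta> / 4) n ln n has to beat terms of order n.\<close>

lemma eventually_first_block_count: "eventually (\<lambda>n::nat. 2 * (real n * 2 ^ n) * (2 / real n) powr (\<delta> * real n - 1) \<le> real n powr (- \<delta> * real n / 4) / 2) at_top"
proof -
  define d where "d = 3 * \<delta> / 4"
  have d: "d > 0" using \<delta> by (simp add: d_def)
  have "eventually (\<lambda>n::nat. ln 4 + 2 * ln (real n) + real n * (ln 2 + \<delta> * ln 2) - ln 2 - d * (real n * ln (real n)) \<le> 0) at_top"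
    using d by real_asymp
  then show ?thesis using eventually_gt_at_top[of 0]
  proof eventually_elim
    case (elim n)
    have n: "real n = exp (ln (real n))" using elim by simp
    have "2 * (real n * 2 ^ n) * (2 / real n) powr (\<delta> * real n - 1)
       = exp (ln 2) * (exp (ln (real n)) * exp (real n * ln 2)) * exp ((\<delta> * real n - 1) * (ln 2 - ln (real n)))"
      using elim by (simp add: powr_def ln_div exp_of_nat_mult)
    also have "\<dots> = exp (ln 2 + (ln (real n) + real n * ln 2) + (\<delta> * real n - 1) * (ln 2 - ln (real n)))"
      by (simp only: exp_add)
    also have "\<dots> \<le> exp (- \<delta> * real n / 4 * ln (real n) - ln 2)"
    proof -
      have "ln (4::real) = 2 * ln 2" using ln_realpow[of 2 2] by simp
      then show ?thesis using elim(1) unfolding exp_le_cancel_iff d_def by (simp add: field_simps)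
    qed
    also have "\<dots> = real n powr (- \<delta> * real n / 4) / 2"
      using elim by (simp add: powr_def exp_diff)
    finally show ?case .
  qed
qed

text \<open>Serves the middle frequencies: n ^ (-1/5) for each of the 2 l coordinates of the second
  block, against the factor \<open>\<tau>\<close> to the power -K, whose exponent of n is only of
  order n ^ (3/4).\<close>

lemma eventually_last_block_count: "eventually (\<lambda>n::nat. (real n * 2 ^ n) * (real n powr (- 2 / 5 * (\<delta> * real n - 1)) * real n powr (5 * (real n powr (3/4) + 1)))
   \<le> real n powr (- \<delta> * real n / 4) / 2) at_top"
  using \<delta> by real_asymp

lemma eventually_near_multiples: "eventually (\<lambda>n::nat. 21 * (sqrt (real n) + 1) * ((2 * real n powr (\<delta> / 32 + 1/2) + 2) / real n + real n powr (-1/2)) \<le> real n powr (\<delta> / 16)) at_top"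
  using \<delta> by real_asymp

text \<open>The assumption \<open>e\<close> makes the term for dependent rows in the first block,
  \<open>(1 - p) ^ (n - 5 * l)\<close> with l about \<delta> n, at most 1 / H on the whole range of
  H, hence no larger than the main term of the moment bound. Of the 5 l missing coordinates, 4 l go
  to the other two blocks and l to the order of the moment.\<close>

lemma cube_bad_points:
  assumes e: "(1 - p) powr (1 - 5 * \<delta>) \<le> 1 - p'" and p': "p' < p"
  shows "eventually (\<lambda>n. \<forall>H c J2. H > 0 \<longrightarrow> real H \<le> (1 - p') powr (- real n) \<longrightarrow> J2 \<subseteq> {..<n} \<longrightarrow>
      \<delta> * real n \<le> real (card J2) / 2 \<longrightarrow>
      (\<forall>i\<in>J2. \<forall>x\<in>{c i..<c i + int H}. real H \<le> \<bar>real_of_int x\<bar> \<and> \<bar>real_of_int x\<bar> \<le> A * real H) \<longrightarrow>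
      real (card {w\<in>cube {..<n} c H. \<exists>z. window_prob p {..<n} (nat \<lceil>sqrt (real n)\<rceil>) w z > real n powr (\<delta> / 16) / real H})
        \<le> real H ^ n * real n powr (- \<delta> * real n / 4)) at_top"
  using eventually_tail_decay eventually_pointwise_step eventually_l2_tail eventually_first_block_count eventually_last_block_count eventually_near_multiples eventually_ge_at_top[of "nat \<lceil>2 / \<delta>\<rceil> + 2"]
proof eventually_elim
  case (elim n)
  show ?case
  proof (intro allI impI)
    fix H :: nat and c :: "nat \<Rightarrow> int" and J2' :: "nat set"
    assume H: "H > 0" and HN: "real H \<le> (1 - p') powr (- real n)" and J2': "J2' \<subseteq> {..<n}" "\<delta> * real n \<le> real (card J2') / 2"
      and good: "\<forall>i\<in>J2'. \<forall>x\<in>{c i..<c i + int H}. real H \<le> \<bar>real_of_int x\<bar> \<and> \<bar>real_of_int x\<bar> \<le> A * real H"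
    have n2: "n \<ge> 2" using elim by simp
    have dn: "2 \<le> \<delta> * real n"
    proof -
      have "2 / \<delta> \<le> real n" using elim(7) by linarith
      then show ?thesis using \<delta> by (simp add: field_simps)
    qed
    \<comment> \<open>The order of the moments in the first and third block. \<open>J2\<close> and
      \<open>J3\<close> get 2 l coordinates each, so in the third block l coordinates remain after l
      rows have been exposed.\<close>
    define l where "l = nat \<lfloor>\<delta> * real n\<rfloor>"
    have l: "real l \<le> \<delta> * real n" "\<delta> * real n - 1 \<le> real l" using \<delta> by (simp_all add: l_def)
    have l5: "5 * l \<le> n"
    proof -
      have "5 * (\<delta> * real n) \<le> 5 * (1 / 5 * real n)" using \<delta> by (intro mult_left_mono mult_right_mono) auto
      then have "real (5 * l) \<le> real n" using l(1) by simp
      then show ?thesis by linarith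
    qed
    have "2 * l \<le> card J2'" using J2'(2) l by linarith
    then obtain J2 where J2: "J2 \<subseteq> J2'" "card J2 = 2 * l" "finite J2"
      using obtain_subset_with_card_n by metis
    have "card ({..<n} - J2) = n - 2 * l" using J2 J2'(1) by (subst card_Diff_subset) auto
    then obtain J3 where J3: "J3 \<subseteq> {..<n} - J2" "card J3 = 2 * l" "finite J3"
    proof -
      have "2 * l \<le> card ({..<n} - J2)" using l5 \<open>card ({..<n} - J2) = n - 2 * l\<close> by simp
      then show ?thesis using that obtain_subset_with_card_n by metis
    qed
    define J1 where "J1 = {..<n} - J2 - J3"
    have J: "J1 \<union> J2 \<union> J3 = {..<n}" using J2(1) J2'(1) J3(1) by (auto simp: J1_def)
    have disj: "J1 \<inter> J2 = {}" "J1 \<inter> J3 = {}" "J2 \<inter> J3 = {}" using J3(1) by (auto simp: J1_def)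
    have J1: "finite J1" "card J1 = n - 4 * l"
      using J2 J2'(1) J3 by (auto simp: J1_def card_Diff_subset)
    define r where "r = nat \<lceil>sqrt (real n)\<rceil>"
    have r: "sqrt (real n) \<le> real r" "real r \<le> sqrt (real n) + 1" "r > 0" using n2 by (auto simp: r_def)
    \<comment> \<open>Large enough for windows of length l H to fit into one period; still, W / q is
      only n ^ (\<delta> / 32 - 1/2) / H.\<close>
    define q where "q = n * H"
    have q: "q > 0" using n2 H by (simp add: q_def)
    \<comment> \<open>With this exponent (H W / q)^2 = n ^ (\<delta> / 16 - 1), so the 2 l
      low-frequency factors of the second block give exp (- c n ^ (\<delta> / 16)), below any power
      of n. On the other hand r W / q is of order n ^ (\<delta> / 32) / H, which the final bound n ^
      (\<delta> / 16) / H absorbs.\<close>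
    define W where "W = real n powr (\<delta> / 32 + 1 / 2)"
    have W: "W > 0" using n2 by (simp add: W_def)
    \<comment> \<open>K t^2 is about n ^ (1/4), enough to make the exponential term negligible,
      while dividing by \<open>\<tau> ^ K\<close> costs only exp (O (n ^ (3/4) ln n)).\<close>
    define K where "K = nat \<lceil>real n powr (3/4)\<rceil>"
    have K: "real n powr (3/4) \<le> real K" "real K \<le> real n powr (3/4) + 1" by (auto simp: K_def)
    define t where "t = real n powr (-1/4)"
    define \<rho> where "\<rho> = real n / real H"
    \<comment> \<open>Twenty averagings reach n ^ (-5), because r t is at least n ^ (1/4). As sqrt
      (q \<rho>) = n, this leaves n ^ (-4) / H in the third block, which after division by \<sigma>
      is far below 1 / n.\<close>
    define \<tau> where "\<tau> = real n powr (-5)"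
    define \<sigma> where "\<sigma> = real n powr (-1/2) / real H"
    have "t \<le> real n powr 0" unfolding t_def using n2 by (intro powr_mono) auto
    then have t: "0 \<le> t" "t \<le> 1" "t > 0" using n2 by (auto simp: t_def)
    have pos: "\<rho> > 0" "\<tau> > 0" "\<sigma> > 0" using n2 H by (auto simp: \<rho>_def \<tau>_def \<sigma>_def)
    \<comment> \<open>So the union over the q residues costs at most
      \<open>n * 2 ^ n\<close>.\<close>
    have H2: "real H \<le> 2 ^ n"
    proof -
      have "(1 - p') powr (- real n) = (1 / (1 - p')) ^ n"
        using p p' by (simp add: powr_minus powr_realpow field_simps)
      also have "\<dots> \<le> 2 ^ n" using p p' by (intro power_mono) (auto simp: field_simps)
      finally show ?thesis using HN by linarith
    qed
    have det: "exp (- p * real (card J2) * (real H * W / real q)\<^sup>2) \<le> \<tau>"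
    proof -
      have "real H * W / real q = real n powr (\<delta> / 32 + 1 / 2) / real n" using H n2 by (simp add: W_def q_def)
      also have "\<dots> = real n powr (\<delta> / 32 - 1 / 2)" using n2 powr_diff[of "real n" "\<delta> / 32 + 1 / 2" 1] by simp
      finally have "(real H * W / real q)\<^sup>2 = real n powr (\<delta> / 16 - 1)"
        using n2 by (simp add: powr_power power2_eq_square flip: powr_add)
      also have "\<dots> = real n powr (\<delta> / 16) / real n" using n2 by (simp add: powr_diff)
      finally have e1: "(real H * W / real q)\<^sup>2 = real n powr (\<delta> / 16) / real n" .
      have "\<delta> * real n \<le> real (card J2)" using l dn J2(2) by simp
      then have "\<delta> \<le> real (card J2) / real n" using n2 by (simp add: field_simps)
      then have "p * \<delta> * real n powr (\<delta> / 16) \<le> p * (real (card J2) / real n) * real n powr (\<delta> / 16)"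
        using p by (intro mult_right_mono mult_left_mono) auto
      then have "exp (- p * real (card J2) * (real H * W / real q)\<^sup>2) \<le> exp (- (p * \<delta> * real n powr (\<delta> / 16)))"
        unfolding e1 by (simp add: mult_ac)
      then show ?thesis using elim(1) unfolding \<tau>_def by linarith
    qed
    have high: "(1 / (real r * t)) ^ 20 \<le> \<tau>"
    proof -
      have "real n powr (1/4) = real n powr (1/2) * t" using n2 by (simp add: t_def flip: powr_add)
      also have "\<dots> \<le> real r * t" using r t n2 by (intro mult_right_mono) (simp_all add: powr_half_sqrt)
      finally have le: "real n powr (1/4) \<le> real r * t" .
      have "1 / (real r * t) \<le> 1 / real n powr (1/4)" using n2 by (intro divide_left_mono[OF le]) (use r t in auto)
      also have "\<dots> = real n powr (-1/4)" using n2 by (simp add: powr_minus_divide)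
      finally have "(1 / (real r * t)) ^ 20 \<le> (real n powr (-1/4)) ^ 20" using r t by (intro power_mono) auto
      also have "\<dots> = \<tau>" using n2 by (simp add: \<tau>_def powr_power)
      finally show ?thesis .
    qed
    define Bad where "Bad = {w\<in>cube {..<n} c H. \<exists>y. (avg r ^^ 20) (res_prob q p {..<n} w) y > (2 * W + 2) / real q + \<sigma>}"
    define b1 where "b1 = ((1 / real H + (1 - p) ^ (card J1 - l)) / \<rho>) ^ l"
    define b2 where "b2 = (14 * A * (t + t) + exp (- p * real K * t\<^sup>2)) ^ card J2 / \<tau> ^ K"
    define b3 where "b3 = ((\<tau> * sqrt (real q * \<rho>) / real H + (\<rho> + (2 * W + 2) / real q) * (1 - p) ^ (card J3 - l)) / \<sigma>) ^ l"
    have bad: "real (card Bad) \<le> real H ^ n * (real q * (b1 + b2 + b3))"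
    proof -
      have "real (card {w\<in>cube (J1 \<union> J2 \<union> J3) c H.
          \<exists>y. (avg r ^^ 20) (res_prob q p (J1 \<union> J2 \<union> J3) w) y > (2 * W + 2) / real q + \<sigma>})
        \<le> real H ^ card (J1 \<union> J2 \<union> J3) * (real q * (b1 + b2 + b3))"
        unfolding b1_def b2_def b3_def
      proof (rule card_concentrated_cube_points[OF q r(3) H less_imp_le[OF p(1)] p(2) J1(1) J2(3) J3(3) disj W A t(1,2) pos t(3)])
        show "l \<le> card J1" "l \<le> card J3" using J1(2) J3(2) l5 by auto
        show "l * H \<le> q" "l * H \<le> q" using l5 by (auto simp: q_def)
        show "real H \<le> \<bar>real_of_int x\<bar> \<and> \<bar>real_of_int x\<bar> \<le> A * real H" if "i \<in> J2" "x \<in> {c i..<c i + int H}" for i x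
          using good J2(1) that by blast
      qed (use det high in auto)
      then show ?thesis unfolding J Bad_def by simp
    qed
    have l1: "(2 / real n) ^ l \<le> (2 / real n) powr (\<delta> * real n - 1)"
    proof -
      have "(2 / real n) ^ l = (2 / real n) powr real l" using n2 by (simp add: powr_realpow)
      also have "\<dots> \<le> (2 / real n) powr (\<delta> * real n - 1)" using n2 l by (intro powr_mono') auto
      finally show ?thesis .
    qed
    have b1: "b1 \<le> (2 / real n) ^ l"
      unfolding b1_def
    proof (rule power_mono)
      have "(1 - p) ^ (card J1 - l) \<le> 1 / real H"
      proof -
        have c: "card J1 - l = n - 5 * l" using J1(2) by simp
        have "(1 - p) ^ (card J1 - l) = (1 - p) powr real (n - 5 * l)"
          unfolding c using p by (intro powr_realpow[symmetric]) simp
        also have "\<dots> \<le> (1 - p) powr ((1 - 5 * \<delta>) * real n)"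
          using p l(1) l5 by (intro powr_mono') (auto simp: algebra_simps of_nat_diff)
        also have "\<dots> = ((1 - p) powr (1 - 5 * \<delta>)) powr real n" by (simp add: powr_powr)
        also have "\<dots> \<le> (1 - p') powr real n" using e p by (intro powr_mono2) auto
        also have "\<dots> \<le> 1 / real H"
          using HN H p p' by (simp add: powr_minus field_simps)
        finally show ?thesis .
      qed
      then have "(1 / real H + (1 - p) ^ (card J1 - l)) / \<rho> \<le> (2 / real H) / \<rho>"
        using pos by (intro divide_right_mono) auto
      also have "\<dots> = 2 / real n" using H by (simp add: \<rho>_def)
      finally show "(1 / real H + (1 - p) ^ (card J1 - l)) / \<rho> \<le> 2 / real n" .
      show "0 \<le> (1 / real H + (1 - p) ^ (card J1 - l)) / \<rho>" using pos p by simp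
    qed
    have b3: "b3 \<le> (2 / real n) ^ l"
      unfolding b3_def
    proof (rule power_mono)
      show "0 \<le> (\<tau> * sqrt (real q * \<rho>) / real H + (\<rho> + (2 * W + 2) / real q) * (1 - p) ^ (card J3 - l)) / \<sigma>"
        using pos p W by simp
      have sq: "sqrt (real q * \<rho>) = real n" using H by (simp add: q_def \<rho>_def flip: power2_eq_square)
      have "\<tau> * real n = real n powr (-4)" using n2 powr_add[of "real n" "-5" 1] by (simp add: \<tau>_def)
      then have s1: "\<tau> * sqrt (real q * \<rho>) / real H = real n powr (-4) / real H" by (simp add: sq)
      have s2: "\<rho> + (2 * W + 2) / real q = (real n + (2 * W + 2) / real n) / real H"
        using H n2 by (simp add: \<rho>_def q_def add_divide_distrib)
      have "(1 - p) ^ (card J3 - l) = exp (real l * ln (1 - p))" using p J3(2) by (simp add: exp_of_nat_mult)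
      also have "\<dots> \<le> exp ((\<delta> * real n - 1) * ln (1 - p))" using p l(2) by (simp add: mult_right_mono_neg)
      finally have s3: "(1 - p) ^ (card J3 - l) \<le> exp ((\<delta> * real n - 1) * ln (1 - p))" .
      have "\<tau> * sqrt (real q * \<rho>) / real H + (\<rho> + (2 * W + 2) / real q) * (1 - p) ^ (card J3 - l)
        \<le> real n powr (-4) / real H + (real n + (2 * W + 2) / real n) / real H * exp ((\<delta> * real n - 1) * ln (1 - p))"
        unfolding s1 s2 using W by (intro add_left_mono mult_left_mono s3) auto
      also have "\<dots> = (real n powr (-4) + (real n + (2 * W + 2) / real n) * exp ((\<delta> * real n - 1) * ln (1 - p))) / real H"
        by (simp only: add_divide_distrib[of "real n powr (-4)"] times_divide_eq_left)
      also have "\<dots> \<le> 2 * real n powr (-4) / real H"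
        using elim(3) H by (intro divide_right_mono) (auto simp: W_def)
      finally have "(\<tau> * sqrt (real q * \<rho>) / real H + (\<rho> + (2 * W + 2) / real q) * (1 - p) ^ (card J3 - l)) / \<sigma>
        \<le> (2 * real n powr (-4) / real H) / \<sigma>" using pos by (intro divide_right_mono) auto
      also have "\<dots> = 2 * (real n powr (-4) / real n powr (-1/2))" using H by (simp add: \<sigma>_def)
      also have "\<dots> = 2 * real n powr (-4 - (-1/2))" by (simp only: powr_diff)
      also have "\<dots> \<le> 2 * real n powr (-1)" using n2 by (intro mult_left_mono powr_mono) auto
      also have "\<dots> = 2 / real n" using n2 by (simp add: powr_minus_divide)
      finally show "(\<tau> * sqrt (real q * \<rho>) / real H + (\<rho> + (2 * W + 2) / real q) * (1 - p) ^ (card J3 - l)) / \<sigma> \<le> 2 / real n" .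
    qed
    have b2: "b2 \<le> real n powr (- 2 / 5 * (\<delta> * real n - 1)) * real n powr (5 * (real n powr (3/4) + 1))"
    proof -
      have "exp (- p * real K * t\<^sup>2) \<le> exp (- (p * real n powr (1/4)))"
      proof -
        have "real n powr (1/4) = real n powr (3/4) * t\<^sup>2"
          using n2 by (simp add: t_def powr_power flip: powr_add)
        also have "\<dots> \<le> real K * t\<^sup>2" using K by (intro mult_right_mono) auto
        finally have "p * real n powr (1/4) \<le> p * (real K * t\<^sup>2)" using p by (intro mult_left_mono) auto
        then show ?thesis by (simp add: mult.assoc)
      qed
      then have "14 * A * (t + t) + exp (- p * real K * t\<^sup>2) \<le> real n powr (-1/5)"
      proof -
        have "14 * A * (t + t) = 28 * A * real n powr (-1/4)" by (simp add: t_def)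
        then show ?thesis using elim(2) \<open>exp (- p * real K * t\<^sup>2) \<le> exp (- (p * real n powr (1/4)))\<close> by linarith
      qed
      then have "(14 * A * (t + t) + exp (- p * real K * t\<^sup>2)) ^ card J2 \<le> (real n powr (-1/5)) ^ card J2"
        using A t by (intro power_mono) auto
      also have "\<dots> = real n powr (- 2 / 5 * real l)" using n2 J2(2) by (simp add: powr_power mult_ac)
      also have "\<dots> \<le> real n powr (- 2 / 5 * (\<delta> * real n - 1))" using n2 l by (intro powr_mono) auto
      finally have x: "(14 * A * (t + t) + exp (- p * real K * t\<^sup>2)) ^ card J2 \<le> real n powr (- 2 / 5 * (\<delta> * real n - 1))" .
      have "\<tau> ^ K = \<tau> powr real K" using pos by (simp add: powr_realpow)
      also have "\<dots> = real n powr (- 5 * real K)" unfolding \<tau>_def by (rule powr_powr)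
      finally have "1 / \<tau> ^ K = real n powr (5 * real K)" using powr_minus_divide[of "real n" "- 5 * real K"] by simp
      also have "\<dots> \<le> real n powr (5 * (real n powr (3/4) + 1))" using n2 K by (intro powr_mono) auto
      finally have y: "1 / \<tau> ^ K \<le> real n powr (5 * (real n powr (3/4) + 1))" .
      have "b2 = (14 * A * (t + t) + exp (- p * real K * t\<^sup>2)) ^ card J2 * (1 / \<tau> ^ K)" by (simp add: b2_def)
      also have "\<dots> \<le> real n powr (- 2 / 5 * (\<delta> * real n - 1)) * real n powr (5 * (real n powr (3/4) + 1))"
        using pos by (intro mult_mono x y) auto
      finally show ?thesis .
    qed
    have q2: "real q \<le> real n * 2 ^ n" using H2 by (simp add: q_def mult_left_mono)
    have bnn: "b1 \<ge> 0" "b2 \<ge> 0" "b3 \<ge> 0"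
      unfolding b1_def b2_def b3_def using pos p A t W by simp_all
    have "real q * (b1 + b2 + b3) \<le> (real n * 2 ^ n) * (2 * (2 / real n) powr (\<delta> * real n - 1)
       + real n powr (- 2 / 5 * (\<delta> * real n - 1)) * real n powr (5 * (real n powr (3/4) + 1)))"
      using b1 b2 b3 l1 bnn q2 by (intro mult_mono) auto
    also have "\<dots> \<le> real n powr (- \<delta> * real n / 4) / 2 + real n powr (- \<delta> * real n / 4) / 2"
      using elim(4,5) by (simp only: distrib_left)
    finally have tot: "real q * (b1 + b2 + b3) \<le> real n powr (- \<delta> * real n / 4)" by simp
    have sub: "{w\<in>cube {..<n} c H. \<exists>z. window_prob p {..<n} r w z > real n powr (\<delta> / 16) / real H} \<subseteq> Bad"
    proof
      fix w assume w: "w \<in> {w\<in>cube {..<n} c H. \<exists>z. window_prob p {..<n} r w z > real n powr (\<delta> / 16) / real H}"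
      show "w \<in> Bad"
      proof (rule ccontr)
        assume "w \<notin> Bad"
        then have le: "(avg r ^^ 20) (res_prob q p {..<n} w) y \<le> (2 * W + 2) / real q + \<sigma>" for y
          using w by (auto simp: Bad_def not_less)
        have "window_prob p {..<n} r w z \<le> real n powr (\<delta> / 16) / real H" for z
        proof -
          have "window_prob p {..<n} r w z \<le> real ((20 + 1) * r) * ((2 * W + 2) / real q + \<sigma>)"
            using p by (intro window_prob_le[OF r(3) _ _ _ le]) auto
          also have "\<dots> = 21 * real r * ((2 * W + 2) / real n + real n powr (-1/2)) / real H"
            using H n2 by (simp add: q_def \<sigma>_def field_simps)
          also have "\<dots> \<le> 21 * (sqrt (real n) + 1) * ((2 * W + 2) / real n + real n powr (-1/2)) / real H"
            using r W by (intro divide_right_mono mult_right_mono mult_left_mono) auto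
          also have "\<dots> \<le> real n powr (\<delta> / 16) / real H"
            using elim(6) by (intro divide_right_mono) (auto simp: W_def)
          finally show ?thesis .
        qed
        then show False using w by (auto simp: not_less[symmetric])
      qed
    qed
    have "finite Bad" using finite_cube[of "{..<n}" c H] by (simp add: Bad_def)
    then have "real (card {w\<in>cube {..<n} c H. \<exists>z. window_prob p {..<n} r w z > real n powr (\<delta> / 16) / real H}) \<le> real (card Bad)"
      using card_mono[OF _ sub] by simp
    also have "\<dots> \<le> real H ^ n * real n powr (- \<delta> * real n / 4)"
      using bad mult_left_mono[OF tot, of "real H ^ n"] by simp
    finally show "real (card {w\<in>cube {..<n} c H. \<exists>z. window_prob p {..<n} (nat \<lceil>sqrt (real n)\<rceil>) w z > real n powr (\<delta> / 16) / real H})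
        \<le> real H ^ n * real n powr (- \<delta> * real n / 4)" by (simp only: r_def)
  qed
qed

end

section \<open>Smoothed concentration and random rounding\<close>

text \<open>Concentration of the inner product at scale sqrt n, smoothed by a weight with polynomial
  decay. It dominates the probability of the value 0, decreases when v is scaled up, and is stable
  under perturbations of mean square n, the size of a rounding error.\<close>

definition psi :: "real \<Rightarrow> nat \<Rightarrow> (nat \<Rightarrow> real) \<Rightarrow> real" where
  "psi p n v = bexp (\<lambda>_. p) {..<n} (\<lambda>S. 1 / (1 + (ssum S v)\<^sup>2 / real n))"

text \<open>Since 1 / (1 + m^2) \<le> 2 / m - 2 / (m + 1), the sum telescopes.\<close>

lemma sum_inverse_squares_le: "m \<ge> 1 \<Longrightarrow> (\<Sum>b<m. 1 / (1 + (real b)\<^sup>2)) \<le> 3 - 2 / real m"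
proof (induction m rule: dec_induct)
  case (step m)
  have m: "real m > 0" using step by simp
  define y where "y = 1 + (real m)\<^sup>2"
  have y: "y > 0" by (auto simp: y_def intro: add_pos_nonneg)
  have "real m * (real m + 1) \<le> 2 * y" unfolding y_def
    using zero_le_power2[of "real m - 1"] zero_le_power2[of "real m"] by (simp add: power2_eq_square algebra_simps)
  then have "2 / (2 * y) \<le> 2 / (real m * (real m + 1))"
    using m y by (intro divide_left_mono mult_pos_pos) auto
  then have "1 / (1 + (real m)\<^sup>2) \<le> 2 / (real m * (real m + 1))" unfolding y_def[symmetric] by simp
  also have "\<dots> = 2 / real m - 2 / real (Suc m)" using step by (simp add: field_simps)
  finally show ?case using step by simp
qed simp

text \<open>The line is cut into windows of length r \<ge> sqrt n. In the window separated from 0 by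
  b others the weight is at most 1 / (1 + b^2), and these bounds sum to at most 3 on either
  side.\<close>

lemma psi_le_window:
  fixes w :: "nat \<Rightarrow> int"
  assumes p: "0 \<le> p" "p \<le> 1" and n: "n > 0" and r: "sqrt (real n) \<le> real r"
    and M: "\<And>z. window_prob p {..<n} r w z \<le> M"
  shows "psi p n (\<lambda>j. real_of_int (w j)) \<le> 6 * M"
proof -
  \<comment> \<open>For a negative index a the window [a r, (a + 1) r) comes closest to 0 at its
    right end, at distance (- a - 1) r.\<close>
  define g :: "int \<Rightarrow> real" where "g a = 1 / (1 + (real_of_int (if a \<ge> 0 then a else - a - 1))\<^sup>2)" for a
  have "0 < sqrt (real n)" using n by simp
  then have "real r > 0" using r by linarith
  then have r0: "r > 0" by simp
  have "(sqrt (real n))\<^sup>2 \<le> (real r)\<^sup>2" using r by (intro power_mono) auto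
  then have rn: "real n \<le> (real r)\<^sup>2" by simp
  have "0 \<le> window_prob p {..<n} r w 0" unfolding window_prob_def using p by (intro bexp_nonneg) auto
  then have M0: "M \<ge> 0" using M[of 0] by linarith
  define L where "L = nat (Max ((\<lambda>S. \<bar>ssum S w div int r\<bar>) ` Pow {..<n}))"
  have L: "\<bar>ssum S w div int r\<bar> \<le> int L" if "S \<subseteq> {..<n}" for S
  proof -
    have "\<bar>ssum S w div int r\<bar> \<le> Max ((\<lambda>S. \<bar>ssum S w div int r\<bar>) ` Pow {..<n})"
      using that by (intro Max_ge) auto
    then show ?thesis by (simp add: L_def)
  qed
  have "psi p n (\<lambda>j. real_of_int (w j)) \<le>
    bexp (\<lambda>_. p) {..<n} (\<lambda>S. \<Sum>a\<in>{- int L..int L}. g a * of_bool (ssum S w \<in> {a * int r..<a * int r + int r}))"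
    unfolding psi_def
  proof (rule bexp_mono)
    fix S assume S: "S \<subseteq> {..<n}"
    define x where "x = ssum S w"
    define a where "a = x div int r"
    have x: "x = a * int r + x mod int r" "0 \<le> x mod int r" "x mod int r < int r" using r0 by (simp_all add: a_def)
    define b where "b = (if a \<ge> 0 then a else - a - 1)"
    have b0: "b \<ge> 0" by (simp add: b_def)
    have "b * int r \<le> \<bar>x\<bar>"
    proof (cases "a \<ge> 0")
      case True
      then show ?thesis using x by (simp add: b_def)
    next
      case False
      have "x \<le> (a + 1) * int r" using x by (simp add: distrib_right)
      then have "(- a - 1) * int r \<le> - x" by (simp add: algebra_simps)
      then show ?thesis using False by (simp add: b_def)
    qed
    then have "(real_of_int (b * int r))\<^sup>2 \<le> (real_of_int x)\<^sup>2"
      using b0 by (intro abs_le_square_iff[THEN iffD1]) (simp only: of_int_abs[symmetric] of_int_le_iff, simp add: abs_mult)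
    then have "(real_of_int b)\<^sup>2 * (real r)\<^sup>2 \<le> (real_of_int x)\<^sup>2" by (simp add: power_mult_distrib)
    then have "(real_of_int b)\<^sup>2 * real n \<le> (real_of_int x)\<^sup>2"
      using mult_left_mono[OF rn, of "(real_of_int b)\<^sup>2"] by simp
    then have "(real_of_int b)\<^sup>2 \<le> (real_of_int x)\<^sup>2 / real n" using n by (simp add: field_simps)
    then have "1 / (1 + (real_of_int x)\<^sup>2 / real n) \<le> g a"
      unfolding g_def b_def[symmetric] by (intro divide_left_mono mult_pos_pos) (auto intro: add_pos_nonneg)
    also have "\<dots> = g a * of_bool (ssum S w \<in> {a * int r..<a * int r + int r})"
      using x by (simp add: x_def)
    also have "\<dots> \<le> (\<Sum>a\<in>{- int L..int L}. g a * of_bool (ssum S w \<in> {a * int r..<a * int r + int r}))"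
      using L[OF S] by (intro member_le_sum) (auto simp: a_def x_def g_def)
    finally show "1 / (1 + (ssum S (\<lambda>j. real_of_int (w j)))\<^sup>2 / real n)
      \<le> (\<Sum>a\<in>{- int L..int L}. g a * of_bool (ssum S w \<in> {a * int r..<a * int r + int r}))"
      by (simp add: x_def ssum_def)
  qed (use p in auto)
  also have "\<dots> = (\<Sum>a\<in>{- int L..int L}. g a * window_prob p {..<n} r w (a * int r))"
    by (simp only: bexp_sum bexp_cmult window_prob_def)
  also have "\<dots> \<le> (\<Sum>a\<in>{- int L..int L}. g a * M)"
    using M by (intro sum_mono mult_left_mono) (auto simp: g_def)
  also have "\<dots> = (\<Sum>a\<in>{- int L..int L}. g a) * M" by (simp add: sum_distrib_right)
  also have "(\<Sum>a\<in>{- int L..int L}. g a) = (\<Sum>a\<in>{- int L..<0}. g a) + (\<Sum>a\<in>{0..int L}. g a)"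
    by (subst sum.union_disjoint[symmetric]) (auto intro!: sum.cong)
  also have "(\<Sum>a\<in>{- int L..<0}. g a) = (\<Sum>b<L. 1 / (1 + (real b)\<^sup>2))"
    by (rule sum.reindex_bij_witness[of _ "\<lambda>b. - int b - 1" "\<lambda>a. nat (- a - 1)"]) (auto simp: g_def)
  also have "(\<Sum>a\<in>{0..int L}. g a) = (\<Sum>b<Suc L. 1 / (1 + (real b)\<^sup>2))"
    by (rule sum.reindex_bij_witness[of _ int nat]) (auto simp: g_def)
  also have "((\<Sum>b<L. 1 / (1 + (real b)\<^sup>2)) + (\<Sum>b<Suc L. 1 / (1 + (real b)\<^sup>2))) * M \<le> (3 + 3) * M"
  proof (intro mult_right_mono add_mono M0)
    have *: "(\<Sum>b<m. 1 / (1 + (real b)\<^sup>2)) \<le> 3" for m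
      using sum_inverse_squares_le[of m] by (cases m) (auto intro: order_trans)
    show "(\<Sum>b<L. 1 / (1 + (real b)\<^sup>2)) \<le> 3" "(\<Sum>b<Suc L. 1 / (1 + (real b)\<^sup>2)) \<le> 3" by (rule *)+
  qed
  finally show ?thesis by simp
qed

section \<open>Random rounding and the stability of \<open>psi\<close>\<close>

lemma bexp_mult_right: "bexp \<pi> J (\<lambda>S. F S * c) = bexp \<pi> J F * (c :: real)"
  using bexp_cmult[of \<pi> J c F] by (simp add: mult.commute)

lemma bexp_diff: "bexp \<pi> J (\<lambda>S. F S - G S) = bexp \<pi> J F - bexp \<pi> J (G :: _ \<Rightarrow> real)"
  using bexp_add[of \<pi> J F "\<lambda>S. - 1 * G S"] unfolding bexp_cmult by simp

lemma bexp_centered_moments: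
  fixes a :: "'a \<Rightarrow> real"
  assumes "finite J"
  shows "bexp \<pi> J (\<lambda>T. \<Sum>j\<in>J. a j * (of_bool (j \<in> T) - \<pi> j)) = 0"
    and "bexp \<pi> J (\<lambda>T. (\<Sum>j\<in>J. a j * (of_bool (j \<in> T) - \<pi> j))\<^sup>2) = (\<Sum>j\<in>J. (a j)\<^sup>2 * (\<pi> j * (1 - \<pi> j)))"
  using assms
proof (induction J rule: finite_induct)
  case (insert j J)
  let ?X = "\<lambda>T. \<Sum>i\<in>J. a i * (of_bool (i \<in> T) - \<pi> i)"
  {
    fix g :: "real \<Rightarrow> real"
    have 1: "bexp \<pi> J (\<lambda>T. g (\<Sum>i\<in>insert j J. a i * (of_bool (i \<in> T) - \<pi> i))) = bexp \<pi> J (\<lambda>T. g (?X T - a j * \<pi> j))"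
      using insert(1,2) by (intro bexp_cong) (auto simp: algebra_simps)
    have 2: "bexp \<pi> J (\<lambda>T. g (\<Sum>i\<in>insert j J. a i * (of_bool (i \<in> insert j T) - \<pi> i))) = bexp \<pi> J (\<lambda>T. g (?X T + a j * (1 - \<pi> j)))"
    proof (rule bexp_cong)
      fix T
      have "(\<Sum>i\<in>J. a i * (of_bool (i \<in> insert j T) - \<pi> i)) = ?X T"
        using insert(2) by (intro sum.cong) auto
      then show "g (\<Sum>i\<in>insert j J. a i * (of_bool (i \<in> insert j T) - \<pi> i)) = g (?X T + a j * (1 - \<pi> j))"
        using insert(1,2) by (simp add: add.commute)
    qed
    have "bexp \<pi> (insert j J) (\<lambda>T. g (\<Sum>i\<in>insert j J. a i * (of_bool (i \<in> T) - \<pi> i)))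
      = (1 - \<pi> j) * bexp \<pi> J (\<lambda>T. g (?X T - a j * \<pi> j)) + \<pi> j * bexp \<pi> J (\<lambda>T. g (?X T + a j * (1 - \<pi> j)))"
      unfolding bexp_insert[OF insert(1,2)] 1 2 by simp
  }
  note step = this
  show "bexp \<pi> (insert j J) (\<lambda>T. \<Sum>i\<in>insert j J. a i * (of_bool (i \<in> T) - \<pi> i)) = 0"
    using step[of "\<lambda>x. x"] insert by (simp add: bexp_diff bexp_add bexp_const algebra_simps)
  have sq: "bexp \<pi> J (\<lambda>T. (?X T + c)\<^sup>2) = bexp \<pi> J (\<lambda>T. (?X T)\<^sup>2) + c\<^sup>2" for c
  proof -
    have "bexp \<pi> J (\<lambda>T. (?X T + c)\<^sup>2) = bexp \<pi> J (\<lambda>T. (?X T)\<^sup>2 + ((2 * c) * ?X T + c\<^sup>2))"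
      by (intro bexp_cong) (simp add: power2_eq_square algebra_simps)
    then show ?thesis unfolding bexp_add bexp_cmult bexp_const[OF insert(1)] insert.IH(1) by simp
  qed
  show "bexp \<pi> (insert j J) (\<lambda>T. (\<Sum>i\<in>insert j J. a i * (of_bool (i \<in> T) - \<pi> i))\<^sup>2)
     = (\<Sum>i\<in>insert j J. (a i)\<^sup>2 * (\<pi> i * (1 - \<pi> i)))"
  proof -
    have A: "bexp \<pi> J (\<lambda>T. (?X T - a j * \<pi> j)\<^sup>2) = bexp \<pi> J (\<lambda>T. (?X T)\<^sup>2) + (- (a j * \<pi> j))\<^sup>2"
      using sq[of "- (a j * \<pi> j)"] by (simp only: diff_conv_add_uminus)
    show ?thesis
      unfolding step[of "\<lambda>x. x\<^sup>2"] A sq insert.IH(2)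
      using insert(1,2) by (simp add: power2_eq_square algebra_simps)
  qed
qed simp_all

lemma bexp_single:
  fixes f :: "bool \<Rightarrow> real"
  assumes "finite J" "j \<in> J"
  shows "bexp \<pi> J (\<lambda>T. f (j \<in> T)) = \<pi> j * f True + (1 - \<pi> j) * f False"
proof -
  have J: "J = insert j (J - {j})" using assms by auto
  have "bexp \<pi> (J - {j}) (\<lambda>T. f (j \<in> T)) = bexp \<pi> (J - {j}) (\<lambda>T. f False)"
  proof (rule bexp_cong)
    fix T assume "T \<subseteq> J - {j}"
    then have "j \<notin> T" by auto
    then show "f (j \<in> T) = f False" by simp
  qed
  then have "bexp \<pi> (insert j (J - {j})) (\<lambda>T. f (j \<in> T)) = \<pi> j * f True + (1 - \<pi> j) * f False"
    using assms by (subst bexp_insert) (simp_all add: bexp_const)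
  then show ?thesis using J by simp
qed

text \<open>Every coordinate is rounded independently to one of the two neighbouring integers, with the
  correct mean; some outcome of the rounding has all the required properties.\<close>

lemma ex_rounding:
  fixes v :: "'a \<Rightarrow> real" and B :: "'i \<Rightarrow> 'a set" and \<kappa> :: "'a set \<Rightarrow> real"
  assumes J: "finite J" and I: "finite I" "I \<noteq> {}" and p: "0 \<le> p" "p \<le> 1"
    and B: "\<And>i. i \<in> I \<Longrightarrow> B i \<subseteq> J" "\<And>i. i \<in> I \<Longrightarrow> ssum (B i) v = 0"
    and \<kappa>: "\<And>S. S \<subseteq> J \<Longrightarrow> \<kappa> S \<ge> 0" "bexp (\<lambda>_. p) J \<kappa> > 0" and v: "\<exists>j\<in>J. v j \<noteq> 0"
  shows "\<exists>w::'a \<Rightarrow> int. (\<forall>j. \<bar>real_of_int (w j) - v j\<bar> \<le> 1)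
     \<and> (\<Sum>i\<in>I. (ssum (B i) (\<lambda>j. real_of_int (w j)))\<^sup>2) \<le> real (card I) * real (card J)
     \<and> bexp (\<lambda>_. p) J (\<lambda>S. \<kappa> S * (ssum S (\<lambda>j. real_of_int (w j) - v j))\<^sup>2) \<le> real (card J) * bexp (\<lambda>_. p) J \<kappa>
     \<and> (\<Sum>j\<in>J. \<bar>real_of_int (w j)\<bar>) \<le> 4 * (\<Sum>j\<in>J. \<bar>v j\<bar>)"
proof -
  define \<pi> where "\<pi> j = frac (v j)" for j
  define w where "w T j = \<lfloor>v j\<rfloor> + of_bool (j \<in> T)" for T j
  have \<pi>: "0 \<le> \<pi> j \<and> \<pi> j \<le> 1" for j by (simp add: \<pi>_def frac_lt_1 less_imp_le)
  have wv: "real_of_int (w T j) - v j = of_bool (j \<in> T) - \<pi> j" for T j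
    by (simp add: w_def \<pi>_def frac_def)
  have nJ: "real (card J) > 0" using J v by (auto simp: card_gt_0_iff)
  have nI: "real (card I) > 0" using I by (auto simp: card_gt_0_iff)
  have v0: "(\<Sum>j\<in>J. \<bar>v j\<bar>) > 0"
  proof -
    obtain j where j: "j \<in> J" "v j \<noteq> 0" using v by blast
    have "\<bar>v j\<bar> \<le> (\<Sum>j\<in>J. \<bar>v j\<bar>)" using j J by (intro member_le_sum) auto
    then show ?thesis using j by simp
  qed
  have var: "bexp \<pi> J (\<lambda>T. (ssum S (\<lambda>j. real_of_int (w T j) - v j))\<^sup>2) \<le> real (card J) / 4" if S: "S \<subseteq> J" for S
  proof -
    have "ssum S (\<lambda>j. real_of_int (w T j) - v j) = (\<Sum>j\<in>J. of_bool (j \<in> S) * (of_bool (j \<in> T) - \<pi> j))" for T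
      unfolding wv ssum_def by (rule sum.mono_neutral_cong_left) (use S J in auto)
    then have "bexp \<pi> J (\<lambda>T. (ssum S (\<lambda>j. real_of_int (w T j) - v j))\<^sup>2) = (\<Sum>j\<in>J. (of_bool (j \<in> S))\<^sup>2 * (\<pi> j * (1 - \<pi> j)))"
      using bexp_centered_moments(2)[OF J] by simp
    also have "\<dots> \<le> (\<Sum>j\<in>J. 1 / 4)"
    proof (rule sum_mono)
      fix j
      have "\<pi> j * (1 - \<pi> j) \<le> 1 / 4" using zero_le_power2[of "\<pi> j - 1 / 2"] by (simp add: power2_eq_square algebra_simps)
      moreover have "0 \<le> \<pi> j * (1 - \<pi> j)" using \<pi>[of j] by simp
      ultimately show "(of_bool (j \<in> S))\<^sup>2 * (\<pi> j * (1 - \<pi> j)) \<le> 1 / 4" by (cases "j \<in> S") auto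
    qed
    finally show ?thesis by simp
  qed
  define X1 where "X1 T = (\<Sum>i\<in>I. (ssum (B i) (\<lambda>j. real_of_int (w T j)))\<^sup>2)" for T
  define X2 where "X2 T = bexp (\<lambda>_. p) J (\<lambda>S. \<kappa> S * (ssum S (\<lambda>j. real_of_int (w T j) - v j))\<^sup>2)" for T
  define X3 where "X3 T = (\<Sum>j\<in>J. \<bar>real_of_int (w T j)\<bar>)" for T
  let ?c1 = "real (card I) * real (card J)" and ?c2 = "real (card J) * bexp (\<lambda>_. p) J \<kappa>" and ?c3 = "4 * (\<Sum>j\<in>J. \<bar>v j\<bar>)"
  have c: "?c1 > 0" "?c2 > 0" "?c3 > 0" using nJ nI \<kappa> v0 by auto
  have nn: "X1 T \<ge> 0" "X2 T \<ge> 0" "X3 T \<ge> 0" for T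
    unfolding X1_def X2_def X3_def using p \<kappa>
    by (auto intro!: sum_nonneg bexp_nonneg mult_nonneg_nonneg)
  have e1: "bexp \<pi> J X1 \<le> ?c1 / 4"
  proof -
    have "ssum (B i) (\<lambda>j. real_of_int (w T j)) = ssum (B i) (\<lambda>j. real_of_int (w T j) - v j)" if "i \<in> I" for i T
      using B(2)[OF that] by (simp add: ssum_diff)
    then have "bexp \<pi> J X1 = (\<Sum>i\<in>I. bexp \<pi> J (\<lambda>T. (ssum (B i) (\<lambda>j. real_of_int (w T j) - v j))\<^sup>2))"
      unfolding X1_def bexp_sum by (intro sum.cong) simp_all
    also have "\<dots> \<le> (\<Sum>i\<in>I. real (card J) / 4)" using var B by (intro sum_mono) auto
    finally show ?thesis by simp
  qed
  have e2: "bexp \<pi> J X2 \<le> ?c2 / 4"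
  proof -
    have "bexp \<pi> J X2 = bexp (\<lambda>_. p) J (\<lambda>S. \<kappa> S * bexp \<pi> J (\<lambda>T. (ssum S (\<lambda>j. real_of_int (w T j) - v j))\<^sup>2))"
      unfolding X2_def by (subst bexp_swap) (simp only: bexp_cmult)
    also have "\<dots> \<le> bexp (\<lambda>_. p) J (\<lambda>S. \<kappa> S * (real (card J) / 4))"
      using p \<kappa> var by (intro bexp_mono mult_left_mono) auto
    also have "\<dots> = bexp (\<lambda>_. p) J \<kappa> * (real (card J) / 4)" by (rule bexp_mult_right)
    finally show ?thesis by (simp add: mult.commute)
  qed
  have e3: "bexp \<pi> J X3 \<le> ?c3 / 4"
  proof -
    have "bexp \<pi> J X3 = (\<Sum>j\<in>J. bexp \<pi> J (\<lambda>T. \<bar>real_of_int (w T j)\<bar>))" unfolding X3_def bexp_sum ..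
    \<comment> \<open>The two integers between which v j is rounded never have opposite signs, so
      absolute value and expectation commute.\<close>
    also have "\<dots> = (\<Sum>j\<in>J. \<bar>v j\<bar>)"
    proof (rule sum.cong[OF refl])
      fix j assume j: "j \<in> J"
      have "bexp \<pi> J (\<lambda>T. \<bar>real_of_int (w T j)\<bar>) = \<pi> j * \<bar>real_of_int (\<lfloor>v j\<rfloor> + 1)\<bar> + (1 - \<pi> j) * \<bar>real_of_int \<lfloor>v j\<rfloor>\<bar>"
        using bexp_single[OF J j, of \<pi> "\<lambda>b. \<bar>real_of_int (\<lfloor>v j\<rfloor> + of_bool b)\<bar>"] by (simp add: w_def)
      also have "\<dots> = \<bar>real_of_int \<lfloor>v j\<rfloor> + \<pi> j\<bar>"
      proof (cases "\<lfloor>v j\<rfloor> \<ge> 0")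
        case True
        then show ?thesis using \<pi>[of j] by (simp add: algebra_simps)
      next
        case False
        then have "real_of_int \<lfloor>v j\<rfloor> \<le> - 1" by linarith
        then show ?thesis using \<pi>[of j] by (simp add: algebra_simps)
      qed
      also have "\<dots> = \<bar>v j\<bar>" by (simp add: \<pi>_def frac_def)
      finally show "bexp \<pi> J (\<lambda>T. \<bar>real_of_int (w T j)\<bar>) = \<bar>v j\<bar>" .
    qed
    finally show ?thesis by simp
  qed
  \<comment> \<open>Each of the three nonnegative quantities has mean at most a quarter of its
    allowance; the quarter is the Bernoulli variance for the first two and comes from the factor 4
    for the third. The normalised sum thus has mean at most 1, and an outcome where it is at most 1
    meets all three bounds.\<close>
  have "bexp \<pi> J (\<lambda>T. X1 T * (1 / ?c1) + (X2 T * (1 / ?c2) + X3 T * (1 / ?c3))) \<le> 1"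
  proof -
    have "bexp \<pi> J X1 * (1 / ?c1) \<le> 1 / 4" "bexp \<pi> J X2 * (1 / ?c2) \<le> 1 / 4" "bexp \<pi> J X3 * (1 / ?c3) \<le> 1 / 4"
      using e1 e2 e3 c by (simp_all add: field_simps)
    then show ?thesis unfolding bexp_add bexp_mult_right by linarith
  qed
  then obtain T where T: "X1 T * (1 / ?c1) + (X2 T * (1 / ?c2) + X3 T * (1 / ?c3)) \<le> 1"
    using bexp_exists_le[OF J, of \<pi>] \<pi> by blast
  have "X1 T * (1 / ?c1) \<ge> 0" "X2 T * (1 / ?c2) \<ge> 0" "X3 T * (1 / ?c3) \<ge> 0"
    using nn c by (intro mult_nonneg_nonneg; simp)+
  then have "X1 T * (1 / ?c1) \<le> 1" "X2 T * (1 / ?c2) \<le> 1" "X3 T * (1 / ?c3) \<le> 1" using T by linarith+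
  then have "X1 T \<le> ?c1" "X2 T \<le> ?c2" "X3 T \<le> ?c3" using c by (simp_all add: field_simps)
  moreover have "\<bar>real_of_int (w T j) - v j\<bar> \<le> 1" for j unfolding wv using \<pi>[of j] by (cases "j \<in> T") auto
  ultimately show ?thesis by (intro exI[of _ "w T"]) (simp add: X1_def X2_def X3_def)
qed

text \<open>Both directions are instances of 1 + c^2 \<le> 2 (1 + x^2) (1 + (c + x)^2): once with c
  = a, once with c = a + x and - x in place of x.\<close>

lemma peetre:
  fixes a x :: real
  shows "1 / (1 + (a + x)\<^sup>2) \<le> 2 * (1 + x\<^sup>2) * (1 / (1 + a\<^sup>2))"
    and "1 / (1 + (a + x)\<^sup>2) \<ge> (1 / 2) * ((1 / (1 + a\<^sup>2)) * (1 / (1 + x\<^sup>2)))"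
proof -
  have pos: "1 + y\<^sup>2 > 0" for y :: real by (rule add_pos_nonneg) auto
  have key: "1 + c\<^sup>2 \<le> 2 * (1 + x\<^sup>2) * (1 + (c + x)\<^sup>2)" for c x :: real
  proof -
    have "c\<^sup>2 \<le> 2 * (c + x)\<^sup>2 + 2 * x\<^sup>2"
      using zero_le_power2[of "c + 2 * x"] by (simp add: power2_eq_square algebra_simps)
    moreover have "0 \<le> x\<^sup>2 * (c + x)\<^sup>2" by simp
    moreover have "2 * (1 + x\<^sup>2) * (1 + (c + x)\<^sup>2) = 2 + 2 * x\<^sup>2 + 2 * (c + x)\<^sup>2 + 2 * (x\<^sup>2 * (c + x)\<^sup>2)"
      by (simp only: distrib_left distrib_right mult_1_left mult_1_right add_ac mult_ac)
    ultimately show ?thesis by linarith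
  qed
  show "1 / (1 + (a + x)\<^sup>2) \<le> 2 * (1 + x\<^sup>2) * (1 / (1 + a\<^sup>2))"
    using key[of a x] pos[of a] pos[of "a + x"] by (simp add: field_simps)
  have "1 + (a + x)\<^sup>2 \<le> 2 * (1 + x\<^sup>2) * (1 + a\<^sup>2)" using key[of "a + x" "- x"] by simp
  then have "1 + (a + x)\<^sup>2 \<le> 2 * ((1 + a\<^sup>2) * (1 + x\<^sup>2))" by (simp only: mult_ac)
  then have "1 / (2 * ((1 + a\<^sup>2) * (1 + x\<^sup>2))) \<le> 1 / (1 + (a + x)\<^sup>2)"
    using pos[of "a + x"] by (intro divide_left_mono mult_pos_pos pos) auto
  then show "1 / (1 + (a + x)\<^sup>2) \<ge> (1 / 2) * ((1 / (1 + a\<^sup>2)) * (1 / (1 + x\<^sup>2)))"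
    by (simp only: times_divide_times_eq mult_1_right)
qed

text \<open>The hypothesis \<open>G\<close> bounds the squared error in units of sqrt n, averaged
  against the weight at v, by \<open>psi p n v\<close> itself. The upper Peetre bound is linear in
  the squared error, and 2 + 2 gives the factor 4. In the lower bound 1 / (1 + x^2) is first
  replaced by a minorant linear in x^2, and 3/8 - 1/8 gives 1/4.\<close>

lemma psi_perturb:
  assumes p: "0 \<le> p" "p \<le> 1" and n: "n > 0"
    and G: "bexp (\<lambda>_. p) {..<n} (\<lambda>S. 1 / (1 + (ssum S v)\<^sup>2 / real n) * (ssum S (\<lambda>j. w j - v j))\<^sup>2) \<le> real n * psi p n v"
  shows "psi p n w \<le> 4 * psi p n v" and "psi p n w \<ge> psi p n v / 4"
proof -
  let ?k = "\<lambda>S. 1 / (1 + (ssum S v)\<^sup>2 / real n)"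
  define x where "x S = ssum S (\<lambda>j. w j - v j) / sqrt (real n)" for S
  define a where "a S = ssum S v / sqrt (real n)" for S
  have sq: "(y / sqrt (real n))\<^sup>2 = y\<^sup>2 / real n" for y by (simp add: power_divide)
  have ax: "a S + x S = ssum S w / sqrt (real n)" for S
    by (simp add: a_def x_def ssum_diff add_divide_distrib[symmetric])
  have psi_v: "psi p n v = bexp (\<lambda>_. p) {..<n} (\<lambda>S. 1 / (1 + (a S)\<^sup>2))" by (simp add: psi_def a_def sq)
  have psi_w: "psi p n w = bexp (\<lambda>_. p) {..<n} (\<lambda>S. 1 / (1 + (a S + x S)\<^sup>2))" by (simp add: psi_def ax sq)
  have "bexp (\<lambda>_. p) {..<n} (\<lambda>S. (x S)\<^sup>2 * (1 / (1 + (a S)\<^sup>2)))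
     = bexp (\<lambda>_. p) {..<n} (\<lambda>S. (1 / real n) * (?k S * (ssum S (\<lambda>j. w j - v j))\<^sup>2))"
    by (intro bexp_cong) (simp add: x_def a_def sq)
  also have "\<dots> \<le> psi p n v" unfolding bexp_cmult using G n by (simp add: field_simps)
  finally have X: "bexp (\<lambda>_. p) {..<n} (\<lambda>S. (x S)\<^sup>2 * (1 / (1 + (a S)\<^sup>2))) \<le> psi p n v" .
  have "psi p n w \<le> bexp (\<lambda>_. p) {..<n} (\<lambda>S. 2 * (1 / (1 + (a S)\<^sup>2)) + 2 * ((x S)\<^sup>2 * (1 / (1 + (a S)\<^sup>2))))"
    unfolding psi_w using p
  proof (intro bexp_mono)
    fix S
    show "1 / (1 + (a S + x S)\<^sup>2) \<le> 2 * (1 / (1 + (a S)\<^sup>2)) + 2 * ((x S)\<^sup>2 * (1 / (1 + (a S)\<^sup>2)))"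
      using peetre(1)[of "a S" "x S"] by (simp only: distrib_left distrib_right mult_1_right mult.assoc)
  qed auto
  then show "psi p n w \<le> 4 * psi p n v" unfolding bexp_add bexp_cmult psi_v[symmetric] using X by linarith
  have "bexp (\<lambda>_. p) {..<n} (\<lambda>S. (3 / 8) * (1 / (1 + (a S)\<^sup>2)) - (1 / 8) * ((x S)\<^sup>2 * (1 / (1 + (a S)\<^sup>2)))) \<le> psi p n w"
    unfolding psi_w using p
  proof (intro bexp_mono)
    fix S
    let ?y = "1 + (x S)\<^sup>2"
    have y: "?y > 0" by (rule add_pos_nonneg) auto
    \<comment> \<open>The left-hand side is the tangent to 1 / y at y = 2.\<close>
    have "1 - ?y / 4 \<le> 1 / ?y"
    proof -
      have "(1 - ?y / 4) * ?y \<le> 1"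
        using zero_le_power2[of "?y / 2 - 1"] by (simp add: power2_eq_square algebra_simps)
      then show ?thesis using y by (simp add: le_divide_eq)
    qed
    then have "(1 / 2) * ((1 / (1 + (a S)\<^sup>2)) * (1 - ?y / 4)) \<le> (1 / 2) * ((1 / (1 + (a S)\<^sup>2)) * (1 / ?y))"
      by (intro mult_left_mono) auto
    also have "\<dots> \<le> 1 / (1 + (a S + x S)\<^sup>2)" by (rule peetre(2))
    finally show "(3 / 8) * (1 / (1 + (a S)\<^sup>2)) - (1 / 8) * ((x S)\<^sup>2 * (1 / (1 + (a S)\<^sup>2))) \<le> 1 / (1 + (a S + x S)\<^sup>2)"
      by (simp add: algebra_simps diff_divide_distrib add_divide_distrib)
  qed auto
  then show "psi p n w \<ge> psi p n v / 4" unfolding bexp_diff bexp_cmult psi_v[symmetric] using X by linarith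
qed

text \<open>If nonnegative numbers x i sum to at most card I, the product of the 1 + x i is at most
  exp (card I). So the indicator is dominated by the product of the e / (1 + x i), whose expectation
  factors over the independent rows.\<close>

lemma mexp_small_rows_le:
  fixes w :: "nat \<Rightarrow> real" and I :: "'i set"
  assumes I: "finite I" and p: "0 \<le> p" "p \<le> 1" and n: "n > 0"
  shows "mexp (\<lambda>_. p) I {..<n} (\<lambda>B. of_bool ((\<Sum>i\<in>I. (ssum (B i) w)\<^sup>2) \<le> real (card I) * real n))
     \<le> (exp 1 * psi p n w) ^ card I"
proof -
  have "mexp (\<lambda>_. p) I {..<n} (\<lambda>B. of_bool ((\<Sum>i\<in>I. (ssum (B i) w)\<^sup>2) \<le> real (card I) * real n))
     \<le> mexp (\<lambda>_. p) I {..<n} (\<lambda>B. \<Prod>i\<in>I. exp 1 * (1 / (1 + (ssum (B i) w)\<^sup>2 / real n)))"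
  proof (rule mexp_mono)
    fix B :: "'i \<Rightarrow> nat set"
    define x where "x i = (ssum (B i) w)\<^sup>2 / real n" for i
    have x: "x i \<ge> 0" for i by (simp add: x_def)
    show "of_bool ((\<Sum>i\<in>I. (ssum (B i) w)\<^sup>2) \<le> real (card I) * real n)
      \<le> (\<Prod>i\<in>I. exp 1 * (1 / (1 + (ssum (B i) w)\<^sup>2 / real n)))"
    proof (cases "(\<Sum>i\<in>I. (ssum (B i) w)\<^sup>2) \<le> real (card I) * real n")
      case True
      then have "(\<Sum>i\<in>I. x i) \<le> real (card I)" using n by (simp add: x_def field_simps flip: sum_divide_distrib)
      have "(\<Prod>i\<in>I. 1 + x i) \<le> (\<Prod>i\<in>I. exp (x i))" using x by (intro prod_mono) (auto simp: add_increasing)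
      also have "\<dots> = exp (\<Sum>i\<in>I. x i)" by (rule exp_sum[OF I, symmetric])
      also have "\<dots> \<le> exp (real (card I))" using \<open>(\<Sum>i\<in>I. x i) \<le> real (card I)\<close> by simp
      also have "\<dots> = exp 1 ^ card I" by (simp add: exp_of_nat_mult[symmetric])
      finally have le: "(\<Prod>i\<in>I. 1 + x i) \<le> exp 1 ^ card I" .
      have pos: "(\<Prod>i\<in>I. 1 + x i) > 0" using x by (intro prod_pos) (auto intro: add_pos_nonneg)
      have "(\<Prod>i\<in>I. exp 1 * (1 / (1 + x i))) = exp 1 ^ card I / (\<Prod>i\<in>I. 1 + x i)"
        by (simp add: prod.distrib prod_dividef)
      also have "\<dots> \<ge> 1" using le pos by simp
      finally show ?thesis using True by (simp add: x_def)
    next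
      case False
      have "0 \<le> (\<Prod>i\<in>I. exp 1 * (1 / (1 + x i)))" using x by (intro prod_nonneg) (auto intro: add_nonneg_nonneg)
      then show ?thesis using False by (simp add: x_def)
    qed
  qed (use p in auto)
  also have "\<dots> = (exp 1 * psi p n w) ^ card I"
    by (subst mexp_prod) (simp_all only: I finite_lessThan bexp_cmult psi_def prod_constant)
  finally show ?thesis .
qed

text \<open>Give w the weight x to the power of its l1 norm. Points of the ball have weight at least
  \<open>x ^ K\<close>, and the total weight factors into sums over integers, each at most 1 + 4 x.
  The free parameter yields C ^ n points for a radius of order n, and (1 + \<epsilon>) ^ n points if
  the radius is a small enough multiple of n.\<close>

lemma card_l1_ball_le:
  fixes x :: real
  assumes J: "finite J" and x: "0 < x" "x \<le> 1 / 2"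
  shows "finite {w\<in>extensional J. (\<Sum>j\<in>J. \<bar>w j\<bar>) \<le> int K}"
    and "real (card {w\<in>extensional J. (\<Sum>j\<in>J. \<bar>w j\<bar>) \<le> int K}) \<le> (1 / x) ^ K * (1 + 4 * x) ^ card J"
proof -
  let ?X = "{w\<in>extensional J. (\<Sum>j\<in>J. \<bar>w j\<bar>) \<le> int K}"
  let ?P = "PiE J (\<lambda>_. {- int K..int K})"
  have sub: "?X \<subseteq> ?P"
  proof
    fix w assume w: "w \<in> ?X"
    have "- int K \<le> w j \<and> w j \<le> int K" if "j \<in> J" for j
    proof -
      have "\<bar>w j\<bar> \<le> (\<Sum>j\<in>J. \<bar>w j\<bar>)" using J that by (intro member_le_sum) auto
      then show ?thesis using w by (simp add: abs_le_iff)
    qed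
    then show "w \<in> ?P" using w by (simp add: PiE_iff)
  qed
  have finP: "finite ?P" using J by (intro finite_PiE) auto
  then show "finite ?X" using sub finite_subset by blast
  have geo: "(\<Sum>z\<in>{- int K..int K}. x ^ nat \<bar>z\<bar>) \<le> 1 + 4 * x"
  proof -
    have half: "(\<Sum>b\<in>{1..K}. x ^ b) \<le> 2 * x"
    proof -
      have "(\<Sum>b\<in>{1..K}. x ^ b) \<le> x / (1 - x)"
      proof -
        have "(1 - x) * (\<Sum>b\<in>{1..m}. x ^ b) = x - x ^ Suc m" for m
        proof (induction m)
          case (Suc m)
          have "(\<Sum>b\<in>{1..Suc m}. x ^ b) = (\<Sum>b\<in>{1..m}. x ^ b) + x ^ Suc m" by simp
          then show ?case unfolding distrib_left by (simp only: Suc distrib_left) (simp add: algebra_simps)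
        qed simp
        then have "(1 - x) * (\<Sum>b\<in>{1..K}. x ^ b) \<le> x" using x by simp
        then show ?thesis using x by (simp add: field_simps)
      qed
      also have "\<dots> \<le> 2 * x" using x mult_left_mono[of "2 * x" 1 x] by (simp add: field_simps)
      finally show ?thesis .
    qed
    have "(\<Sum>z\<in>{- int K..int K}. x ^ nat \<bar>z\<bar>) = (\<Sum>z\<in>{- int K..-1}. x ^ nat \<bar>z\<bar>) + (1 + (\<Sum>z\<in>{1..int K}. x ^ nat \<bar>z\<bar>))"
    proof -
      have e: "{- int K..int K} = {- int K..-1} \<union> insert 0 {1..int K}" by auto
      show ?thesis unfolding e by (subst sum.union_disjoint) auto
    qed
    also have "(\<Sum>z\<in>{- int K..-1}. x ^ nat \<bar>z\<bar>) = (\<Sum>b\<in>{1..K}. x ^ b)"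
      by (rule sum.reindex_bij_witness[of _ "\<lambda>b. - int b" "\<lambda>z. nat (- z)"]) auto
    also have "(\<Sum>z\<in>{1..int K}. x ^ nat \<bar>z\<bar>) = (\<Sum>b\<in>{1..K}. x ^ b)"
      by (rule sum.reindex_bij_witness[of _ int nat]) auto
    finally show ?thesis using half by linarith
  qed
  have "x ^ K * real (card ?X) = (\<Sum>w\<in>?X. x ^ K)" by simp
  also have "\<dots> \<le> (\<Sum>w\<in>?X. \<Prod>j\<in>J. x ^ nat \<bar>w j\<bar>)"
  proof (rule sum_mono)
    fix w assume w: "w \<in> ?X"
    have "int (\<Sum>j\<in>J. nat \<bar>w j\<bar>) = (\<Sum>j\<in>J. \<bar>w j\<bar>)" by simp
    then have "int (\<Sum>j\<in>J. nat \<bar>w j\<bar>) \<le> int K" using w by simp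
    then have "(\<Sum>j\<in>J. nat \<bar>w j\<bar>) \<le> K" by (simp only: of_nat_le_iff)
    then have "x ^ K \<le> x ^ (\<Sum>j\<in>J. nat \<bar>w j\<bar>)" using x by (intro power_decreasing) auto
    then show "x ^ K \<le> (\<Prod>j\<in>J. x ^ nat \<bar>w j\<bar>)" by (simp add: power_sum)
  qed
  also have "\<dots> \<le> (\<Sum>w\<in>?P. \<Prod>j\<in>J. x ^ nat \<bar>w j\<bar>)" using sub finP x by (intro sum_mono2 prod_nonneg) auto
  also have "\<dots> = (\<Prod>j\<in>J. \<Sum>z\<in>{- int K..int K}. x ^ nat \<bar>z\<bar>)" by (rule prod_sum_PiE[symmetric]) (use J in auto)
  also have "\<dots> \<le> (\<Prod>j\<in>J. 1 + 4 * x)" using geo x by (intro prod_mono) (auto intro: sum_nonneg)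
  finally have "x ^ K * real (card ?X) \<le> (1 + 4 * x) ^ card J" by simp
  then show "real (card ?X) \<le> (1 / x) ^ K * (1 + 4 * x) ^ card J"
    using x by (simp add: power_divide field_simps)
qed

section \<open>Spread kernel vectors\<close>

text \<open>With this normalisation the l1 norm is at most n by Cauchy-Schwarz, so \<kappa> is the
  fraction of the maximum that is reached.\<close>

definition spread_vec :: "nat \<Rightarrow> real \<Rightarrow> (nat \<Rightarrow> real) \<Rightarrow> bool" where
  "spread_vec n \<kappa> v \<longleftrightarrow> (\<Sum>j<n. (v j)\<^sup>2) = real n \<and> (\<Sum>j<n. \<bar>v j\<bar>) \<ge> \<kappa> * real n"

lemma spread_vec_l1:
  assumes "spread_vec n \<kappa> v"
  shows "(\<Sum>j<n. \<bar>v j\<bar>) \<le> real n"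
proof (rule power2_le_imp_le)
  have "(\<Sum>j<n. \<bar>v j\<bar>)\<^sup>2 \<le> (\<Sum>j<n. \<bar>v j\<bar>\<^sup>2) * real (card {..<n})" by (rule sum_squared_le_sum_of_squares)
  also have "\<dots> = (real n)\<^sup>2" using assms by (simp add: spread_vec_def power2_eq_square)
  finally show "(\<Sum>j<n. \<bar>v j\<bar>)\<^sup>2 \<le> (real n)\<^sup>2" .
qed simp

text \<open>Coordinates below \<kappa> / 2 carry at most half of the guaranteed l1 mass;
  Cauchy-Schwarz on the others, whose square sum is at most n, bounds their number from
  below.\<close>

lemma spread_vec_large_coords:
  assumes v: "spread_vec n \<kappa> v" and \<kappa>: "\<kappa> > 0" and n: "n > 0"
  shows "real (card {j. j < n \<and> \<bar>v j\<bar> \<ge> \<kappa> / 2}) \<ge> \<kappa>\<^sup>2 / 4 * real n"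
proof -
  let ?L = "{j. j < n \<and> \<bar>v j\<bar> \<ge> \<kappa> / 2}" and ?S = "{j. j < n \<and> \<bar>v j\<bar> < \<kappa> / 2}"
  have "(\<Sum>j<n. \<bar>v j\<bar>) = (\<Sum>j\<in>?L \<union> ?S. \<bar>v j\<bar>)" by (rule sum.cong) auto
  also have "\<dots> = (\<Sum>j\<in>?L. \<bar>v j\<bar>) + (\<Sum>j\<in>?S. \<bar>v j\<bar>)"
    by (rule sum.union_disjoint) auto
  also have "(\<Sum>j\<in>?S. \<bar>v j\<bar>) \<le> (\<Sum>j\<in>?S. \<kappa> / 2)" by (intro sum_mono) auto
  also have "\<dots> \<le> real n * (\<kappa> / 2)"
  proof -
    have "card ?S \<le> card {..<n}" by (intro card_mono) auto
    then show ?thesis using \<kappa> by (simp add: mult_right_mono)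
  qed
  finally have "\<kappa> * real n \<le> (\<Sum>j\<in>?L. \<bar>v j\<bar>) + real n * (\<kappa> / 2)"
    using v by (simp add: spread_vec_def)
  then have "\<kappa> / 2 * real n \<le> (\<Sum>j\<in>?L. \<bar>v j\<bar>)" by (simp add: algebra_simps)
  then have "(\<kappa> / 2 * real n)\<^sup>2 \<le> (\<Sum>j\<in>?L. \<bar>v j\<bar>)\<^sup>2" using \<kappa> by (intro power_mono) auto
  also have "\<dots> \<le> (\<Sum>j\<in>?L. \<bar>v j\<bar>\<^sup>2) * real (card ?L)" by (rule sum_squared_le_sum_of_squares)
  also have "\<dots> \<le> real n * real (card ?L)"
  proof (rule mult_right_mono)
    have "(\<Sum>j\<in>?L. \<bar>v j\<bar>\<^sup>2) \<le> (\<Sum>j<n. \<bar>v j\<bar>\<^sup>2)" by (intro sum_mono2) auto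
    then show "(\<Sum>j\<in>?L. \<bar>v j\<bar>\<^sup>2) \<le> real n" using v by (simp add: spread_vec_def)
  qed simp
  finally show ?thesis using n by (simp add: power2_eq_square)
qed

lemma psi_scale_mono:
  assumes p: "0 \<le> p" "p \<le> 1" and s: "0 \<le> s" "s \<le> t"
  shows "psi p n (\<lambda>j. t * v j) \<le> psi p n (\<lambda>j. s * v j)"
  unfolding psi_def ssum_cmult
proof (rule bexp_mono)
  fix S
  have "(s * ssum S v)\<^sup>2 \<le> (t * ssum S v)\<^sup>2"
    using s by (simp add: power_mult_distrib mult_right_mono power_mono)
  then have "1 + (s * ssum S v)\<^sup>2 / real n \<le> 1 + (t * ssum S v)\<^sup>2 / real n" by (simp add: divide_right_mono)
  then show "1 / (1 + (t * ssum S v)\<^sup>2 / real n) \<le> 1 / (1 + (s * ssum S v)\<^sup>2 / real n)"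
    by (intro divide_left_mono mult_pos_pos) (auto intro: add_pos_nonneg)
qed (use p in auto)

lemma psi_le_1: "0 \<le> p \<Longrightarrow> p \<le> 1 \<Longrightarrow> psi p n v \<le> 1"
  unfolding psi_def by (intro bexp_le_const) (auto simp: divide_le_eq_1 add_pos_nonneg)

lemma zero_prob_le_psi:
  assumes "0 \<le> p" "p \<le> 1"
  shows "bexp (\<lambda>_. p) {..<n} (\<lambda>S. of_bool (ssum S v = 0)) \<le> psi p n (\<lambda>j. t * v j)"
  unfolding psi_def ssum_cmult using assms by (intro bexp_mono) auto

text \<open>Let N run through the halvings of \<open>Nmax\<close>. The inequality psi \<ge> L / N
  holds at the start by \<open>big\<close> and fails after n halvings, where N \<le> 1 and psi \<le>
  1 < L. At the last scale before the first failure, monotonicity in N gives the matching upper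
  bound 2 L / N. Dyadic scales leave only n cases for the union bound.\<close>

lemma ex_critical_scale:
  assumes p: "0 \<le> p" "p \<le> 1" and N: "Nmax > 0" "Nmax \<le> 2 ^ n" and L: "L > 1"
    and big: "bexp (\<lambda>_. p) {..<n} (\<lambda>S. of_bool (ssum S v = 0)) > L / Nmax"
  shows "\<exists>i<n. L / (Nmax / 2 ^ i) \<le> psi p n (\<lambda>j. Nmax / 2 ^ i * v j) \<and> psi p n (\<lambda>j. Nmax / 2 ^ i * v j) \<le> 2 * L / (Nmax / 2 ^ i)"
proof -
  let ?Q = "\<lambda>i. psi p n (\<lambda>j. Nmax / 2 ^ i * v j) < L / (Nmax / 2 ^ i)"
  have Qn: "?Q n"
  proof -
    have "psi p n (\<lambda>j. Nmax / 2 ^ n * v j) \<le> 1" using p by (rule psi_le_1)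
    also have "1 < L / (Nmax / 2 ^ n)"
    proof -
      have "Nmax / 2 ^ n \<le> 1" using N by simp
      then have "L / 1 \<le> L / (Nmax / 2 ^ n)" using L N by (intro divide_left_mono) auto
      then show ?thesis using L by simp
    qed
    finally show ?thesis .
  qed
  define m where "m = (LEAST i. ?Q i)"
  have Qm: "?Q m" unfolding m_def using Qn by (rule LeastI)
  have mn: "m \<le> n" unfolding m_def using Qn by (rule Least_le)
  have "m \<noteq> 0"
  proof
    assume "m = 0"
    then have "psi p n (\<lambda>j. Nmax * v j) < L / Nmax" using Qm by simp
    then show False using zero_prob_le_psi[OF p, of n v Nmax] big by linarith
  qed
  then obtain i where i: "m = Suc i" by (cases m) auto
  have "\<not> ?Q i" using i not_less_Least[of i ?Q] by (simp add: m_def)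
  moreover have "psi p n (\<lambda>j. Nmax / 2 ^ i * v j) \<le> 2 * L / (Nmax / 2 ^ i)"
  proof -
    have "psi p n (\<lambda>j. Nmax / 2 ^ i * v j) \<le> psi p n (\<lambda>j. Nmax / 2 ^ Suc i * v j)"
      using N p by (intro psi_scale_mono) (auto simp: field_simps)
    also have "\<dots> < L / (Nmax / 2 ^ Suc i)" using Qm i by simp
    finally show ?thesis by (simp add: mult_ac)
  qed
  ultimately show ?thesis using i mn by (intro exI[of _ i]) (simp add: not_less)
qed

lemma mexp_ex_le_sum:
  assumes p: "0 \<le> p" "p \<le> 1" and X: "finite X"
    and sub: "\<And>B. B \<in> PiE I (\<lambda>_. Pow J) \<Longrightarrow> Q B \<Longrightarrow> \<exists>x\<in>X. P x B"
  shows "mexp (\<lambda>_. p) I J (\<lambda>B. of_bool (Q B)) \<le> (\<Sum>x\<in>X. mexp (\<lambda>_. p) I J (\<lambda>B. of_bool (P x B)))"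
  unfolding mexp_sum[symmetric]
proof (rule mexp_mono)
  fix B assume B: "B \<in> PiE I (\<lambda>_. Pow J)"
  show "of_bool (Q B) \<le> (\<Sum>x\<in>X. of_bool (P x B) :: real)"
  proof (cases "Q B")
    case True
    then obtain x where x: "x \<in> X" "P x B" using sub[OF B] by blast
    have "of_bool (P x B) \<le> (\<Sum>x\<in>X. of_bool (P x B) :: real)" using X x by (intro member_le_sum) auto
    then show ?thesis using True x by simp
  qed (simp add: sum_nonneg)
qed (use p in auto)

text \<open>The integer points that occur as roundings of \<open>N v\<close>, for a spread vector \<open>v\<close> at its critical scale \<open>N\<close>.\<close>

definition critical_points :: "real \<Rightarrow> real \<Rightarrow> real \<Rightarrow> nat \<Rightarrow> real \<Rightarrow> (nat \<Rightarrow> int) set" where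
  "critical_points p \<kappa> L n N = {w\<in>extensional {..<n}. (\<Sum>j<n. \<bar>w j\<bar>) \<le> \<lfloor>2 * N * real n\<rfloor>
     \<and> real (card {j. j < n \<and> \<bar>real_of_int (w j)\<bar> \<ge> N * \<kappa> / 2 - 1}) \<ge> \<kappa>\<^sup>2 / 4 * real n
     \<and> L / (4 * N) \<le> psi p n (\<lambda>j. real_of_int (w j)) \<and> psi p n (\<lambda>j. real_of_int (w j)) \<le> 8 * L / N}"

lemma psi_pos:
  assumes "0 \<le> p" "p \<le> 1"
  shows "psi p n v > 0"
proof -
  define m where "m = Min ((\<lambda>S. 1 / (1 + (ssum S v)\<^sup>2 / real n)) ` Pow {..<n})"
  have "m \<in> (\<lambda>S. 1 / (1 + (ssum S v)\<^sup>2 / real n)) ` Pow {..<n}" unfolding m_def by (intro Min_in) auto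
  then obtain S where "m = 1 / (1 + (ssum S v)\<^sup>2 / real n)" by auto
  moreover have "1 + (ssum S v)\<^sup>2 / real n > 0" by (intro add_pos_nonneg) auto
  ultimately have m: "m > 0" by simp
  have "bexp (\<lambda>_. p) {..<n} (\<lambda>_. m) \<le> psi p n v"
    unfolding psi_def
  proof (rule bexp_mono)
    fix S assume "S \<subseteq> {..<n}"
    then show "m \<le> 1 / (1 + (ssum S v)\<^sup>2 / real n)" unfolding m_def by (intro Min_le) auto
  qed (use assms in auto)
  then show ?thesis using m by (simp add: bexp_const)
qed

lemma ssum_restrict: "S \<subseteq> J \<Longrightarrow> ssum S (\<lambda>j. real_of_int (restrict w J j)) = ssum S (\<lambda>j. real_of_int (w j))"
  by (rule ssum_cong) auto

lemma psi_restrict: "psi p n (\<lambda>j. real_of_int (restrict w {..<n} j)) = psi p n (\<lambda>j. real_of_int (w j))"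
  unfolding psi_def by (rule bexp_cong) (simp only: ssum_restrict)

text \<open>Rounding N v leaves residuals of mean square at most n on the rows, moves a coordinate
  by at most 1 and changes psi by a factor at most 4. These are the constants in
  \<open>critical_points\<close>.\<close>

lemma ex_critical_point:
  assumes p: "0 \<le> p" "p \<le> 1" and n: "n > 0" and I: "finite I" "I \<noteq> {}"
    and B: "B \<in> PiE I (\<lambda>_. Pow {..<n})" "\<forall>i\<in>I. ssum (B i) v = 0"
    and v: "spread_vec n \<kappa> v" and \<kappa>: "\<kappa> > 0" and N: "N \<ge> 1"
    and crit: "L / N \<le> psi p n (\<lambda>j. N * v j)" "psi p n (\<lambda>j. N * v j) \<le> 2 * L / N"
  shows "\<exists>w\<in>critical_points p \<kappa> L n N. (\<Sum>i\<in>I. (ssum (B i) (\<lambda>j. real_of_int (w j)))\<^sup>2) \<le> real (card I) * real n"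
proof -
  let ?v = "\<lambda>j. N * v j"
  \<comment> \<open>The rounding error is averaged against the weight that defines
    \<open>psi\<close> at N v, the form in which the stability of \<open>psi\<close> needs
    it.\<close>
  let ?k = "\<lambda>S. 1 / (1 + (ssum S ?v)\<^sup>2 / real n)"
  have v0: "\<exists>j\<in>{..<n}. ?v j \<noteq> 0"
  proof (rule ccontr)
    assume "\<not> ?thesis"
    then have "(\<Sum>j<n. (v j)\<^sup>2) = 0" using N by (intro sum.neutral) auto
    then show False using v n by (simp add: spread_vec_def)
  qed
  have k0: "?k S \<ge> 0" for S by (auto intro!: divide_nonneg_nonneg add_nonneg_nonneg)
  have "bexp (\<lambda>_. p) {..<n} ?k > 0" using psi_pos[OF p, of n ?v] by (simp add: psi_def)
  then obtain w :: "nat \<Rightarrow> int" where w: "\<And>j. \<bar>real_of_int (w j) - ?v j\<bar> \<le> 1"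
    "(\<Sum>i\<in>I. (ssum (B i) (\<lambda>j. real_of_int (w j)))\<^sup>2) \<le> real (card I) * real (card {..<n})"
    "bexp (\<lambda>_. p) {..<n} (\<lambda>S. ?k S * (ssum S (\<lambda>j. real_of_int (w j) - ?v j))\<^sup>2) \<le> real (card {..<n}) * bexp (\<lambda>_. p) {..<n} ?k"
    using ex_rounding[OF finite_lessThan I p, of B n ?v ?k] k0 v0 B by (auto simp: ssum_cmult PiE_iff)
  define w' where "w' = restrict w {..<n}"
  have pert: "psi p n (\<lambda>j. real_of_int (w j)) \<le> 4 * psi p n ?v" "psi p n (\<lambda>j. real_of_int (w j)) \<ge> psi p n ?v / 4"
    using psi_perturb[OF p n, of ?v "\<lambda>j. real_of_int (w j)"] w(3) by (simp_all add: psi_def)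
  have "w' \<in> critical_points p \<kappa> L n N"
    unfolding critical_points_def
  proof (intro CollectI conjI)
    show "w' \<in> extensional {..<n}" by (simp add: w'_def)
    have "(\<Sum>j<n. \<bar>real_of_int (w j)\<bar>) \<le> (\<Sum>j<n. N * \<bar>v j\<bar> + 1)"
    proof (rule sum_mono)
      fix j
      have "\<bar>?v j\<bar> = N * \<bar>v j\<bar>" using N by (simp add: abs_mult)
      then show "\<bar>real_of_int (w j)\<bar> \<le> N * \<bar>v j\<bar> + 1" using w(1)[of j] by linarith
    qed
    also have "\<dots> = N * (\<Sum>j<n. \<bar>v j\<bar>) + real n" by (simp add: sum.distrib sum_distrib_left)
    also have "\<dots> \<le> N * real n + N * real n"
      using spread_vec_l1[OF v] N by (intro add_mono mult_left_mono) (auto simp: mult_le_cancel_right1)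
    finally have "real_of_int (\<Sum>j<n. \<bar>w j\<bar>) \<le> 2 * N * real n" by simp
    then have "(\<Sum>j<n. \<bar>w j\<bar>) \<le> \<lfloor>2 * N * real n\<rfloor>" by (simp only: le_floor_iff)
    then show "(\<Sum>j<n. \<bar>w' j\<bar>) \<le> \<lfloor>2 * N * real n\<rfloor>" by (simp add: w'_def)
    have "\<kappa>\<^sup>2 / 4 * real n \<le> real (card {j. j < n \<and> \<bar>v j\<bar> \<ge> \<kappa> / 2})"
      by (rule spread_vec_large_coords[OF v \<kappa> n])
    also have "card {j. j < n \<and> \<bar>v j\<bar> \<ge> \<kappa> / 2} \<le> card {j. j < n \<and> \<bar>real_of_int (w' j)\<bar> \<ge> N * \<kappa> / 2 - 1}"
    proof (intro card_mono subsetI)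
      fix j assume j: "j \<in> {j. j < n \<and> \<bar>v j\<bar> \<ge> \<kappa> / 2}"
      have "\<bar>?v j\<bar> = N * \<bar>v j\<bar>" using N by (simp add: abs_mult)
      moreover have "N * \<bar>v j\<bar> \<ge> N * (\<kappa> / 2)" using j N by (intro mult_left_mono) auto
      ultimately have "\<bar>real_of_int (w j)\<bar> \<ge> N * (\<kappa> / 2) - 1" using w(1)[of j] by linarith
      then show "j \<in> {j. j < n \<and> \<bar>real_of_int (w' j)\<bar> \<ge> N * \<kappa> / 2 - 1}" using j by (simp add: w'_def)
    qed auto
    finally show "\<kappa>\<^sup>2 / 4 * real n \<le> real (card {j. j < n \<and> \<bar>real_of_int (w' j)\<bar> \<ge> N * \<kappa> / 2 - 1})" by simp
    have a: "L / (4 * N) = L / N / 4" "8 * L / N = 4 * (2 * L / N)" by simp_all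
    show "L / (4 * N) \<le> psi p n (\<lambda>j. real_of_int (w' j))"
      unfolding w'_def psi_restrict a by (rule order_trans[OF divide_right_mono[OF crit(1)] pert(2)]) simp
    show "psi p n (\<lambda>j. real_of_int (w' j)) \<le> 8 * L / N"
      unfolding w'_def psi_restrict a using pert crit by linarith
  qed
  moreover have "ssum (B i) (\<lambda>j. real_of_int (w' j)) = ssum (B i) (\<lambda>j. real_of_int (w j))" if "i \<in> I" for i
    unfolding w'_def by (rule ssum_restrict) (use B(1) that in auto)
  ultimately show ?thesis using w(2) by (intro bexI[of _ w']) simp_all
qed

text \<open>The points are covered by boxes of side H with corners in H times the integer lattice.
  The corner index has l1 norm O(n), so there are only exponentially many boxes, and in each of them
  a positive fraction of the coordinates is comparable to H throughout, as \<open>bad\<close>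
  requires. Since psi is at most 6 times the largest window probability, the lower bound on psi puts
  every critical point among the bad points of its box.\<close>

lemma card_critical_points_le:
  fixes \<delta> \<kappa> L N M\<^sub>0 :: real
  assumes p: "0 \<le> p" "p \<le> 1" and \<kappa>: "0 < \<kappa>" "\<kappa> \<le> 1" and n: "n > 0" and N: "N \<ge> 16 / \<kappa>"
    and r: "sqrt (real n) \<le> real r"
    and L: "L > 384 / \<kappa> * M\<^sub>0" and M0: "M\<^sub>0 > 0"
    and bad: "\<And>H c J2. H > 0 \<Longrightarrow> real H \<le> N \<Longrightarrow> J2 \<subseteq> {..<n} \<Longrightarrow> \<kappa>\<^sup>2 / 8 * real n \<le> real (card J2) \<Longrightarrow>
      \<forall>i\<in>J2. \<forall>x\<in>{c i..<c i + int H}. real H \<le> \<bar>real_of_int x\<bar> \<and> \<bar>real_of_int x\<bar> \<le> (264 / \<kappa> ^ 3 + 1) * real H \<Longrightarrow>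
      real (card {w\<in>cube {..<n} c H. \<exists>z. window_prob p {..<n} r w z > M\<^sub>0 / real H}) \<le> real H ^ n * \<beta>"
  shows "finite (critical_points p \<kappa> L n N)"
    and "real (card (critical_points p \<kappa> L n N)) \<le> 2 ^ nat \<lfloor>33 / \<kappa> * real n\<rfloor> * 3 ^ n * (N ^ n * \<beta>)"
proof -
  \<comment> \<open>Coordinates of size at least N \<kappa> / 2 - 1 \<ge> 3 H get a box index of
    modulus at least 2, so their whole interval stays at distance at least H from 0.\<close>
  define H where "H = nat \<lfloor>N * \<kappa> / 8\<rfloor>"
  have Nk: "N * \<kappa> \<ge> 16" using N \<kappa> by (simp add: field_simps)
  have "16 \<le> 16 / \<kappa>" using \<kappa> by (simp add: le_divide_eq)
  then have N1: "N \<ge> 16" using N by linarith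
  have H: "real H \<le> N * \<kappa> / 8" "N * \<kappa> / 16 \<le> real H" "H > 0"
  proof -
    have "\<lfloor>N * \<kappa> / 8\<rfloor> \<ge> 2" using Nk by (simp add: le_floor_iff)
    then have "real H = real_of_int \<lfloor>N * \<kappa> / 8\<rfloor>" "H > 0" by (simp_all add: H_def)
    then show "real H \<le> N * \<kappa> / 8" "N * \<kappa> / 16 \<le> real H" "H > 0" using Nk by linarith+
  qed
  have HN: "real H \<le> N"
  proof -
    have "N * \<kappa> \<le> N * 1" using \<kappa> N1 by (intro mult_left_mono) auto
    then show ?thesis using H N1 by linarith
  qed
  \<comment> \<open>33 = 32 + 1: the l1 norm 2 N n divided by H \<ge> N \<kappa> / 16, plus one per
    coordinate for rounding down. \<open>A\<close> satisfies C / A = \<kappa>^2 n / 8, so by Markov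
    the coordinates with huge index use up at most half of the guaranteed number of large
    ones.\<close>
  define C where "C = 33 / \<kappa> * real n"
  define A where "A = 264 / \<kappa> ^ 3"
  let ?Bs = "{b\<in>extensional {..<n}. (\<Sum>j<n. \<bar>b j\<bar>) \<le> int (nat \<lfloor>C\<rfloor>)}"
  let ?G = "\<lambda>b :: nat \<Rightarrow> int. {j. j < n \<and> 2 \<le> \<bar>b j\<bar> \<and> real_of_int \<bar>b j\<bar> \<le> A}"
  let ?Bs' = "{b\<in>?Bs. real (card (?G b)) \<ge> \<kappa>\<^sup>2 / 8 * real n}"
  let ?Q = "\<lambda>b. {w\<in>cube {..<n} (\<lambda>j. b j * int H) H. \<exists>z. window_prob p {..<n} r w z > M\<^sub>0 / real H}"
  have finB: "finite ?Bs" and cardB: "real (card ?Bs) \<le> 2 ^ nat \<lfloor>C\<rfloor> * 3 ^ n"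
    using card_l1_ball_le[of "{..<n}" "1 / 2" "nat \<lfloor>C\<rfloor>"] by simp_all
  have C0: "C \<ge> 0" using \<kappa> by (simp add: C_def)
  have sub: "critical_points p \<kappa> L n N \<subseteq> (\<Union>b\<in>?Bs'. ?Q b)"
  proof
    fix w assume "w \<in> critical_points p \<kappa> L n N"
    then have w: "w \<in> extensional {..<n}" "(\<Sum>j<n. \<bar>w j\<bar>) \<le> \<lfloor>2 * N * real n\<rfloor>"
      "real (card {j. j < n \<and> \<bar>real_of_int (w j)\<bar> \<ge> N * \<kappa> / 2 - 1}) \<ge> \<kappa>\<^sup>2 / 4 * real n"
      "L / (4 * N) \<le> psi p n (\<lambda>j. real_of_int (w j))"
      by (auto simp: critical_points_def)
    define b where "b = (\<lambda>j\<in>{..<n}. w j div int H)"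
    have dm: "w j = w j div int H * int H + w j mod int H" "0 \<le> w j mod int H" "w j mod int H < int H" for j
      using H(3) by simp_all
    have babs: "real_of_int \<bar>w j div int H\<bar> \<le> real_of_int \<bar>w j\<bar> / real H + 1" for j
    proof -
      have "\<bar>w j div int H\<bar> * int H \<le> \<bar>w j\<bar> + int H"
      proof -
        have "\<bar>w j div int H\<bar> * int H = \<bar>w j div int H * int H\<bar>" by (simp add: abs_mult)
        also have "w j div int H * int H = w j - w j mod int H" using dm(1)[of j] by linarith
        also have "\<bar>w j - w j mod int H\<bar> \<le> \<bar>w j\<bar> + int H" using dm(2,3)[of j] by linarith
        finally show ?thesis .
      qed
      then have "real_of_int (\<bar>w j div int H\<bar> * int H) \<le> real_of_int (\<bar>w j\<bar> + int H)" by (simp only: of_int_le_iff)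
      then show ?thesis using H(3) by (simp add: field_simps)
    qed
    have "real_of_int (\<Sum>j<n. \<bar>b j\<bar>) = (\<Sum>j<n. real_of_int \<bar>w j div int H\<bar>)" by (simp add: b_def)
    also have "\<dots> \<le> (\<Sum>j<n. real_of_int \<bar>w j\<bar> / real H + 1)" by (intro sum_mono babs)
    also have "\<dots> = real_of_int (\<Sum>j<n. \<bar>w j\<bar>) / real H + real n" by (simp add: sum.distrib sum_divide_distrib)
    also have "\<dots> \<le> 2 * N * real n / real H + real n"
      using w(2) by (intro add_right_mono divide_right_mono) (simp_all only: le_floor_iff of_nat_0_le_iff)
    also have "\<dots> \<le> 32 / \<kappa> * real n + real n"
    proof -
      have "N / real H \<le> 16 / \<kappa>" using H \<kappa> by (simp add: field_simps)
      then have "2 * real n * (N / real H) \<le> 2 * real n * (16 / \<kappa>)" by (intro mult_left_mono) auto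
      then show ?thesis by (simp add: mult_ac)
    qed
    also have "\<dots> \<le> C"
    proof -
      have "1 \<le> 1 / \<kappa>" using \<kappa> by simp
      then have "1 * real n \<le> 1 / \<kappa> * real n" by (intro mult_right_mono) auto
      then show ?thesis by (simp add: C_def)
    qed
    finally have sumb: "real_of_int (\<Sum>j<n. \<bar>b j\<bar>) \<le> C" .
    then have "(\<Sum>j<n. \<bar>b j\<bar>) \<le> \<lfloor>C\<rfloor>" by (simp only: le_floor_iff)
    then have bB: "b \<in> ?Bs" using C0 by (simp add: b_def)
    have bG: "real (card (?G b)) \<ge> \<kappa>\<^sup>2 / 8 * real n"
    proof -
      let ?big = "{j. j < n \<and> \<bar>real_of_int (w j)\<bar> \<ge> N * \<kappa> / 2 - 1}"
      let ?huge = "{j. j < n \<and> real_of_int \<bar>b j\<bar> > A}"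
      have "?big \<subseteq> ?G b \<union> ?huge"
      proof
        fix j assume j: "j \<in> ?big"
        have "real_of_int \<bar>w j\<bar> \<ge> real_of_int (3 * int H)" using j H Nk by simp
        then have w3: "\<bar>w j\<bar> \<ge> 3 * int H" by (simp only: of_int_le_iff)
        have "2 \<le> \<bar>w j div int H\<bar>"
        proof (rule ccontr)
          assume "\<not> ?thesis"
          then have "- 1 \<le> w j div int H" "w j div int H \<le> 1" by auto
          then have "- 1 * int H \<le> w j div int H * int H" "w j div int H * int H \<le> 1 * int H"
            by (intro mult_right_mono; simp)+
          then show False using dm[of j] w3 H(3) by linarith
        qed
        then show "j \<in> ?G b \<union> ?huge" using j by (auto simp: b_def)
      qed
      have "card ?big \<le> card (?G b) + card ?huge"
      proof -
        have "card ?big \<le> card (?G b \<union> ?huge)" by (rule card_mono[OF _ \<open>?big \<subseteq> ?G b \<union> ?huge\<close>]) simp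
        also have "\<dots> \<le> card (?G b) + card ?huge" by (rule card_Un_le)
        finally show ?thesis .
      qed
      moreover have "real (card ?huge) \<le> \<kappa>\<^sup>2 / 8 * real n"
      proof -
        have A0: "A > 0" using \<kappa> by (simp add: A_def)
        have "real (card ?huge) * A = (\<Sum>j\<in>?huge. A)" by simp
        also have "\<dots> \<le> (\<Sum>j\<in>?huge. real_of_int \<bar>b j\<bar>)" by (intro sum_mono) auto
        also have "\<dots> \<le> (\<Sum>j<n. real_of_int \<bar>b j\<bar>)" by (intro sum_mono2) auto
        also have "\<dots> \<le> C" using sumb by simp
        finally have "real (card ?huge) \<le> C / A" using A0 by (simp add: field_simps)
        also have "C / A = \<kappa>\<^sup>2 / 8 * real n" using \<kappa> by (simp add: C_def A_def power2_eq_square power3_eq_cube)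
        finally show ?thesis .
      qed
      ultimately show ?thesis using w(3) by linarith
    qed
    have wQ: "w \<in> cube {..<n} (\<lambda>j. b j * int H) H"
      unfolding cube_def PiE_iff
    proof (intro conjI ballI w(1))
      fix j assume j: "j \<in> {..<n}"
      have e: "b j * int H = w j div int H * int H" using j by (simp add: b_def)
      show "w j \<in> {b j * int H..<b j * int H + int H}" unfolding e atLeastLessThan_iff using dm[of j] by linarith
    qed
    \<comment> \<open>Here 384 = 6 * 16 * 4 arises: 6 from comparing psi with windows, 16 from H
      \<ge> N \<kappa> / 16, and 4 from the lower bound L / (4 N).\<close>
    have "\<exists>z. window_prob p {..<n} r w z > M\<^sub>0 / real H"
    proof (rule ccontr)
      assume "\<not> ?thesis"
      then have "psi p n (\<lambda>j. real_of_int (w j)) \<le> 6 * (M\<^sub>0 / real H)"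
        using psi_le_window[OF p n r, of w "M\<^sub>0 / real H"] by (simp add: not_less)
      then have "L / (4 * N) \<le> 6 * (M\<^sub>0 / real H)" using w(4) by linarith
      also have "\<dots> \<le> 6 * (M\<^sub>0 / (N * \<kappa> / 16))"
        using H M0 Nk by (intro mult_left_mono divide_left_mono mult_pos_pos) auto
      finally have "L / (4 * N) * (4 * N) \<le> 6 * (M\<^sub>0 / (N * \<kappa> / 16)) * (4 * N)" using N1 by (intro mult_right_mono) auto
      moreover have "6 * (M\<^sub>0 / (N * \<kappa> / 16)) * (4 * N) = 384 / \<kappa> * M\<^sub>0" using N1 \<kappa> by (simp add: field_simps)
      ultimately show False using L N1 by simp
    qed
    then show "w \<in> (\<Union>b\<in>?Bs'. ?Q b)" using bB bG wQ by blast
  qed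
  have finQ: "finite (?Q b)" for b using finite_cube[of "{..<n}"] by simp
  have finB': "finite ?Bs'" by (rule finite_subset[OF _ finB]) auto
  have finU: "finite (\<Union>b\<in>?Bs'. ?Q b)" using finite_UN_I[OF finB' finQ] .
  then show "finite (critical_points p \<kappa> L n N)" using sub finite_subset by blast
  have cQ: "real (card (?Q b)) \<le> real H ^ n * \<beta>" if b: "b \<in> ?Bs'" for b
  proof (rule bad[OF H(3) HN, of "?G b"])
    show "\<forall>i\<in>?G b. \<forall>x\<in>{b i * int H..<b i * int H + int H}. real H \<le> \<bar>real_of_int x\<bar> \<and> \<bar>real_of_int x\<bar> \<le> (264 / \<kappa> ^ 3 + 1) * real H"
    proof (intro ballI)
      fix i x assume i: "i \<in> ?G b" and x: "x \<in> {b i * int H..<b i * int H + int H}"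
      have "int H \<le> \<bar>x\<bar> \<and> \<bar>x\<bar> \<le> (\<bar>b i\<bar> + 1) * int H"
      proof (cases "b i \<ge> 2")
        case True
        then have m: "2 * int H \<le> b i * int H" by (intro mult_right_mono) auto
        have e: "(\<bar>b i\<bar> + 1) * int H = b i * int H + int H" using True by (simp add: algebra_simps)
        show ?thesis unfolding e using x m unfolding atLeastLessThan_iff by linarith
      next
        case False
        then have b2: "b i \<le> - 2" using i by auto
        then have m: "b i * int H \<le> - 2 * int H" by (intro mult_right_mono) auto
        have e: "(\<bar>b i\<bar> + 1) * int H = - (b i * int H) + int H" using b2 by (simp add: algebra_simps)
        show ?thesis unfolding e using x m unfolding atLeastLessThan_iff by linarith
      qed
      then have "real_of_int (int H) \<le> real_of_int \<bar>x\<bar> \<and> real_of_int \<bar>x\<bar> \<le> real_of_int ((\<bar>b i\<bar> + 1) * int H)"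
        by (simp only: of_int_le_iff)
      moreover have "real_of_int ((\<bar>b i\<bar> + 1) * int H) \<le> (264 / \<kappa> ^ 3 + 1) * real H"
        using i by (simp add: A_def mult_right_mono)
      ultimately show "real H \<le> \<bar>real_of_int x\<bar> \<and> \<bar>real_of_int x\<bar> \<le> (264 / \<kappa> ^ 3 + 1) * real H" by simp
    qed
  qed (use b in auto)
  have Hn: "real H ^ n > 0" using H(3) by simp
  have \<beta>0: "\<beta> \<ge> 0" if "b \<in> ?Bs'" for b
  proof -
    have "0 \<le> real H ^ n * \<beta>" using cQ[OF that] of_nat_0_le_iff order_trans by blast
    then show ?thesis using mult_le_cancel_left_pos[OF Hn, of 0 \<beta>] by simp
  qed
  show "real (card (critical_points p \<kappa> L n N)) \<le> 2 ^ nat \<lfloor>33 / \<kappa> * real n\<rfloor> * 3 ^ n * (N ^ n * \<beta>)"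
  proof (cases "?Bs' = {}")
    case True
    then have "critical_points p \<kappa> L n N = {}" using sub by blast
    \<comment> \<open>With no boxes at hand, the sign of \<beta> is extracted from
      \<open>bad\<close> for one auxiliary box, all of whose coordinates lie in [2 H, 3 H).\<close>
    moreover have "0 \<le> \<beta>"
    proof -
      let ?J = "{..<n}"
      have "real (card {w\<in>cube {..<n} (\<lambda>_. 2 * int H) H. \<exists>z. window_prob p {..<n} r w z > M\<^sub>0 / real H}) \<le> real H ^ n * \<beta>"
      proof (rule bad[OF H(3) HN, of ?J])
        have "\<kappa>\<^sup>2 \<le> 1" using \<kappa> by (simp add: power_le_one)
        then have "\<kappa>\<^sup>2 / 8 * real n \<le> 1 * real n" by (intro mult_right_mono) auto
        then show "\<kappa>\<^sup>2 / 8 * real n \<le> real (card {..<n})" by simp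
        have "264 / \<kappa> ^ 3 \<ge> 264 / 1" using \<kappa> by (intro divide_left_mono) (auto simp: power_le_one)
        then have "3 * real H \<le> (264 / \<kappa> ^ 3 + 1) * real H" by (intro mult_right_mono) auto
        then show "\<forall>i\<in>{..<n}. \<forall>x\<in>{2 * int H..<2 * int H + int H}. real H \<le> \<bar>real_of_int x\<bar> \<and> \<bar>real_of_int x\<bar> \<le> (264 / \<kappa> ^ 3 + 1) * real H"
          by (auto simp: abs_if)
      qed auto
      then have "0 \<le> real H ^ n * \<beta>" using of_nat_0_le_iff order_trans by blast
      then show ?thesis using mult_le_cancel_left_pos[OF Hn, of 0 \<beta>] by simp
    qed
    ultimately show ?thesis using N1 by simp
  next
    case False
    then have b0: "\<beta> \<ge> 0" using \<beta>0 by blast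
    have "card (critical_points p \<kappa> L n N) \<le> card (\<Union>b\<in>?Bs'. ?Q b)" by (rule card_mono[OF finU sub])
    also have "\<dots> \<le> (\<Sum>b\<in>?Bs'. card (?Q b))" using finB' by (intro card_UN_le)
    finally have "real (card (critical_points p \<kappa> L n N)) \<le> (\<Sum>b\<in>?Bs'. real (card (?Q b)))" by (simp flip: of_nat_sum)
    also have "\<dots> \<le> (\<Sum>b\<in>?Bs'. real H ^ n * \<beta>)" by (intro sum_mono cQ)
    also have "\<dots> = real (card ?Bs') * (real H ^ n * \<beta>)" by simp
    also have "\<dots> \<le> (2 ^ nat \<lfloor>C\<rfloor> * 3 ^ n) * (N ^ n * \<beta>)"
    proof (intro mult_mono mult_right_mono power_mono)
      have "card ?Bs' \<le> card ?Bs" using finB by (intro card_mono) auto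
      then show "real (card ?Bs') \<le> 2 ^ nat \<lfloor>C\<rfloor> * 3 ^ n" using cardB by linarith
    qed (use HN b0 N1 in auto)
    finally show ?thesis by (simp only: C_def)
  qed
qed

text \<open>For small \<delta> the exponent 1 - 5 \<delta> costs less than the gap between p' and p.
  The bound \<kappa>^2 / 16 makes room for 2 \<delta> n coordinates among the \<kappa>^2 n / 8 large
  ones of a box.\<close>

lemma ex_split_parameter:
  fixes p p' \<kappa> :: real
  assumes p: "0 < p" "p \<le> 1 / 2" and p': "p' < p" and \<kappa>: "0 < \<kappa>"
  shows "\<exists>\<delta>. 0 < \<delta> \<and> \<delta> < 1 / 5 \<and> \<delta> \<le> \<kappa>\<^sup>2 / 16 \<and> (1 - p) powr (1 - 5 * \<delta>) \<le> 1 - p'"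
proof -
  define l where "l = - ln (1 - p)"
  have l: "l > 0" using p by (simp add: l_def)
  define d where "d = (ln (1 - p') - ln (1 - p)) / (5 * l)"
  have d: "d > 0" using l p p' by (simp add: d_def)
  define \<delta> where "\<delta> = min d (min (1 / 10) (\<kappa>\<^sup>2 / 16))"
  have \<delta>: "0 < \<delta>" "\<delta> \<le> d" "\<delta> \<le> 1 / 10" "\<delta> \<le> \<kappa>\<^sup>2 / 16" using d \<kappa> by (auto simp: \<delta>_def)
  have "5 * l * \<delta> \<le> 5 * l * d" using \<delta> l by (intro mult_left_mono) auto
  also have "\<dots> = ln (1 - p') + l" using l by (simp add: d_def l_def)
  finally have "(1 - 5 * \<delta>) * ln (1 - p) \<le> ln (1 - p')" by (simp add: l_def algebra_simps)
  then have "exp ((1 - 5 * \<delta>) * ln (1 - p)) \<le> exp (ln (1 - p'))" by simp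
  also have "\<dots> = 1 - p'" using p p' by simp
  finally have "(1 - p) powr (1 - 5 * \<delta>) \<le> 1 - p'" using p by (simp add: powr_def)
  then show ?thesis using \<delta> by (intro exI[of _ \<delta>]) auto
qed

text \<open>Up to a probability of smaller order than \<open>(1 - p) ^ (k * n)\<close>, every spread kernel vector has
  concentration at most \<open>n (1 - p') ^ n\<close>. The rounding loses a factor \<open>C ^ n\<close> only, whereas the
  number of critical points gains a factor \<open>n ^ (- c n)\<close>.\<close>

theorem spread_kernel_vectors_rare:
  fixes p p' \<kappa> :: real
  assumes p: "0 < p" "p \<le> 1 / 2" and p': "p' < p" and \<kappa>: "0 < \<kappa>" "\<kappa> \<le> 1"
  shows "eventually (\<lambda>n. \<forall>I :: nat set. finite I \<longrightarrow> card I = n - k \<longrightarrow>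
     mexp (\<lambda>_. p) I {..<n} (\<lambda>B. of_bool (\<exists>v. spread_vec n \<kappa> v \<and> (\<forall>i\<in>I. ssum (B i) v = 0)
        \<and> bexp (\<lambda>_. p) {..<n} (\<lambda>S. of_bool (ssum S v = 0)) > real n * (1 - p') ^ n)) \<le> (1 - p) ^ (k * n)) at_top"
proof -
  obtain \<delta> where \<delta>: "0 < \<delta>" "\<delta> < 1 / 5" "\<delta> \<le> \<kappa>\<^sup>2 / 16" "(1 - p) powr (1 - 5 * \<delta>) \<le> 1 - p'"
    using ex_split_parameter[OF p p' \<kappa>(1)] by blast
  define A where "A = 264 / \<kappa> ^ 3 + 1"
  have A: "A \<ge> 1" using \<kappa> by (simp add: A_def)
  \<comment> \<open>Just above the 384 / \<kappa> demanded by the count of critical points.\<close>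
  define c where "c = 400 / \<kappa>"
  have c: "c \<ge> 400" using \<kappa> by (simp add: c_def le_divide_eq)
  \<comment> \<open>Collects all exponential rates: the number of boxes, the leftover
    \<open>2 ^ (n * k)\<close>, the constants per row, and the target
    \<open>(1 - p) ^ (k * n)\<close>.\<close>
  define D where "D = 33 / \<kappa> * ln 2 + ln 3 + real k * ln 2 + ln (8 * exp 1 * c) + real k * (- ln (1 - p))"
  have "D > 0"
  proof -
    have "8 * exp 1 * c > 1" using c by (smt (verit) one_le_exp_iff mult_less_cancel_left2 mult_le_cancel_left1)
    then have "ln (8 * exp 1 * c) > 0" by (rule ln_gt_zero)
    moreover have "ln (1 - p) < 0" "33 / \<kappa> * ln 2 \<ge> 0" "ln (3::real) > 0" using p \<kappa> by simp_all
    moreover have "real k * ln 2 \<ge> 0" by simp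
    moreover have "real k * (- ln (1 - p)) \<ge> 0" using p by (intro mult_nonneg_nonneg) auto
    ultimately show ?thesis unfolding D_def by linarith
  qed
  \<comment> \<open>The count of critical points gains n ^ (\<delta> n / 4), of which the factor
    \<open>L ^ n\<close> with L = c n ^ (\<delta> / 16) takes back \<delta> / 16 in the
    exponent.\<close>
  define d where "d = 3 * \<delta> / 16"
  have d: "d > 0" using \<delta> by (simp add: d_def)
  have ev: "eventually (\<lambda>n::nat. ln (real n) + D * real n - d * (real n * ln (real n)) \<le> 0) at_top"
    using \<open>D > 0\<close> d by real_asymp
  have evL: "eventually (\<lambda>n::nat. c * real n powr (\<delta> / 16) \<le> real n) at_top"
    using c \<delta> by real_asymp
  have cb: "eventually (\<lambda>n. \<forall>H c J2. H > 0 \<longrightarrow> real H \<le> (1 - p') powr (- real n) \<longrightarrow> J2 \<subseteq> {..<n} \<longrightarrow>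
      \<delta> * real n \<le> real (card J2) / 2 \<longrightarrow>
      (\<forall>i\<in>J2. \<forall>x\<in>{c i..<c i + int H}. real H \<le> \<bar>real_of_int x\<bar> \<and> \<bar>real_of_int x\<bar> \<le> A * real H) \<longrightarrow>
      real (card {w\<in>cube {..<n} c H. \<exists>z. window_prob p {..<n} (nat \<lceil>sqrt (real n)\<rceil>) w z > real n powr (\<delta> / 16) / real H})
        \<le> real H ^ n * real n powr (- \<delta> * real n / 4)) at_top"
    by (rule cube_bad_points[OF p \<delta>(1,2) A \<delta>(4) p'])
  show ?thesis
    using ev evL cb eventually_gt_at_top[of "k + 1"]
  proof eventually_elim
    case (elim n)
    show ?case
    proof (intro allI impI)
      fix I :: "nat set" assume I: "finite I" "card I = n - k"
      have n: "n > 0" "k < n" using elim(4) by simp_all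
      have I0: "I \<noteq> {}" using I n by auto
      have p01: "0 \<le> p" "p \<le> 1" using p by auto
      define M0 where "M0 = real n powr (\<delta> / 16)"
      define L where "L = c * M0"
      have M0: "M0 \<ge> 1" using n \<delta> by (simp add: M0_def ge_one_powr_ge_zero)
      have L: "L \<ge> 400 / \<kappa>" "L \<ge> 400"
      proof -
        have "c * 1 \<le> c * M0" using M0 c by (intro mult_left_mono) auto
        then show "L \<ge> 400 / \<kappa>" "L \<ge> 400" using c by (simp_all add: L_def c_def)
      qed
      \<comment> \<open>At this scale L / Nmax is at most n (1 - p') ^ n, so a vector that violates
        the bound satisfies the starting condition for the search of its critical scale.\<close>
      define Nmax where "Nmax = (1 / (1 - p')) ^ n"
      have Nmax: "Nmax > 0" "Nmax \<le> 2 ^ n" "Nmax = (1 - p') powr (- real n)"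
      proof -
        show "Nmax > 0" using p p' by (simp add: Nmax_def)
        show "Nmax \<le> 2 ^ n" unfolding Nmax_def using p p' by (intro power_mono) (auto simp: field_simps)
        show "Nmax = (1 - p') powr (- real n)"
          using p p' by (simp add: Nmax_def powr_minus powr_realpow field_simps)
      qed
      define N where "N i = Nmax / 2 ^ i" for i :: nat
      define r where "r = nat \<lceil>sqrt (real n)\<rceil>"
      have r: "sqrt (real n) \<le> real r" by (simp add: r_def)
      define \<beta> where "\<beta> = real n powr (- \<delta> * real n / 4)"
      have \<beta>0: "\<beta> \<ge> 0" by (simp add: \<beta>_def)
      define K where "K = {i. i < n \<and> N i \<ge> 16 / \<kappa>}"
      have NK: "N i \<le> Nmax" for i
      proof -
        have "Nmax / 2 ^ i \<le> Nmax / 1" using Nmax by (intro divide_left_mono) auto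
        then show ?thesis by (simp add: N_def)
      qed
      have cp: "finite (critical_points p \<kappa> L n (N i))"
        "real (card (critical_points p \<kappa> L n (N i))) \<le> 2 ^ nat \<lfloor>33 / \<kappa> * real n\<rfloor> * 3 ^ n * (N i ^ n * \<beta>)"
        if i: "i \<in> K" for i
      proof -
        have Ni: "N i \<ge> 16 / \<kappa>" using i by (simp add: K_def)
        have LM: "L > 384 / \<kappa> * M0" using M0 \<kappa> by (simp add: L_def c_def divide_strict_right_mono mult_strict_right_mono)
        have bd: "real (card {w\<in>cube {..<n} c' H. \<exists>z. window_prob p {..<n} r w z > M0 / real H}) \<le> real H ^ n * \<beta>"
          if h: "H > 0" "real H \<le> N i" "J2 \<subseteq> {..<n}" "\<kappa>\<^sup>2 / 8 * real n \<le> real (card J2)"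
            "\<forall>i\<in>J2. \<forall>x\<in>{c' i..<c' i + int H}. real H \<le> \<bar>real_of_int x\<bar> \<and> \<bar>real_of_int x\<bar> \<le> (264 / \<kappa> ^ 3 + 1) * real H"
          for H c' J2
        proof -
          have "\<delta> * real n \<le> \<kappa>\<^sup>2 / 16 * real n" using \<delta>(3) by (intro mult_right_mono) auto
          then have "\<delta> * real n \<le> real (card J2) / 2" using h(4) by simp
          moreover have "real H \<le> (1 - p') powr (- real n)" using h(2) NK[of i] Nmax(3) by linarith
          ultimately show ?thesis
            unfolding M0_def r_def \<beta>_def using elim(3)[rule_format, OF h(1) _ h(3), of c'] h(5) unfolding A_def by blast
        qed
        have M0p: "M0 > 0" using M0 by simp
        show "finite (critical_points p \<kappa> L n (N i))"
          by (rule card_critical_points_le(1)[OF p01 \<kappa> n(1) Ni r LM M0p], rule bd)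
        show "real (card (critical_points p \<kappa> L n (N i))) \<le> 2 ^ nat \<lfloor>33 / \<kappa> * real n\<rfloor> * 3 ^ n * (N i ^ n * \<beta>)"
          by (rule card_critical_points_le(2)[OF p01 \<kappa> n(1) Ni r LM M0p], rule bd)
      qed
      let ?X = "SIGMA i:K. critical_points p \<kappa> L n (N i)"
      let ?E = "\<lambda>w B. (\<Sum>i\<in>I. (ssum (B i) (\<lambda>j. real_of_int (w j)))\<^sup>2) \<le> real (card I) * real n"
      have finK: "finite K" by (simp add: K_def)
      have finX: "finite ?X" using finK cp(1) by (intro finite_SigmaI)
      have "mexp (\<lambda>_. p) I {..<n} (\<lambda>B. of_bool (\<exists>v. spread_vec n \<kappa> v \<and> (\<forall>i\<in>I. ssum (B i) v = 0)
        \<and> bexp (\<lambda>_. p) {..<n} (\<lambda>S. of_bool (ssum S v = 0)) > real n * (1 - p') ^ n))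
        \<le> (\<Sum>x\<in>?X. mexp (\<lambda>_. p) I {..<n} (\<lambda>B. of_bool (?E (snd x) B)))"
      proof (rule mexp_ex_le_sum[OF p01 finX])
        fix B assume B: "B \<in> PiE I (\<lambda>_. Pow {..<n})"
          and "\<exists>v. spread_vec n \<kappa> v \<and> (\<forall>i\<in>I. ssum (B i) v = 0)
            \<and> bexp (\<lambda>_. p) {..<n} (\<lambda>S. of_bool (ssum S v = 0)) > real n * (1 - p') ^ n"
        then obtain v where v: "spread_vec n \<kappa> v" "\<forall>i\<in>I. ssum (B i) v = 0"
          "bexp (\<lambda>_. p) {..<n} (\<lambda>S. of_bool (ssum S v = 0)) > real n * (1 - p') ^ n" by blast
        have "L / Nmax \<le> real n * (1 - p') ^ n"
        proof -
          have "L / Nmax = L * (1 - p') ^ n" using p p' by (simp add: Nmax_def power_divide)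
          also have "\<dots> \<le> real n * (1 - p') ^ n"
            using elim(2) p p' by (intro mult_right_mono) (auto simp: L_def M0_def)
          finally show ?thesis .
        qed
        then have big: "bexp (\<lambda>_. p) {..<n} (\<lambda>S. of_bool (ssum S v = 0)) > L / Nmax" using v(3) by linarith
        obtain i where i: "i < n" "L / N i \<le> psi p n (\<lambda>j. N i * v j)" "psi p n (\<lambda>j. N i * v j) \<le> 2 * L / N i"
          using ex_critical_scale[OF p01 Nmax(1,2) _ big] L unfolding N_def by auto
        have Npos: "N i > 0" using Nmax by (simp add: N_def)
        have "L / N i \<le> 1" using i(2) psi_le_1[OF p01, of n "\<lambda>j. N i * v j"] by linarith
        then have NL: "N i \<ge> L" using Npos by (simp add: divide_le_eq)
        have "16 / \<kappa> \<le> 400 / \<kappa>" using \<kappa> by (simp add: divide_right_mono)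
        then have iK: "i \<in> K" using i(1) NL L by (simp add: K_def)
        have "N i \<ge> 1" using NL L by linarith
        from ex_critical_point[OF p01 n(1) I(1) I0 B v(2,1) \<kappa>(1) this i(2,3)]
        obtain w where "w \<in> critical_points p \<kappa> L n (N i)" "?E w B" by blast
        then show "\<exists>x\<in>?X. ?E (snd x) B" using iK by (intro bexI[of _ "(i, w)"]) auto
      qed
      also have "\<dots> \<le> (\<Sum>x\<in>?X. (exp 1 * (8 * L / N (fst x))) ^ (n - k))"
      proof (rule sum_mono)
        fix x assume x: "x \<in> ?X"
        have "mexp (\<lambda>_. p) I {..<n} (\<lambda>B. of_bool (?E (snd x) B)) \<le> (exp 1 * psi p n (\<lambda>j. real_of_int (snd x j))) ^ card I"
          by (rule mexp_small_rows_le[OF I(1) p01 n(1)])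
        also have "\<dots> \<le> (exp 1 * (8 * L / N (fst x))) ^ (n - k)"
          unfolding I(2) using x psi_pos[OF p01, of n "\<lambda>j. real_of_int (snd x j)"]
          by (intro power_mono mult_left_mono mult_nonneg_nonneg) (auto simp: critical_points_def)
        finally show "mexp (\<lambda>_. p) I {..<n} (\<lambda>B. of_bool (?E (snd x) B)) \<le> (exp 1 * (8 * L / N (fst x))) ^ (n - k)" .
      qed
      also have "\<dots> = (\<Sum>i\<in>K. \<Sum>w\<in>critical_points p \<kappa> L n (N i). (exp 1 * (8 * L / N i)) ^ (n - k))"
        using finK cp(1) by (subst sum.Sigma) (auto intro!: sum.cong)
      also have "\<dots> \<le> (\<Sum>i\<in>K. 2 powr (33 / \<kappa> * real n) * 3 ^ n * \<beta> * (2 ^ (n * k) * (8 * exp 1 * L) ^ n))"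
      proof (rule sum_mono)
        fix i assume i: "i \<in> K"
        have Npos: "N i > 0" using Nmax by (simp add: N_def)
        have kn: "k \<le> n" using n by simp
        have eL: "8 * exp 1 * L \<ge> 1" using L by (smt (verit) one_le_exp_iff mult_le_cancel_left1)
        \<comment> \<open>The n - k rows cancel the \<open>N ^ n\<close> from the number of points
          up to \<open>N ^ k\<close>, and N \<le> \<open>2 ^ n\<close> makes this remainder
          exponential in n.\<close>
        have f1: "N i ^ n * (exp 1 * (8 * L / N i)) ^ (n - k) \<le> 2 ^ (n * k) * (8 * exp 1 * L) ^ n"
        proof -
          have "N i ^ n = N i ^ k * N i ^ (n - k)" using kn by (simp flip: power_add)
          then have "N i ^ n * (exp 1 * (8 * L / N i)) ^ (n - k) = N i ^ k * (N i * (exp 1 * (8 * L / N i))) ^ (n - k)"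
            by (simp only: power_mult_distrib mult_ac)
          also have "N i * (exp 1 * (8 * L / N i)) = 8 * exp 1 * L" using Npos by simp
          also have "N i ^ k * (8 * exp 1 * L) ^ (n - k) \<le> (2 ^ n) ^ k * (8 * exp 1 * L) ^ n"
          proof (intro mult_mono power_mono power_increasing)
            show "0 \<le> (8 * exp 1 * L) ^ (n - k)" using eL by (intro zero_le_power) linarith
          qed (use NK[of i] Nmax(2) Npos eL in auto)
          finally show ?thesis by (simp only: power_mult)
        qed
        have f2: "(2::real) ^ nat \<lfloor>33 / \<kappa> * real n\<rfloor> \<le> 2 powr (33 / \<kappa> * real n)"
        proof -
          have "(2::real) ^ nat \<lfloor>33 / \<kappa> * real n\<rfloor> = 2 powr real (nat \<lfloor>33 / \<kappa> * real n\<rfloor>)" by (simp add: powr_realpow)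
          also have "\<dots> \<le> 2 powr (33 / \<kappa> * real n)" using \<kappa> by (intro powr_mono) auto
          finally show ?thesis .
        qed
        have "(\<Sum>w\<in>critical_points p \<kappa> L n (N i). (exp 1 * (8 * L / N i)) ^ (n - k))
          = real (card (critical_points p \<kappa> L n (N i))) * (exp 1 * (8 * L / N i)) ^ (n - k)" by simp
        also have "\<dots> \<le> (2 ^ nat \<lfloor>33 / \<kappa> * real n\<rfloor> * 3 ^ n * (N i ^ n * \<beta>)) * (exp 1 * (8 * L / N i)) ^ (n - k)"
          using cp(2)[OF i] L Npos by (intro mult_right_mono) auto
        also have "\<dots> = 2 ^ nat \<lfloor>33 / \<kappa> * real n\<rfloor> * 3 ^ n * \<beta> * (N i ^ n * (exp 1 * (8 * L / N i)) ^ (n - k))"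
          by (simp only: mult_ac)
        also have "\<dots> \<le> 2 powr (33 / \<kappa> * real n) * 3 ^ n * \<beta> * (2 ^ (n * k) * (8 * exp 1 * L) ^ n)"
          by (rule mult_mono[OF mult_right_mono[OF mult_right_mono[OF f2]] f1]) (use \<beta>0 L Npos in \<open>auto intro!: mult_nonneg_nonneg\<close>)
        finally show "(\<Sum>w\<in>critical_points p \<kappa> L n (N i). (exp 1 * (8 * L / N i)) ^ (n - k))
          \<le> 2 powr (33 / \<kappa> * real n) * 3 ^ n * \<beta> * (2 ^ (n * k) * (8 * exp 1 * L) ^ n)" .
      qed
      also have "\<dots> \<le> real n * (2 powr (33 / \<kappa> * real n) * 3 ^ n * \<beta> * (2 ^ (n * k) * (8 * exp 1 * L) ^ n))"
      proof -
        have "card K \<le> card {..<n}" by (intro card_mono) (auto simp: K_def)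
        then have "real (card K) \<le> real n" by simp
        then show ?thesis using \<beta>0 L unfolding sum_constant by (intro mult_right_mono) (auto intro!: mult_nonneg_nonneg)
      qed
      also have "\<dots> = exp (ln (real n) + D * real n - d * (real n * ln (real n)) + real (k * n) * ln (1 - p))"
      proof -
        have e1: "2 powr (33 / \<kappa> * real n) = exp (33 / \<kappa> * real n * ln 2)" by (simp add: powr_def)
        have pw: "x ^ m = exp (real m * ln x)" if "x > 0" for x :: real and m
          using that by (simp add: exp_of_nat_mult)
        have e2: "(3::real) ^ n = exp (real n * ln 3)" "(2::real) ^ (n * k) = exp (real (n * k) * ln 2)" by (rule pw; simp)+
        have e3: "\<beta> = exp (- \<delta> * real n / 4 * ln (real n))" using n by (simp add: \<beta>_def powr_def)
        have M0e: "M0 = exp (\<delta> / 16 * ln (real n))" using n by (simp add: M0_def powr_def)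
        have e4: "(8 * exp 1 * L) ^ n = exp (real n * (ln (8 * exp 1 * c) + \<delta> / 16 * ln (real n)))"
        proof -
          have "8 * exp 1 * L = (8 * exp 1 * c) * M0" by (simp add: L_def)
          moreover have "(8 * exp 1 * c) * M0 > 0" using c M0 by simp
          moreover have "ln ((8 * exp 1 * c) * M0) = ln (8 * exp 1 * c) + \<delta> / 16 * ln (real n)"
            using c by (subst ln_mult) (auto simp: M0e)
          ultimately show ?thesis by (simp only: pw)
        qed
        have e5: "real n = exp (ln (real n))" using n by simp
        have "real n * (2 powr (33 / \<kappa> * real n) * 3 ^ n * \<beta> * (2 ^ (n * k) * (8 * exp 1 * L) ^ n))
          = exp (ln (real n)) * (exp (33 / \<kappa> * real n * ln 2) * exp (real n * ln 3) * exp (- \<delta> * real n / 4 * ln (real n))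
            * (exp (real (n * k) * ln 2) * exp (real n * (ln (8 * exp 1 * c) + \<delta> / 16 * ln (real n)))))"
          unfolding e1 e2 e3 e4 using n by simp
        also have "\<dots> = exp (ln (real n) + (33 / \<kappa> * real n * ln 2 + real n * ln 3 + - \<delta> * real n / 4 * ln (real n)
            + (real (n * k) * ln 2 + real n * (ln (8 * exp 1 * c) + \<delta> / 16 * ln (real n)))))"
          by (simp only: exp_add)
        also have "\<dots> = exp (ln (real n) + D * real n - d * (real n * ln (real n)) + real (k * n) * ln (1 - p))"
          unfolding D_def d_def by (rule arg_cong[of _ _ exp]) (simp add: field_simps)
        finally show ?thesis .
      qed
      also have "\<dots> \<le> exp (real (k * n) * ln (1 - p))" using elim(1) by simp
      also have "\<dots> = (1 - p) ^ (k * n)" using p unfolding exp_of_nat_mult by simp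
      finally show "mexp (\<lambda>_. p) I {..<n} (\<lambda>B. of_bool (\<exists>v. spread_vec n \<kappa> v \<and> (\<forall>i\<in>I. ssum (B i) v = 0)
        \<and> bexp (\<lambda>_. p) {..<n} (\<lambda>S. of_bool (ssum S v = 0)) > real n * (1 - p') ^ n)) \<le> (1 - p) ^ (k * n)" .
    qed
  qed
qed

section \<open>Flat kernel vectors\<close>

text \<open>\<open>f i\<close> is the pivot coordinate of the vector \<open>u i\<close>.\<close>

definition tri_system :: "nat set \<Rightarrow> nat \<Rightarrow> (nat \<Rightarrow> nat \<Rightarrow> real) \<Rightarrow> (nat \<Rightarrow> nat) \<Rightarrow> bool" where
  "tri_system J k u f \<longleftrightarrow> (\<forall>i<k. f i \<in> J \<and> u i (f i) = 1 \<and> (\<forall>l<i. u i (f l) = 0) \<and> (\<forall>j\<in>J. \<bar>u i j\<bar> \<le> 1))"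

text \<open>The later vectors vanish at the pivot of \<open>u 0\<close>, and adding this pivot to S
  changes \<open>ssum S (u 0)\<close> by exactly 1. So, given the remaining coordinates, at most one
  of the two states keeps that sum inside (-1/2, 1/2), with probability at most 1 - p. This
  coordinate is removed, and induction applies to the other vectors.\<close>

lemma tri_system_prob:
  assumes "finite J" "0 \<le> p" "p \<le> 1 / 2" "tri_system J k u f"
  shows "bexp (\<lambda>_. p) J (\<lambda>S. of_bool (\<forall>i<k. \<bar>ssum S (u i)\<bar> < 1 / 2)) \<le> (1 - p) ^ k"
  using assms
proof (induction k arbitrary: u f J)
  case 0
  then show ?case by (simp add: bexp_const)
next
  case (Suc k)
  define a where "a = f 0"
  define J' where "J' = J - {a}"
  have a: "a \<in> J" "u 0 a = 1" using Suc.prems(4) by (auto simp: tri_system_def a_def)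
  have z: "u (Suc i) a = 0" if "i < k" for i using Suc.prems(4) that by (auto simp: tri_system_def a_def)
  have J: "J = insert a J'" "a \<notin> J'" "finite J'" using a Suc.prems(1) by (auto simp: J'_def)
  have fa: "f (Suc i) \<noteq> a" if "i < k" for i
  proof
    assume "f (Suc i) = a"
    then show False using z[OF that] Suc.prems(4) that by (auto simp: tri_system_def)
  qed
  have tri: "tri_system J' k (\<lambda>i. u (Suc i)) (\<lambda>i. f (Suc i))"
    using Suc.prems(4) fa unfolding tri_system_def J'_def by auto
  let ?R = "\<lambda>S. \<forall>i<k. \<bar>ssum S (u (Suc i))\<bar> < 1 / 2"
  let ?Q = "\<lambda>S. \<forall>i<Suc k. \<bar>ssum S (u i)\<bar> < 1 / 2"
  have spl: "?Q S \<longleftrightarrow> \<bar>ssum S (u 0)\<bar> < 1 / 2 \<and> ?R S" for S by (simp add: All_less_Suc2)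
  have ins: "ssum (insert a S) v = v a + ssum S v" if "S \<subseteq> J'" for S and v :: "nat \<Rightarrow> real"
    using that J(2,3) finite_subset unfolding ssum_def by (subst sum.insert) auto
  have R: "?R (insert a S) \<longleftrightarrow> ?R S" if "S \<subseteq> J'" for S using z by (simp add: ins[OF that])
  have "bexp (\<lambda>_. p) J (\<lambda>S. of_bool (?Q S))
    = bexp (\<lambda>_. p) J' (\<lambda>S. (1 - p) * of_bool (?Q S) + p * of_bool (?Q (insert a S)))"
    unfolding J(1) bexp_insert[OF J(3,2)] bexp_add bexp_cmult by simp
  also have "\<dots> \<le> bexp (\<lambda>_. p) J' (\<lambda>S. (1 - p) * of_bool (?R S))"
  proof (rule bexp_mono)
    fix S assume S: "S \<subseteq> J'"
    have "\<not> (\<bar>ssum S (u 0)\<bar> < 1 / 2 \<and> \<bar>ssum (insert a S) (u 0)\<bar> < 1 / 2)"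
      using ins[OF S, of "u 0"] a by auto
    then show "(1 - p) * of_bool (?Q S) + p * of_bool (?Q (insert a S)) \<le> (1 - p) * of_bool (?R S)"
      unfolding spl R[OF S] using Suc.prems(2,3) by (cases "?R S") auto
  qed (use Suc.prems in auto)
  also have "\<dots> \<le> (1 - p) * (1 - p) ^ k"
    unfolding bexp_cmult using Suc.IH[OF J(3) Suc.prems(2,3) tri] Suc.prems by (intro mult_left_mono) auto
  finally show ?case by simp
qed

text \<open>Independence factors the characteristic function, and a factor p exp (i x) + 1 - p has
  modulus at most exp (- p x^2 / 16) as long as x stays within pi of 0.\<close>

lemma norm_bexp_cis_le:
  fixes v :: "'a \<Rightarrow> real"
  assumes J: "finite J" and p: "0 \<le> p" "p \<le> 1 / 2" and v: "\<And>j. j \<in> J \<Longrightarrow> \<bar>\<theta> * v j\<bar> \<le> pi"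
  shows "norm (bexp (\<lambda>_. p) J (\<lambda>S. cis (\<theta> * ssum S v))) \<le> exp (- p / 16 * \<theta>\<^sup>2 * (\<Sum>j\<in>J. (v j)\<^sup>2))"
proof -
  have "bexp (\<lambda>_. p) J (\<lambda>S. cis (\<theta> * ssum S v)) = bexp (\<lambda>_. p) J (\<lambda>S. \<Prod>j\<in>J. if j \<in> S then cis (\<theta> * v j) else 1)"
  proof (rule bexp_cong)
    fix S assume S: "S \<subseteq> J"
    then have fS: "finite S" using J finite_subset by blast
    have "cis (\<theta> * ssum S v) = (\<Prod>j\<in>S. cis (\<theta> * v j))"
      unfolding ssum_def sum_distrib_left using fS by (induction S rule: finite_induct) (auto simp: cis_mult[symmetric])
    also have "\<dots> = (\<Prod>j\<in>J. if j \<in> S then cis (\<theta> * v j) else 1)"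
      using S J by (simp add: prod.If_cases Int_absorb1)
    finally show "cis (\<theta> * ssum S v) = (\<Prod>j\<in>J. if j \<in> S then cis (\<theta> * v j) else 1)" .
  qed
  also have "\<dots> = (\<Prod>j\<in>J. p *\<^sub>R cis (\<theta> * v j) + (1 - p) *\<^sub>R 1)" by (rule bexp_prod[OF J])
  finally have "norm (bexp (\<lambda>_. p) J (\<lambda>S. cis (\<theta> * ssum S v))) = (\<Prod>j\<in>J. norm (p *\<^sub>R cis (\<theta> * v j) + (1 - p) *\<^sub>R 1))"
    by (simp only: prod_norm)
  also have "\<dots> \<le> (\<Prod>j\<in>J. exp (- p / 16 * \<theta>\<^sup>2 * (v j)\<^sup>2))"
  proof (intro prod_mono conjI norm_ge_zero)
    fix j assume j: "j \<in> J"
    define x where "x = \<theta> * v j"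
    have "(norm (p *\<^sub>R cis x + (1 - p) *\<^sub>R 1))\<^sup>2 = (p * cos x + (1 - p))\<^sup>2 + (p * sin x)\<^sup>2"
      unfolding cmod_power2 by simp
    also have "\<dots> = p\<^sup>2 * ((cos x)\<^sup>2 + (sin x)\<^sup>2) + 2 * p * (1 - p) * cos x + (1 - p)\<^sup>2"
    proof -
      have "(p * c + (1 - p))\<^sup>2 + (p * s)\<^sup>2 = p\<^sup>2 * (c\<^sup>2 + s\<^sup>2) + 2 * p * (1 - p) * c + (1 - p)\<^sup>2" for c s :: real
        by (simp add: power2_eq_square algebra_simps)
      then show ?thesis .
    qed
    also have "(cos x)\<^sup>2 + (sin x)\<^sup>2 = 1" by simp
    also have "p\<^sup>2 * 1 + 2 * p * (1 - p) * cos x + (1 - p)\<^sup>2 = 1 + (- (2 * p * (1 - p) * (1 - cos x)))" by (simp add: power2_eq_square algebra_simps)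
    also have "\<dots> \<le> exp (- (2 * p * (1 - p) * (1 - cos x)))" by (rule exp_ge_add_one_self)
    also have "\<dots> \<le> exp (2 * (- p / 16 * x\<^sup>2))"
    proof -
      have "p * (x\<^sup>2 / 8) = 2 * p * ((1 / 2) * (x\<^sup>2 / 8))" by simp
      also have "\<dots> \<le> 2 * p * ((1 - p) * (1 - cos x))"
        using p one_minus_cos_ge[of x] v[OF j] by (intro mult_left_mono mult_mono) (auto simp: x_def)
      finally show ?thesis by (simp add: mult.assoc)
    qed
    also have "\<dots> = (exp (- p / 16 * x\<^sup>2))\<^sup>2" by (simp add: exp_double[symmetric])
    finally have "norm (p *\<^sub>R cis x + (1 - p) *\<^sub>R 1) \<le> exp (- p / 16 * x\<^sup>2)" by (rule power2_le_imp_le) simp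
    then show "norm (p *\<^sub>R cis (\<theta> * v j) + (1 - p) *\<^sub>R 1) \<le> exp (- p / 16 * \<theta>\<^sup>2 * (v j)\<^sup>2)"
      by (simp add: x_def power_mult_distrib mult.assoc)
  qed
  also have "\<dots> = exp (- p / 16 * \<theta>\<^sup>2 * (\<Sum>j\<in>J. (v j)\<^sup>2))"
    by (simp only: exp_sum[OF J, symmetric] sum_distrib_left)
  finally show ?thesis .
qed

text \<open>The Fejer kernel \<open>(norm (\<Sum>l<Q. cis (l \<theta> y)))\<^sup>2\<close> is at least \<open>Q\<^sup>2 / 4\<close> for \<open>\<bar>y\<bar> \<le> 1 / (Q \<theta>)\<close>.\<close>

lemma small_ball_fejer:
  fixes v :: "'a \<Rightarrow> real"
  assumes J: "finite J" and p: "0 \<le> p" "p \<le> 1 / 2" and v: "\<And>j. j \<in> J \<Longrightarrow> \<bar>v j\<bar> \<le> 1"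
    and Q: "Q > 0" and R: "R \<ge> 1"
  shows "bexp (\<lambda>_. p) J (\<lambda>S. of_bool (\<bar>ssum S v\<bar> \<le> R))
    \<le> 4 / real Q + 4 * exp (- p / 16 * (1 / (real Q * R))\<^sup>2 * (\<Sum>j\<in>J. (v j)\<^sup>2))"
proof -
  \<comment> \<open>So small that l \<theta> y is below pi / 3 on the ball, where the cosine is at
    least 1/2, and that all differences of the frequencies l \<theta> stay in the range of the
    Gaussian decay.\<close>
  define \<theta> where "\<theta> = 1 / (real Q * R)"
  have th: "\<theta> > 0" "real Q * \<theta> \<le> 1" using Q R by (simp_all add: \<theta>_def)
  define F where "F y = (norm (\<Sum>l<Q. cis (real l * \<theta> * y)))\<^sup>2" for y
  define e where "e = exp (- p / 16 * \<theta>\<^sup>2 * (\<Sum>j\<in>J. (v j)\<^sup>2))"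
  have p01: "0 \<le> p \<and> p \<le> 1" using p by auto
  have F: "of_bool (\<bar>y\<bar> \<le> R) \<le> 4 / (real Q)\<^sup>2 * F y" for y
  proof (cases "\<bar>y\<bar> \<le> R")
    case True
    have c: "cos (real l * \<theta> * y) \<ge> 1 / 2" if "l < Q" for l
    proof -
      have "\<bar>real l * \<theta> * y\<bar> = real l * \<theta> * \<bar>y\<bar>" using th by (simp add: abs_mult)
      also have "\<dots> \<le> real Q * \<theta> * R" using that th True R by (intro mult_mono) auto
      also have "\<dots> = 1" using Q R by (simp add: \<theta>_def)
      finally have "\<bar>real l * \<theta> * y\<bar> \<le> pi / 3" using pi_approx(1) by simp
      then have "cos (pi / 3) \<le> cos \<bar>real l * \<theta> * y\<bar>" by (intro cos_monotone_0_pi_le) auto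
      then show ?thesis by (simp add: cos_60)
    qed
    have "real Q * (1 / 2) = (\<Sum>l<Q. 1 / 2)" by simp
    also have "\<dots> \<le> (\<Sum>l<Q. cos (real l * \<theta> * y))" using c by (intro sum_mono) auto
    also have "\<dots> = Re (\<Sum>l<Q. cis (real l * \<theta> * y))" by simp
    also have "\<dots> \<le> norm (\<Sum>l<Q. cis (real l * \<theta> * y))" by (rule complex_Re_le_cmod)
    finally have "(real Q * (1 / 2))\<^sup>2 \<le> F y" unfolding F_def by (intro power_mono) auto
    then show ?thesis using True Q by (simp add: field_simps power2_eq_square)
  qed (simp add: F_def)
  have FE: "bexp (\<lambda>_. p) J (\<lambda>S. F (ssum S v)) \<le> real Q + (real Q)\<^sup>2 * e"
  proof -
    have "complex_of_real (F y) = (\<Sum>l<Q. \<Sum>m<Q. cis ((real l - real m) * \<theta> * y))" for y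
      unfolding F_def complex_norm_square
      by (simp add: sum_product cis_cnj cis_mult algebra_simps)
    then have "complex_of_real (bexp (\<lambda>_. p) J (\<lambda>S. F (ssum S v)))
       = (\<Sum>l<Q. \<Sum>m<Q. bexp (\<lambda>_. p) J (\<lambda>S. cis ((real l - real m) * \<theta> * ssum S v)))"
      by (simp add: bexp_of_real bexp_sum)
    then have "norm (complex_of_real (bexp (\<lambda>_. p) J (\<lambda>S. F (ssum S v))))
       \<le> (\<Sum>l<Q. \<Sum>m<Q. norm (bexp (\<lambda>_. p) J (\<lambda>S. cis ((real l - real m) * \<theta> * ssum S v))))"
      by (simp only:, intro order_trans[OF norm_sum] sum_mono norm_sum)
    also have "\<dots> \<le> (\<Sum>l<Q. \<Sum>m<Q. (if m = l then 1 else 0) + e)"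
    proof (intro sum_mono)
      fix l m assume lm: "l \<in> {..<Q}" "m \<in> {..<Q}"
      show "norm (bexp (\<lambda>_. p) J (\<lambda>S. cis ((real l - real m) * \<theta> * ssum S v))) \<le> (if m = l then 1 else 0) + e"
      proof (cases "m = l")
        case True
        then show ?thesis by (simp add: bexp_const[OF J] e_def)
      next
        case False
        have d: "\<bar>real l - real m\<bar> \<le> real Q" "\<bar>real l - real m\<bar> \<ge> 1" using lm False by auto
        have "norm (bexp (\<lambda>_. p) J (\<lambda>S. cis ((real l - real m) * \<theta> * ssum S v)))
          \<le> exp (- p / 16 * ((real l - real m) * \<theta>)\<^sup>2 * (\<Sum>j\<in>J. (v j)\<^sup>2))"
        proof (rule norm_bexp_cis_le[OF J p])
          fix j assume j: "j \<in> J"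
          have "\<bar>(real l - real m) * \<theta> * v j\<bar> = \<bar>real l - real m\<bar> * \<theta> * \<bar>v j\<bar>" using th by (simp add: abs_mult)
          also have "\<dots> \<le> (real Q * \<theta>) * 1" using d th v[OF j] by (intro mult_mono) auto
          also have "\<dots> \<le> pi" using th pi_approx(1) by simp
          finally show "\<bar>(real l - real m) * \<theta> * v j\<bar> \<le> pi" .
        qed
        also have "\<dots> \<le> e"
        proof -
          have "1\<^sup>2 \<le> \<bar>real l - real m\<bar>\<^sup>2" using d by (intro power_mono) auto
          then have "1 * \<theta>\<^sup>2 \<le> (real l - real m)\<^sup>2 * \<theta>\<^sup>2" by (intro mult_right_mono) auto
          then have "\<theta>\<^sup>2 \<le> ((real l - real m) * \<theta>)\<^sup>2" by (simp add: power_mult_distrib)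
          then have "p / 16 * \<theta>\<^sup>2 * (\<Sum>j\<in>J. (v j)\<^sup>2) \<le> p / 16 * ((real l - real m) * \<theta>)\<^sup>2 * (\<Sum>j\<in>J. (v j)\<^sup>2)"
            using p by (intro mult_right_mono mult_left_mono sum_nonneg) auto
          then show ?thesis unfolding e_def by simp
        qed
        finally show ?thesis using False by simp
      qed
    qed
    also have "\<dots> = real Q + (real Q)\<^sup>2 * e"
      by (simp add: sum.distrib power2_eq_square algebra_simps)
    finally have "\<bar>bexp (\<lambda>_. p) J (\<lambda>S. F (ssum S v))\<bar> \<le> real Q + (real Q)\<^sup>2 * e" by (simp only: norm_of_real)
    then show ?thesis by linarith
  qed
  have "bexp (\<lambda>_. p) J (\<lambda>S. of_bool (\<bar>ssum S v\<bar> \<le> R)) \<le> bexp (\<lambda>_. p) J (\<lambda>S. 4 / (real Q)\<^sup>2 * F (ssum S v))"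
    using p01 F by (intro bexp_mono) auto
  also have "\<dots> = 4 / (real Q)\<^sup>2 * bexp (\<lambda>_. p) J (\<lambda>S. F (ssum S v))" by (rule bexp_cmult)
  also have "\<dots> \<le> 4 / (real Q)\<^sup>2 * (real Q + (real Q)\<^sup>2 * e)" by (rule mult_left_mono[OF FE]) simp
  also have "\<dots> = 4 / real Q + 4 * e" using Q by (simp add: field_simps power2_eq_square)
  finally show ?thesis by (simp only: e_def \<theta>_def)
qed

text \<open>Q is fixed so that 4 / Q \<le> \<eta> / 2. With R equal to t times the l2 norm, the
  exponent in the kernel estimate becomes - c / t^2, free of v and J, so one small t serves all
  vectors. The condition that this radius is at least 1, the bound on the entries, rules out a
  dominant coordinate.\<close>

lemma ex_small_ball_radius:
  fixes \<eta> p :: real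
  assumes p: "0 < p" "p \<le> 1 / 2" and \<eta>: "\<eta> > 0"
  shows "\<exists>t>0. \<forall>J (v :: nat \<Rightarrow> real). finite J \<longrightarrow> (\<forall>j\<in>J. \<bar>v j\<bar> \<le> 1) \<longrightarrow> t * sqrt (\<Sum>j\<in>J. (v j)\<^sup>2) \<ge> 1 \<longrightarrow>
     bexp (\<lambda>_. p) J (\<lambda>S. of_bool (\<bar>ssum S v\<bar> \<le> t * sqrt (\<Sum>j\<in>J. (v j)\<^sup>2))) \<le> \<eta>"
proof -
  define Q where "Q = nat \<lceil>8 / \<eta>\<rceil>"
  have Q1: "8 / \<eta> \<le> real Q" unfolding Q_def by (rule real_nat_ceiling_ge)
  moreover have "8 / \<eta> > 0" using \<eta> by simp
  ultimately have "real Q > 0" by linarith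
  then have Q: "real Q \<ge> 8 / \<eta>" "Q > 0" using Q1 by simp_all
  have Q4: "4 / real Q \<le> \<eta> / 2" using Q \<eta> by (simp add: field_simps)
  define c where "c = p / (16 * (real Q)\<^sup>2)"
  have c: "c > 0" using p Q by (simp add: c_def)
  have "eventually (\<lambda>t. 4 * exp (- c / t\<^sup>2) < \<eta> / 2) (at_right (0::real))"
    using c \<eta> by real_asymp
  then obtain b where b: "b > 0" "\<And>t. 0 < t \<Longrightarrow> t < b \<Longrightarrow> 4 * exp (- c / t\<^sup>2) < \<eta> / 2"
    unfolding eventually_at_right_field by auto
  define t where "t = b / 2"
  have t: "t > 0" "4 * exp (- c / t\<^sup>2) < \<eta> / 2" using b by (auto simp: t_def)
  show ?thesis
  proof (intro exI[of _ t] conjI t(1) allI impI)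
    fix J and v :: "nat \<Rightarrow> real"
    assume J: "finite J" "\<forall>j\<in>J. \<bar>v j\<bar> \<le> 1" "t * sqrt (\<Sum>j\<in>J. (v j)\<^sup>2) \<ge> 1"
    define s where "s = (\<Sum>j\<in>J. (v j)\<^sup>2)"
    have s0: "s > 0"
    proof (rule ccontr)
      assume "\<not> s > 0"
      moreover have "s \<ge> 0" unfolding s_def by (intro sum_nonneg) simp
      ultimately have "s = 0" by linarith
      then show False using J(3) by (simp add: s_def)
    qed
    have "bexp (\<lambda>_. p) J (\<lambda>S. of_bool (\<bar>ssum S v\<bar> \<le> t * sqrt s))
      \<le> 4 / real Q + 4 * exp (- p / 16 * (1 / (real Q * (t * sqrt s)))\<^sup>2 * s)"
      unfolding s_def by (rule small_ball_fejer[OF J(1) _ p(2) _ Q(2) J(3)]) (use p J in auto)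
    also have "- p / 16 * (1 / (real Q * (t * sqrt s)))\<^sup>2 * s = - c / t\<^sup>2"
      using s0 t Q by (simp add: c_def power_divide power_mult_distrib)
    finally have "bexp (\<lambda>_. p) J (\<lambda>S. of_bool (\<bar>ssum S v\<bar> \<le> t * sqrt s)) \<le> \<eta>" using Q4 t(2) by linarith
    then show "bexp (\<lambda>_. p) J (\<lambda>S. of_bool (\<bar>ssum S v\<bar> \<le> t * sqrt (\<Sum>j\<in>J. (v j)\<^sup>2))) \<le> \<eta>" by (simp only: s_def)
  qed
qed

text \<open>Weigh a bad row by \<eta> and a good one by 1. With at most \<eta> card I bad rows the
  product of the weights is at least \<eta> to the power \<eta> card I, so a compensating factor
  \<open>\<eta> powr (- \<eta>)\<close> per row dominates the indicator by a product over
  independent rows. This factor tends to 1 as \<eta> tends to 0; it accounts for the choice of the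
  set of bad rows.\<close>

lemma mexp_few_bad_rows_le:
  fixes I :: "'i set" and G :: "'a set \<Rightarrow> bool"
  assumes I: "finite I" and J: "finite J" and p: "0 \<le> p" "p \<le> 1" and \<eta>: "0 < \<eta>" "\<eta> < 1"
    and G: "bexp (\<lambda>_. p) J (\<lambda>S. of_bool (G S)) \<le> \<omega>"
  shows "mexp (\<lambda>_. p) I J (\<lambda>B. of_bool (real (card {i\<in>I. \<not> G (B i)}) \<le> \<eta> * real (card I)))
    \<le> (\<eta> powr (- \<eta>) * (\<omega> + \<eta>)) ^ card I"
proof -
  have "mexp (\<lambda>_. p) I J (\<lambda>B. of_bool (real (card {i\<in>I. \<not> G (B i)}) \<le> \<eta> * real (card I)))
    \<le> mexp (\<lambda>_. p) I J (\<lambda>B. \<Prod>i\<in>I. \<eta> powr (- \<eta>) * (of_bool (G (B i)) + \<eta>))"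
  proof (rule mexp_mono)
    fix B :: "'i \<Rightarrow> 'a set"
    let ?b = "card {i\<in>I. \<not> G (B i)}"
    show "of_bool (real ?b \<le> \<eta> * real (card I)) \<le> (\<Prod>i\<in>I. \<eta> powr (- \<eta>) * (of_bool (G (B i)) + \<eta>))"
    proof (cases "real ?b \<le> \<eta> * real (card I)")
      case True
      have "\<eta> powr (\<eta> * real (card I)) \<le> \<eta> powr real ?b" using \<eta> True by (intro powr_mono') auto
      also have "\<dots> = (\<Prod>i\<in>I. if \<not> G (B i) then \<eta> else 1)"
        using I \<eta> by (simp add: powr_realpow prod.If_cases Int_def)
      also have "\<dots> \<le> (\<Prod>i\<in>I. of_bool (G (B i)) + \<eta>)" using \<eta> by (intro prod_mono) auto
      finally have le: "\<eta> powr (\<eta> * real (card I)) \<le> (\<Prod>i\<in>I. of_bool (G (B i)) + \<eta>)" .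
      have "(\<eta> powr (- \<eta>)) ^ card I = \<eta> powr (- (\<eta> * real (card I)))"
        using \<eta> by (simp add: powr_realpow[symmetric] powr_powr)
      then have "1 = (\<eta> powr (- \<eta>)) ^ card I * \<eta> powr (\<eta> * real (card I))" using \<eta> by (simp flip: powr_add)
      also have "\<dots> \<le> (\<eta> powr (- \<eta>)) ^ card I * (\<Prod>i\<in>I. of_bool (G (B i)) + \<eta>)" by (intro mult_left_mono le) simp
      finally show ?thesis using True by (simp add: prod.distrib)
    next
      case False
      have "0 \<le> (\<Prod>i\<in>I. \<eta> powr (- \<eta>) * (of_bool (G (B i)) + \<eta>))" using \<eta> by (intro prod_nonneg) auto
      then show ?thesis using False by simp
    qed
  qed (use p in auto)
  also have "\<dots> = (\<eta> powr (- \<eta>) * (bexp (\<lambda>_. p) J (\<lambda>S. of_bool (G S)) + \<eta>)) ^ card I"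
    by (subst mexp_prod) (simp_all only: I J bexp_cmult bexp_add bexp_const prod_constant)
  also have "\<dots> \<le> (\<eta> powr (- \<eta>) * (\<omega> + \<eta>)) ^ card I"
  proof (intro power_mono mult_left_mono add_right_mono G)
    have "0 \<le> bexp (\<lambda>_. p) J (\<lambda>S. of_bool (G S) :: real)" using p by (intro bexp_nonneg) auto
    then show "0 \<le> \<eta> powr (- \<eta>) * (bexp (\<lambda>_. p) J (\<lambda>S. of_bool (G S)) + \<eta>)" using \<eta> by simp
  qed simp
  finally show ?thesis .
qed

text \<open>Either all vectors of the system have bounded norm, and the triangular structure applies, or one of them
  has a large norm, hence no dominant coordinates, and is not concentrated at all.\<close>

lemma tri_system_small_ball:
  fixes p \<eta> t N D :: real
  assumes p: "0 < p" "p \<le> 1 / 2" and J: "finite J" and tri: "tri_system J k u f" and t: "t > 0" and D: "D > 0"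
    and N: "N = 8 * D / t" and \<eta>: "\<eta> \<ge> 0"
    and ball: "\<And>v :: nat \<Rightarrow> real. (\<forall>j\<in>J. \<bar>v j\<bar> \<le> 1) \<Longrightarrow> t * sqrt (\<Sum>j\<in>J. (v j)\<^sup>2) \<ge> 1 \<Longrightarrow>
     bexp (\<lambda>_. p) J (\<lambda>S. of_bool (\<bar>ssum S v\<bar> \<le> t * sqrt (\<Sum>j\<in>J. (v j)\<^sup>2))) \<le> \<eta>"
  shows "bexp (\<lambda>_. p) J (\<lambda>S. of_bool (\<forall>i<k. \<bar>ssum S (u i)\<bar> \<le> 2 * D / N * sqrt (\<Sum>j\<in>J. (u i j)\<^sup>2))) \<le> (1 - p) ^ k + \<eta>"
proof -
  define \<Lambda> where "\<Lambda> i = sqrt (\<Sum>j\<in>J. (u i j)\<^sup>2)" for i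
  \<comment> \<open>The radius is t / 4 times the norm: less than 1/2 if t times the norm is below
    1, and within the small ball radius in any case.\<close>
  have DN: "2 * D / N = t / 4" using t D by (simp add: N)
  have \<Lambda>0: "\<Lambda> i \<ge> 0" for i by (simp add: \<Lambda>_def sum_nonneg)
  have p01: "0 \<le> p \<and> p \<le> 1" using p by auto
  show ?thesis
  proof (cases "\<exists>i<k. t * \<Lambda> i \<ge> 1")
    case True
    then obtain i where i: "i < k" "t * \<Lambda> i \<ge> 1" by blast
    have "bexp (\<lambda>_. p) J (\<lambda>S. of_bool (\<forall>i<k. \<bar>ssum S (u i)\<bar> \<le> 2 * D / N * \<Lambda> i) :: real)
      \<le> bexp (\<lambda>_. p) J (\<lambda>S. of_bool (\<bar>ssum S (u i)\<bar> \<le> t * \<Lambda> i))"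
    proof (rule bexp_mono)
      fix S
      have "t / 4 * \<Lambda> i \<le> t * \<Lambda> i" using t \<Lambda>0[of i] by (intro mult_right_mono) auto
      then show "of_bool (\<forall>i<k. \<bar>ssum S (u i)\<bar> \<le> 2 * D / N * \<Lambda> i) \<le> (of_bool (\<bar>ssum S (u i)\<bar> \<le> t * \<Lambda> i) :: real)"
        unfolding DN using i(1) by (auto simp: of_bool_def) 
    qed (use p01 in auto)
    also have "\<dots> \<le> \<eta>" unfolding \<Lambda>_def using tri i by (intro ball) (auto simp: tri_system_def \<Lambda>_def)
    finally show ?thesis using p by (simp add: \<Lambda>_def add_increasing)
  next
    case False
    have "bexp (\<lambda>_. p) J (\<lambda>S. of_bool (\<forall>i<k. \<bar>ssum S (u i)\<bar> \<le> 2 * D / N * \<Lambda> i) :: real)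
      \<le> bexp (\<lambda>_. p) J (\<lambda>S. of_bool (\<forall>i<k. \<bar>ssum S (u i)\<bar> < 1 / 2))"
    proof (rule bexp_mono)
      fix S
      have "t / 4 * \<Lambda> i < 1 / 2" if "i < k" for i using False that by (auto simp: not_le)
      then have "(\<forall>i<k. \<bar>ssum S (u i)\<bar> \<le> t / 4 * \<Lambda> i) \<longrightarrow> (\<forall>i<k. \<bar>ssum S (u i)\<bar> < 1 / 2)"
        by (meson le_less_trans)
      then show "of_bool (\<forall>i<k. \<bar>ssum S (u i)\<bar> \<le> 2 * D / N * \<Lambda> i) \<le> (of_bool (\<forall>i<k. \<bar>ssum S (u i)\<bar> < 1 / 2) :: real)"
        unfolding DN of_bool_less_eq_iff .
    qed (use p01 in auto)
    also have "\<dots> \<le> (1 - p) ^ k" using p by (intro tri_system_prob[OF J _ _ tri]) auto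
    finally show ?thesis using \<eta> by (simp add: \<Lambda>_def)
  qed
qed

text \<open>The last clause is the homogeneous form of an l1 norm at most \<kappa> n after scaling
  to l2 norm sqrt n, hence the opposite of being spread, up to equality.\<close>

definition flat_system :: "nat \<Rightarrow> nat \<Rightarrow> real \<Rightarrow> nat set \<Rightarrow> (nat \<Rightarrow> nat set) \<Rightarrow> bool" where
  "flat_system n k \<kappa> I B \<longleftrightarrow> (\<exists>u f. tri_system {..<n} k u f \<and> (\<forall>i<k. \<forall>r\<in>I. ssum (B r) (u i) = 0)
     \<and> (\<forall>i<k. (\<Sum>j<n. \<bar>u i j\<bar>) * sqrt (real n) \<le> \<kappa> * real n * sqrt (\<Sum>j<n. (u i j)\<^sup>2)))"

text \<open>Each vector is scaled to l2 norm N sqrt n and rounded; flatness bounds the l1 norm of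
  the result by 4 N \<kappa> n. The rounding error on a random column has mean square at most n, so
  by Chebyshev it exceeds D sqrt n with probability at most 1 / D^2; likewise, per vector, at most
  card I / D^2 of the given columns see a large value. Undoing the scaling turns 2 D sqrt n into 2 D
  / N times the norm, the radius in the dichotomy for triangular systems.\<close>

lemma flat_system_rounding:
  fixes p \<eta> t N D \<kappa> :: real
  assumes p: "0 < p" "p \<le> 1 / 2" and t: "t > 0" and D: "D > 0" "real k / D\<^sup>2 \<le> \<eta>" and n: "n > 0"
    and N: "N = 8 * D / t" and \<eta>: "\<eta> \<ge> 0" and I: "finite I" "I \<noteq> {}"
    and B: "B \<in> PiE I (\<lambda>_. Pow {..<n})" and fs: "flat_system n k \<kappa> I B"
    and ball: "\<And>v :: nat \<Rightarrow> real. (\<forall>j\<in>{..<n}. \<bar>v j\<bar> \<le> 1) \<Longrightarrow> t * sqrt (\<Sum>j\<in>{..<n}. (v j)\<^sup>2) \<ge> 1 \<Longrightarrow>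
     bexp (\<lambda>_. p) {..<n} (\<lambda>S. of_bool (\<bar>ssum S v\<bar> \<le> t * sqrt (\<Sum>j\<in>{..<n}. (v j)\<^sup>2))) \<le> \<eta>"
  shows "\<exists>w\<in>PiE {..<k} (\<lambda>_. {w\<in>extensional {..<n}. (\<Sum>j<n. \<bar>w j\<bar>) \<le> int (nat \<lfloor>4 * N * \<kappa> * real n\<rfloor>)}).
     bexp (\<lambda>_. p) {..<n} (\<lambda>S. of_bool (\<forall>i<k. \<bar>ssum S (\<lambda>j. real_of_int (w i j))\<bar> \<le> D * sqrt (real n))) \<le> (1 - p) ^ k + 2 * \<eta>
     \<and> real (card {r\<in>I. \<not> (\<forall>i<k. \<bar>ssum (B r) (\<lambda>j. real_of_int (w i j))\<bar> \<le> D * sqrt (real n))}) \<le> \<eta> * real (card I)"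
proof -
  obtain u f where tri: "tri_system {..<n} k u f" and ker: "\<And>i r. i < k \<Longrightarrow> r \<in> I \<Longrightarrow> ssum (B r) (u i) = 0"
    and flat: "\<And>i. i < k \<Longrightarrow> (\<Sum>j<n. \<bar>u i j\<bar>) * sqrt (real n) \<le> \<kappa> * real n * sqrt (\<Sum>j<n. (u i j)\<^sup>2)"
    using fs unfolding flat_system_def by blast
  have p01: "0 \<le> p" "p \<le> 1" using p by auto
  have N0: "N > 0" using t D by (simp add: N)
  define \<Lambda> where "\<Lambda> i = sqrt (\<Sum>j<n. (u i j)\<^sup>2)" for i
  define c where "c i = N * sqrt (real n) / \<Lambda> i" for i
  have \<Lambda>: "\<Lambda> i > 0" if i: "i < k" for i
  proof -
    have f: "f i < n" "u i (f i) = 1" using tri i by (auto simp: tri_system_def)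
    have "(u i (f i))\<^sup>2 \<le> (\<Sum>j<n. (u i j)\<^sup>2)" using f by (intro member_le_sum) auto
    then show ?thesis using f by (simp add: \<Lambda>_def)
  qed
  have c: "c i > 0" if i: "i < k" for i using \<Lambda>[OF i] N0 n by (simp add: c_def)
  \<comment> \<open>The properties of a rounding for the constant weight 1, so that the error is
    measured under the law of a fresh random column.\<close>
  define Pw where "Pw i w \<longleftrightarrow> (\<forall>j. \<bar>real_of_int (w j) - c i * u i j\<bar> \<le> 1)
     \<and> (\<Sum>r\<in>I. (ssum (B r) (\<lambda>j. real_of_int (w j)))\<^sup>2) \<le> real (card I) * real (card {..<n})
     \<and> bexp (\<lambda>_. p) {..<n} (\<lambda>S. 1 * (ssum S (\<lambda>j. real_of_int (w j) - c i * u i j))\<^sup>2) \<le> real (card {..<n}) * bexp (\<lambda>_. p) {..<n} (\<lambda>_. 1)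
     \<and> (\<Sum>j\<in>{..<n}. \<bar>real_of_int (w j)\<bar>) \<le> 4 * (\<Sum>j\<in>{..<n}. \<bar>c i * u i j\<bar>)" for i and w :: "nat \<Rightarrow> int"
  have exw: "\<exists>w. Pw i w" if i: "i < k" for i
    unfolding Pw_def
  proof (rule ex_rounding[OF finite_lessThan I p01])
    show "\<exists>j\<in>{..<n}. c i * u i j \<noteq> 0"
      using tri i c[OF i] by (intro bexI[of _ "f i"]) (auto simp: tri_system_def)
    show "ssum (B r) (\<lambda>j. c i * u i j) = 0" if "r \<in> I" for r unfolding ssum_cmult using ker[OF i that] by simp
  qed (use B in \<open>auto simp: bexp_const\<close>)
  define w' where "w' i = (SOME w. Pw i w)" for i
  have Pw: "Pw i (w' i)" if "i < k" for i unfolding w'_def by (rule someI_ex[OF exw[OF that]])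
  have w1: "(\<Sum>r\<in>I. (ssum (B r) (\<lambda>j. real_of_int (w' i j)))\<^sup>2) \<le> real (card I) * real n"
    and w2: "bexp (\<lambda>_. p) {..<n} (\<lambda>S. (ssum S (\<lambda>j. real_of_int (w' i j) - c i * u i j))\<^sup>2) \<le> real n"
    and w3: "(\<Sum>j<n. \<bar>real_of_int (w' i j)\<bar>) \<le> 4 * (\<Sum>j<n. \<bar>c i * u i j\<bar>)" if "i < k" for i
    using Pw[OF that] by (simp_all add: Pw_def bexp_const)
  define w where "w = (\<lambda>i\<in>{..<k}. restrict (w' i) {..<n})"
  have ws: "ssum S (\<lambda>j. real_of_int (w i j)) = ssum S (\<lambda>j. real_of_int (w' i j))" if "i < k" "S \<subseteq> {..<n}" for i S
    using that by (simp only: w_def restrict_apply' lessThan_iff ssum_restrict)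
  have mem: "w \<in> PiE {..<k} (\<lambda>_. {w\<in>extensional {..<n}. (\<Sum>j<n. \<bar>w j\<bar>) \<le> int (nat \<lfloor>4 * N * \<kappa> * real n\<rfloor>)})"
  proof (rule PiE_I)
    fix i assume i: "i \<in> {..<k}"
    have "(\<Sum>j<n. \<bar>real_of_int (w' i j)\<bar>) \<le> 4 * (\<Sum>j<n. \<bar>c i * u i j\<bar>)" using w3 i by simp
    also have "(\<Sum>j<n. \<bar>c i * u i j\<bar>) = c i * (\<Sum>j<n. \<bar>u i j\<bar>)"
      using abs_of_pos[OF c[of i]] i by (simp add: abs_mult sum_distrib_left)
    also have "\<dots> = N / \<Lambda> i * ((\<Sum>j<n. \<bar>u i j\<bar>) * sqrt (real n))" by (simp add: c_def)
    also have "\<dots> \<le> N / \<Lambda> i * (\<kappa> * real n * \<Lambda> i)"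
      using flat[of i] i N0 \<Lambda>[of i] unfolding \<Lambda>_def[symmetric] by (intro mult_left_mono) auto
    also have "\<dots> = N * \<kappa> * real n" using \<Lambda>[of i] i by simp
    finally have "real_of_int (\<Sum>j<n. \<bar>w' i j\<bar>) \<le> 4 * N * \<kappa> * real n" by simp
    then have "(\<Sum>j<n. \<bar>w' i j\<bar>) \<le> \<lfloor>4 * N * \<kappa> * real n\<rfloor>" by (simp only: le_floor_iff)
    then have "(\<Sum>j<n. \<bar>w' i j\<bar>) \<le> int (nat \<lfloor>4 * N * \<kappa> * real n\<rfloor>)" by linarith
    then show "w i \<in> {w\<in>extensional {..<n}. (\<Sum>j<n. \<bar>w j\<bar>) \<le> int (nat \<lfloor>4 * N * \<kappa> * real n\<rfloor>)}"
      using i by (simp add: w_def)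
  qed (simp add: w_def)
  have Dn: "D * sqrt (real n) > 0" using D n by simp
  have cheb: "bexp (\<lambda>_. p) {..<n} (\<lambda>S. of_bool (\<bar>ssum S (\<lambda>j. real_of_int (w' i j) - c i * u i j)\<bar> > D * sqrt (real n))) \<le> 1 / D\<^sup>2"
    if i: "i < k" for i
  proof -
    have "bexp (\<lambda>_. p) {..<n} (\<lambda>S. of_bool (\<bar>ssum S (\<lambda>j. real_of_int (w' i j) - c i * u i j)\<bar> > D * sqrt (real n)))
      \<le> bexp (\<lambda>_. p) {..<n} (\<lambda>S. 1 / (D\<^sup>2 * real n) * (ssum S (\<lambda>j. real_of_int (w' i j) - c i * u i j))\<^sup>2)"
    proof (rule bexp_mono)
      fix S
      let ?y = "ssum S (\<lambda>j. real_of_int (w' i j) - c i * u i j)"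
      show "of_bool (\<bar>?y\<bar> > D * sqrt (real n)) \<le> 1 / (D\<^sup>2 * real n) * ?y\<^sup>2"
      proof (cases "\<bar>?y\<bar> > D * sqrt (real n)")
        case True
        then have "(D * sqrt (real n))\<^sup>2 \<le> \<bar>?y\<bar>\<^sup>2" using Dn by (intro power_mono) auto
        then have "D\<^sup>2 * real n \<le> ?y\<^sup>2" by (simp add: power_mult_distrib)
        then show ?thesis using True D n by (simp add: field_simps)
      qed simp
    qed (use p01 in auto)
    also have "\<dots> \<le> 1 / (D\<^sup>2 * real n) * real n" unfolding bexp_cmult by (intro mult_left_mono w2[OF i]) simp
    also have "\<dots> = 1 / D\<^sup>2" using n by simp
    finally show ?thesis .
  qed
  have "bexp (\<lambda>_. p) {..<n} (\<lambda>S. of_bool (\<forall>i<k. \<bar>ssum S (\<lambda>j. real_of_int (w i j))\<bar> \<le> D * sqrt (real n)) :: real)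
    \<le> bexp (\<lambda>_. p) {..<n} (\<lambda>S. of_bool (\<forall>i<k. \<bar>ssum S (u i)\<bar> \<le> 2 * D / N * sqrt (\<Sum>j\<in>{..<n}. (u i j)\<^sup>2))
        + (\<Sum>i<k. of_bool (\<bar>ssum S (\<lambda>j. real_of_int (w' i j) - c i * u i j)\<bar> > D * sqrt (real n))))"
  proof (rule bexp_mono)
    fix S assume S: "S \<subseteq> {..<n}"
    let ?e = "\<lambda>i. \<bar>ssum S (\<lambda>j. real_of_int (w' i j) - c i * u i j)\<bar> > D * sqrt (real n)"
    let ?A = "\<forall>i<k. \<bar>ssum S (\<lambda>j. real_of_int (w i j))\<bar> \<le> D * sqrt (real n)"
    let ?C = "\<forall>i<k. \<bar>ssum S (u i)\<bar> \<le> 2 * D / N * sqrt (\<Sum>j\<in>{..<n}. (u i j)\<^sup>2)"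
    show "of_bool ?A \<le> of_bool ?C + (\<Sum>i<k. of_bool (?e i) :: real)"
    proof (cases "\<exists>i<k. ?e i")
      case True
      then obtain i where "i < k" "?e i" by blast
      then have "1 \<le> (\<Sum>i<k. of_bool (?e i) :: real)"
        using member_le_sum[of i "{..<k}" "\<lambda>i. of_bool (?e i) :: real"] by auto
      then show ?thesis by (auto simp: of_bool_def)
    next
      case False
      have "?C" if A: ?A
      proof (intro allI impI)
        fix i assume i: "i < k"
        have "ssum S (\<lambda>j. real_of_int (w' i j) - c i * u i j) = ssum S (\<lambda>j. real_of_int (w i j)) - c i * ssum S (u i)"
          unfolding ws[OF i S] by (simp only: ssum_diff ssum_cmult)
        then have "\<bar>c i * ssum S (u i)\<bar> \<le> 2 * D * sqrt (real n)" using A False i by fastforce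
        then have "c i * \<bar>ssum S (u i)\<bar> \<le> 2 * D * sqrt (real n)" using c[OF i] by (simp add: abs_mult)
        then have "\<bar>ssum S (u i)\<bar> \<le> 2 * D * sqrt (real n) / c i" using c[OF i] by (simp add: field_simps)
        also have "\<dots> = 2 * D / N * \<Lambda> i" using \<Lambda>[OF i] N0 n by (simp add: c_def)
        finally show "\<bar>ssum S (u i)\<bar> \<le> 2 * D / N * sqrt (\<Sum>j\<in>{..<n}. (u i j)\<^sup>2)" by (simp only: \<Lambda>_def)
      qed
      then show ?thesis by (auto simp: of_bool_def intro!: sum_nonneg add_nonneg_nonneg)
    qed
  qed (use p01 in auto)
  also have "\<dots> \<le> ((1 - p) ^ k + \<eta>) + (\<Sum>i<k. 1 / D\<^sup>2)"
    unfolding bexp_add bexp_sum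
    using tri_system_small_ball[OF p finite_lessThan tri t D(1) N \<eta> ball] cheb
    by (intro add_mono sum_mono) auto
  also have "\<dots> \<le> (1 - p) ^ k + 2 * \<eta>" using D(2) by simp
  finally have r1: "bexp (\<lambda>_. p) {..<n} (\<lambda>S. of_bool (\<forall>i<k. \<bar>ssum S (\<lambda>j. real_of_int (w i j))\<bar> \<le> D * sqrt (real n))) \<le> (1 - p) ^ k + 2 * \<eta>" .
  have r2: "real (card {r\<in>I. \<not> (\<forall>i<k. \<bar>ssum (B r) (\<lambda>j. real_of_int (w i j))\<bar> \<le> D * sqrt (real n))}) \<le> \<eta> * real (card I)"
  proof -
    let ?b = "\<lambda>i. {r\<in>I. \<bar>ssum (B r) (\<lambda>j. real_of_int (w' i j))\<bar> > D * sqrt (real n)}"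
    have bi: "real (card (?b i)) \<le> real (card I) / D\<^sup>2" if i: "i < k" for i
    proof -
      have "real (card (?b i)) * (D\<^sup>2 * real n) = (\<Sum>r\<in>?b i. (D * sqrt (real n))\<^sup>2)" by (simp add: power_mult_distrib)
      also have "\<dots> \<le> (\<Sum>r\<in>?b i. \<bar>ssum (B r) (\<lambda>j. real_of_int (w' i j))\<bar>\<^sup>2)"
        using Dn by (intro sum_mono power_mono) auto
      also have "\<dots> \<le> (\<Sum>r\<in>I. (ssum (B r) (\<lambda>j. real_of_int (w' i j)))\<^sup>2)" using I by (simp, intro sum_mono2) auto
      also have "\<dots> \<le> real (card I) * real n" by (rule w1[OF i])
      finally show ?thesis using D n by (simp add: field_simps)
    qed
    have "{r\<in>I. \<not> (\<forall>i<k. \<bar>ssum (B r) (\<lambda>j. real_of_int (w i j))\<bar> \<le> D * sqrt (real n))} \<subseteq> (\<Union>i<k. ?b i)"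
    proof
      fix r assume r: "r \<in> {r\<in>I. \<not> (\<forall>i<k. \<bar>ssum (B r) (\<lambda>j. real_of_int (w i j))\<bar> \<le> D * sqrt (real n))}"
      then obtain i where i: "i < k" "\<bar>ssum (B r) (\<lambda>j. real_of_int (w i j))\<bar> > D * sqrt (real n)" by (auto simp: not_le)
      have "B r \<subseteq> {..<n}" using B r by auto
      then have "r \<in> ?b i" using i r ws[OF i(1)] by simp
      then show "r \<in> (\<Union>i<k. ?b i)" using i by blast
    qed
    then have "card {r\<in>I. \<not> (\<forall>i<k. \<bar>ssum (B r) (\<lambda>j. real_of_int (w i j))\<bar> \<le> D * sqrt (real n))} \<le> card (\<Union>i<k. ?b i)"
      using I by (intro card_mono) auto
    also have "\<dots> \<le> (\<Sum>i<k. card (?b i))" by (intro card_UN_le) simp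
    finally have "real (card {r\<in>I. \<not> (\<forall>i<k. \<bar>ssum (B r) (\<lambda>j. real_of_int (w i j))\<bar> \<le> D * sqrt (real n))}) \<le> (\<Sum>i<k. real (card (?b i)))"
      by (simp flip: of_nat_sum)
    also have "\<dots> \<le> (\<Sum>i<k. real (card I) / D\<^sup>2)" using bi by (intro sum_mono) auto
    also have "\<dots> = real k / D\<^sup>2 * real (card I)" by simp
    also have "\<dots> \<le> \<eta> * real (card I)" using D(2) by (intro mult_right_mono) auto
    finally show ?thesis .
  qed
  show ?thesis using mem r1 r2 by blast
qed

text \<open>The order of the choices matters: \<eta> depends on \<epsilon>, then D, t and the scale
  N on \<eta>, and \<kappa> comes last. Thus it can be so small that the k-tuples of integer points
  of l1 norm at most 4 N \<kappa> n number at most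
  \<open>(1 + e2) ^ n * (1 + e2) ^ n\<close>.\<close>

theorem flat_systems_rare:
  fixes p \<epsilon> :: real
  assumes p: "0 < p" "p \<le> 1 / 2" and \<epsilon>: "0 < \<epsilon>"
  shows "\<exists>\<kappa>. 0 < \<kappa> \<and> \<kappa> \<le> 1 \<and> eventually (\<lambda>n. \<forall>I :: nat set. finite I \<longrightarrow> card I = n - k \<longrightarrow>
     mexp (\<lambda>_. p) I {..<n} (\<lambda>B. of_bool (flat_system n k \<kappa> I B)) \<le> ((1 - p) ^ k + \<epsilon>) ^ n) at_top"
proof -
  define a where "a = (1 - p) ^ k"
  have a: "0 < a" "a \<le> 1" using p by (auto simp: a_def power_le_one)
  define e1 where "e1 = min \<epsilon> 1 / 3"
  have e1: "0 < e1" "3 * e1 \<le> \<epsilon>" "e1 \<le> 1 / 3" using \<epsilon> by (auto simp: e1_def)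
  \<comment> \<open>As (1 + e2)^2 \<le> 1 + 3 e2 and a + e1 \<le> 2, counting the tuples raises a +
    e1 to at most a + 6 e2 + e1 = a + 2 e1.\<close>
  define e2 where "e2 = e1 / 6"
  have e2: "0 < e2" "e2 \<le> 1" using e1 by (auto simp: e2_def)
  have "((\<lambda>\<eta>. \<eta> powr (- \<eta>) * (a + 3 * \<eta>)) \<longlongrightarrow> a) (at_right 0)" by real_asymp
  then have "eventually (\<lambda>\<eta>. \<eta> powr (- \<eta>) * (a + 3 * \<eta>) < a + e1) (at_right 0)"
    by (rule order_tendstoD(2)) (use e1 in simp)
  then obtain b where b: "b > 0" "\<And>\<eta>. 0 < \<eta> \<Longrightarrow> \<eta> < b \<Longrightarrow> \<eta> powr (- \<eta>) * (a + 3 * \<eta>) < a + e1"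
    unfolding eventually_at_right_field by auto
  define \<eta> where "\<eta> = min (b / 2) (1 / 2)"
  have \<eta>: "0 < \<eta>" "\<eta> < 1" "\<eta> < b" using b(1) by (auto simp: \<eta>_def)
  have F: "\<eta> powr (- \<eta>) * (a + 3 * \<eta>) \<le> a + e1" using b(2)[OF \<eta>(1,3)] by simp
  define D where "D = 1 + real k / \<eta>"
  have D: "D \<ge> 1" "real k / D\<^sup>2 \<le> \<eta>"
  proof -
    show D1: "D \<ge> 1" using \<eta> by (simp add: D_def)
    have "real k / \<eta> \<le> D * 1" by (simp add: D_def)
    also have "\<dots> \<le> D * D" using D1 by (intro mult_left_mono) auto
    finally have "real k / \<eta> \<le> D\<^sup>2" by (simp add: power2_eq_square)
    then show "real k / D\<^sup>2 \<le> \<eta>" using \<eta> D1 by (simp add: field_simps)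
  qed
  obtain t where t: "t > 0" and ball: "\<forall>J (v :: nat \<Rightarrow> real). finite J \<longrightarrow> (\<forall>j\<in>J. \<bar>v j\<bar> \<le> 1) \<longrightarrow> t * sqrt (\<Sum>j\<in>J. (v j)\<^sup>2) \<ge> 1 \<longrightarrow>
     bexp (\<lambda>_. p) J (\<lambda>S. of_bool (\<bar>ssum S v\<bar> \<le> t * sqrt (\<Sum>j\<in>J. (v j)\<^sup>2))) \<le> \<eta>"
    using ex_small_ball_radius[OF p \<eta>(1)] by blast
  define N where "N = 8 * D / t"
  have N: "N > 0" using D t by (simp add: N_def)
  have "((\<lambda>x::real. (1 + 4 * x) ^ k) \<longlongrightarrow> (1 + 4 * 0) ^ k) (at_right 0)" by (intro tendsto_intros)
  then have "eventually (\<lambda>x::real. (1 + 4 * x) ^ k < 1 + e2) (at_right 0)"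
    by (rule order_tendstoD(2)) (use e2 in simp)
  then obtain b' where b': "b' > 0" "\<And>x. 0 < x \<Longrightarrow> x < b' \<Longrightarrow> (1 + 4 * x) ^ k < 1 + e2"
    unfolding eventually_at_right_field by auto
  define x where "x = min (b' / 2) (1 / 2)"
  have x: "0 < x" "x \<le> 1 / 2" "(1 + 4 * x) ^ k \<le> 1 + e2"
    using b'(1) b'(2)[of x] by (auto simp: x_def min_def split: if_splits)
  have "((\<lambda>\<kappa>::real. (1 / x) powr (4 * N * real k * \<kappa>)) \<longlongrightarrow> (1 / x) powr (4 * N * real k * 0)) (at_right 0)"
    using x by (intro tendsto_intros) auto
  then have "eventually (\<lambda>\<kappa>. (1 / x) powr (4 * N * real k * \<kappa>) < 1 + e2) (at_right 0)"
    by (rule order_tendstoD(2)) (use e2 x in simp)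
  then obtain b'' where b'': "b'' > 0" "\<And>\<kappa>. 0 < \<kappa> \<Longrightarrow> \<kappa> < b'' \<Longrightarrow> (1 / x) powr (4 * N * real k * \<kappa>) < 1 + e2"
    unfolding eventually_at_right_field by auto
  define \<kappa> where "\<kappa> = min (b'' / 2) 1"
  have \<kappa>: "0 < \<kappa>" "\<kappa> \<le> 1" "(1 / x) powr (4 * N * real k * \<kappa>) \<le> 1 + e2"
    using b''(1) b''(2)[of \<kappa>] by (auto simp: \<kappa>_def min_def split: if_splits)
  \<comment> \<open>Only n - k columns contribute. The missing factor \<open>(a + e1) ^ k\<close> is
    recovered for large n by passing from a + 2 e1 to a + 3 e1.\<close>
  define q where "q = (a + 2 * e1) / (a + 3 * e1)"
  have q: "0 < q" "q < 1" using a e1 by (auto simp: q_def)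
  have Fk: "0 < (a + e1) ^ k" using a e1 by simp
  have ev: "eventually (\<lambda>n::nat. q ^ n < (a + e1) ^ k) at_top"
    using LIMSEQ_realpow_zero[of q] q Fk by (intro order_tendstoD(2)) auto
  have "eventually (\<lambda>n. \<forall>I :: nat set. finite I \<longrightarrow> card I = n - k \<longrightarrow>
     mexp (\<lambda>_. p) I {..<n} (\<lambda>B. of_bool (flat_system n k \<kappa> I B)) \<le> ((1 - p) ^ k + \<epsilon>) ^ n) at_top"
    using ev eventually_gt_at_top[of k]
  proof eventually_elim
    case (elim n)
    show ?case
    proof (intro allI impI)
      fix I :: "nat set" assume I: "finite I" "card I = n - k"
      have n: "n > 0" "I \<noteq> {}" using elim(2) I by auto
      have p01: "0 \<le> p" "p \<le> 1" using p by auto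
      define K where "K = nat \<lfloor>4 * N * \<kappa> * real n\<rfloor>"
      let ?W = "{w\<in>extensional {..<n}. (\<Sum>j<n. \<bar>w j\<bar>) \<le> int K}"
      let ?G = "\<lambda>w S. \<forall>i<k. \<bar>ssum S (\<lambda>j. real_of_int (w i j))\<bar> \<le> D * sqrt (real n)"
      define X where "X = {w\<in>PiE {..<k} (\<lambda>_. ?W). bexp (\<lambda>_. p) {..<n} (\<lambda>S. of_bool (?G w S)) \<le> a + 2 * \<eta>}"
      have finW: "finite ?W" and cW: "real (card ?W) \<le> (1 / x) ^ K * (1 + 4 * x) ^ n"
        using card_l1_ball_le[OF finite_lessThan x(1,2), of n K] by simp_all
      have finP: "finite (PiE {..<k} (\<lambda>_. ?W))" using finW by (intro finite_PiE) auto
      then have finX: "finite X" by (simp add: X_def)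
      have "card X \<le> card (PiE {..<k} (\<lambda>_. ?W))" using finP by (intro card_mono) (auto simp: X_def)
      also have "\<dots> = card ?W ^ k" by (simp add: card_PiE)
      finally have "real (card X) \<le> real (card ?W ^ k)" by (rule of_nat_mono)
      also have "\<dots> = real (card ?W) ^ k" by (rule of_nat_power)
      also have "\<dots> \<le> ((1 / x) ^ K * (1 + 4 * x) ^ n) ^ k" using cW by (intro power_mono) auto
      also have "\<dots> = ((1 / x) ^ K) ^ k * ((1 + 4 * x) ^ k) ^ n"
      proof -
        have "((1 + 4 * x) ^ n) ^ k = ((1 + 4 * x) ^ k) ^ n" by (simp add: mult.commute flip: power_mult)
        with power_mult_distrib[of "(1 / x) ^ K" "(1 + 4 * x) ^ n" k] show ?thesis by (rule back_subst[where P = "\<lambda>z. _ = _ * z"])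
      qed
      also have "\<dots> \<le> (1 + e2) ^ n * (1 + e2) ^ n"
      proof (intro mult_mono)
        have "((1 / x) ^ K) ^ k = (1 / x) ^ (K * k)" by (rule power_mult[symmetric])
        also have "\<dots> = (1 / x) powr real (K * k)" using x by (intro powr_realpow[symmetric]) simp
        also have "\<dots> = (1 / x) powr (real K * real k)" by simp
        also have "\<dots> \<le> (1 / x) powr ((4 * N * \<kappa> * real n) * real k)"
          using x N \<kappa> by (intro powr_mono mult_right_mono) (auto simp: K_def)
        also have "\<dots> = ((1 / x) powr (4 * N * real k * \<kappa>)) powr real n" by (simp add: powr_powr mult_ac)
        also have "\<dots> = ((1 / x) powr (4 * N * real k * \<kappa>)) ^ n" using x by (simp add: powr_realpow)
        also have "\<dots> \<le> (1 + e2) ^ n" using \<kappa> by (intro power_mono) auto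
        finally show "((1 / x) ^ K) ^ k \<le> (1 + e2) ^ n" .
        show "((1 + 4 * x) ^ k) ^ n \<le> (1 + e2) ^ n" using x by (intro power_mono) auto
      qed (use e2 x in auto)
      finally have cX: "real (card X) \<le> (1 + e2) ^ n * (1 + e2) ^ n" .
      have "mexp (\<lambda>_. p) I {..<n} (\<lambda>B. of_bool (flat_system n k \<kappa> I B))
        \<le> (\<Sum>w\<in>X. mexp (\<lambda>_. p) I {..<n} (\<lambda>B. of_bool (real (card {r\<in>I. \<not> ?G w (B r)}) \<le> \<eta> * real (card I))))"
      proof (rule mexp_ex_le_sum[OF p01 finX])
        fix B assume B: "B \<in> PiE I (\<lambda>_. Pow {..<n})" and fs: "flat_system n k \<kappa> I B"
        have D0: "D > 0" using D by simp
        have "\<exists>w\<in>PiE {..<k} (\<lambda>_. {w\<in>extensional {..<n}. (\<Sum>j<n. \<bar>w j\<bar>) \<le> int (nat \<lfloor>4 * N * \<kappa> * real n\<rfloor>)}).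
           bexp (\<lambda>_. p) {..<n} (\<lambda>S. of_bool (?G w S)) \<le> (1 - p) ^ k + 2 * \<eta>
           \<and> real (card {r\<in>I. \<not> ?G w (B r)}) \<le> \<eta> * real (card I)"
          by (rule flat_system_rounding[OF p t D0 D(2) n(1) N_def less_imp_le[OF \<eta>(1)] I(1) n(2) B fs])
            (use ball in blast)
        then show "\<exists>w\<in>X. real (card {r\<in>I. \<not> ?G w (B r)}) \<le> \<eta> * real (card I)"
          unfolding X_def K_def a_def by blast
      qed
      also have "\<dots> \<le> (\<Sum>w\<in>X. (a + e1) ^ (n - k))"
      proof (rule sum_mono)
        fix w assume w: "w \<in> X"
        have "mexp (\<lambda>_. p) I {..<n} (\<lambda>B. of_bool (real (card {r\<in>I. \<not> ?G w (B r)}) \<le> \<eta> * real (card I)))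
          \<le> (\<eta> powr (- \<eta>) * (a + 2 * \<eta> + \<eta>)) ^ card I"
          by (rule mexp_few_bad_rows_le[OF I(1) finite_lessThan p01 \<eta>(1,2)]) (use w in \<open>simp add: X_def\<close>)
        also have "\<dots> \<le> (a + e1) ^ (n - k)"
          unfolding I(2) using F a \<eta> by (intro power_mono) (auto simp: algebra_simps)
        finally show "mexp (\<lambda>_. p) I {..<n} (\<lambda>B. of_bool (real (card {r\<in>I. \<not> ?G w (B r)}) \<le> \<eta> * real (card I))) \<le> (a + e1) ^ (n - k)" .
      qed
      also have "\<dots> = real (card X) * (a + e1) ^ (n - k)" by simp
      also have "\<dots> \<le> (1 + e2) ^ n * (1 + e2) ^ n * (a + e1) ^ (n - k)"
        using cX a e1 by (intro mult_right_mono) auto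
      also have "\<dots> = ((1 + e2) * (1 + e2) * (a + e1)) ^ n / (a + e1) ^ k"
      proof -
        have "(a + e1) ^ n = (a + e1) ^ (n - k) * (a + e1) ^ k" using elim(2) by (simp flip: power_add)
        then have "((1 + e2) * (1 + e2) * (a + e1)) ^ n = (1 + e2) ^ n * (1 + e2) ^ n * (a + e1) ^ (n - k) * (a + e1) ^ k"
          by (simp only: power_mult_distrib mult.assoc)
        then show ?thesis using nonzero_mult_div_cancel_right[of "(a + e1) ^ k"] Fk a e1 by auto
      qed
      also have "\<dots> \<le> (a + 2 * e1) ^ n / (a + e1) ^ k"
      proof (intro divide_right_mono power_mono)
        have "(1 + e2) * (1 + e2) \<le> 1 + 3 * e2" using e2 mult_left_mono[of e2 1 e2] by (simp add: algebra_simps)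
        then have "(1 + e2) * (1 + e2) * (a + e1) \<le> (1 + 3 * e2) * (a + e1)" using a e1 by (intro mult_right_mono) auto
        also have "\<dots> = a + e1 + 3 * e2 * (a + e1)" by (simp add: algebra_simps)
        also have "\<dots> \<le> a + e1 + 3 * e2 * 2" using a e1 e2 by (intro add_left_mono mult_left_mono) auto
        also have "\<dots> = a + 2 * e1" by (simp add: e2_def)
        finally show "(1 + e2) * (1 + e2) * (a + e1) \<le> a + 2 * e1" .
      qed (use a e1 e2 in auto)
      also have "\<dots> \<le> (a + 3 * e1) ^ n"
      proof -
        have "(a + 2 * e1) ^ n = q ^ n * (a + 3 * e1) ^ n" using a e1 by (simp add: q_def power_divide)
        also have "\<dots> \<le> (a + e1) ^ k * (a + 3 * e1) ^ n" using elim(1) a e1 by (intro mult_right_mono) auto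
        finally show ?thesis using Fk by (simp add: field_simps)
      qed
      also have "\<dots> \<le> (a + \<epsilon>) ^ n" using a e1 by (intro power_mono) auto
      finally show "mexp (\<lambda>_. p) I {..<n} (\<lambda>B. of_bool (flat_system n k \<kappa> I B)) \<le> ((1 - p) ^ k + \<epsilon>) ^ n"
        by (simp only: a_def)
    qed
  qed
  then show ?thesis using \<kappa> by blast
qed

section \<open>Existence of triangular systems in the kernel\<close>

lemma ex_normalized_kernel_vector:
  assumes J: "finite (J :: nat set)" and L: "\<And>S. S \<in> set L \<Longrightarrow> S \<subseteq> J" "length L < card J"
  shows "\<exists>u f. f \<in> J \<and> u f = (1::real) \<and> (\<forall>j\<in>J. \<bar>u j\<bar> \<le> 1) \<and> (\<forall>S\<in>set L. ssum S u = 0)"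
proof -
  obtain v :: "nat \<Rightarrow> real" where v: "\<exists>j\<in>J. v j \<noteq> 0" "\<forall>S\<in>set L. ssum S v = 0"
    using ex_nonzero_kernel_vector[OF J L] by blast
  \<comment> \<open>Dividing by the entry of largest modulus makes its coordinate the pivot and
    bounds all entries by 1 at once.\<close>
  define M where "M = Max ((\<lambda>j. \<bar>v j\<bar>) ` J)"
  have "M \<in> (\<lambda>j. \<bar>v j\<bar>) ` J" unfolding M_def using J v by (intro Max_in) auto
  then obtain f where f: "f \<in> J" "M = \<bar>v f\<bar>" by auto
  have le: "\<bar>v j\<bar> \<le> \<bar>v f\<bar>" if "j \<in> J" for j
    unfolding f(2)[symmetric] M_def using J that by (intro Max_ge) auto
  have f0: "v f \<noteq> 0" using v(1) le by force
  show ?thesis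
  proof (intro exI[of _ "\<lambda>j. 1 / v f * v j"] exI[of _ f] conjI ballI)
    fix j assume "j \<in> J"
    then show "\<bar>1 / v f * v j\<bar> \<le> 1" using le[of j] f0 by (simp add: abs_mult abs_divide field_simps)
  next
    fix S assume "S \<in> set L"
    then show "ssum S (\<lambda>j. 1 / v f * v j) = 0" unfolding ssum_cmult using v(2) by simp
  qed (use f f0 in auto)
qed

text \<open>Each new vector is chosen in the kernel subject to vanishing at the previous pivots; these
  additional equations are again given by 0/1 rows, namely by singletons.\<close>

lemma ex_tri_system_kernel:
  assumes I: "finite I" and B: "\<And>i. i \<in> I \<Longrightarrow> B i \<subseteq> {..<n}" and k: "card I + k \<le> n"
  shows "\<exists>u f. tri_system {..<n} k u f \<and> (\<forall>i<k. \<forall>r\<in>I. ssum (B r) (u i) = 0)"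
  using k
proof (induction k)
  case 0
  then show ?case by (auto simp: tri_system_def)
next
  case (Suc k)
  then obtain u f where uf: "tri_system {..<n} k u f" "\<forall>i<k. \<forall>r\<in>I. ssum (B r) (u i) = 0" by auto
  obtain L where L: "set L = I" "length L = card I" using finite_distinct_list[OF I] distinct_card by metis
  let ?L = "map B L @ map (\<lambda>i. {f i}) [0..<k]"
  have sub: "S \<subseteq> {..<n}" if "S \<in> set ?L" for S
    using that B uf(1) L(1) by (auto simp: tri_system_def)
  have len: "length ?L < card {..<n}" using L(2) Suc.prems by simp
  have "\<exists>v g. g \<in> {..<n} \<and> v g = (1::real) \<and> (\<forall>j\<in>{..<n}. \<bar>v j\<bar> \<le> 1) \<and> (\<forall>S\<in>set ?L. ssum S v = 0)"
    by (rule ex_normalized_kernel_vector[OF finite_lessThan _ len]) (rule sub)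
  then obtain v :: "nat \<Rightarrow> real" and g where v: "g \<in> {..<n}" "v g = 1" "\<forall>j\<in>{..<n}. \<bar>v j\<bar> \<le> 1" "\<forall>S\<in>set ?L. ssum S v = 0"
    by blast
  have v0: "v (f i) = 0" if "i < k" for i
  proof -
    have "{f i} \<in> set ?L" using that by auto
    then have "ssum {f i} v = 0" using v(4) by blast
    then show ?thesis by (simp add: ssum_def)
  qed
  have "tri_system {..<n} (Suc k) (u(k := v)) (f(k := g))"
    unfolding tri_system_def
  proof (intro allI impI)
    fix i assume i: "i < Suc k"
    show "(f(k := g)) i \<in> {..<n} \<and> (u(k := v)) i ((f(k := g)) i) = 1 \<and>
      (\<forall>l<i. (u(k := v)) i ((f(k := g)) l) = 0) \<and> (\<forall>j\<in>{..<n}. \<bar>(u(k := v)) i j\<bar> \<le> 1)"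
    proof (cases "i = k")
      case True
      then show ?thesis using v(1,2,3) v0 by simp
    next
      case False
      then have "i < k" using i by simp
      then show ?thesis using uf(1) by (simp add: tri_system_def)
    qed
  qed
  moreover have "\<forall>i<Suc k. \<forall>r\<in>I. ssum (B r) ((u(k := v)) i) = 0"
    using uf(2) v(4) L(1) by (auto simp: less_Suc_eq)
  ultimately show ?case by blast
qed

text \<open>In a triangular system of kernel vectors either all are flat, or one of them, rescaled
  to l2 norm sqrt n, is spread; that this one violates the concentration bound is an instance of
  \<open>small\<close>.\<close>

lemma unstructured_or_flat:
  fixes B :: "nat \<Rightarrow> nat set"
  assumes p: "0 \<le> p" "p \<le> 1" and n: "n > 0" and I: "finite I" and B: "B \<in> PiE I (\<lambda>_. Pow {..<n})" and k: "card I + k \<le> n"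
    and small: "\<And>v :: nat \<Rightarrow> real. (\<forall>i\<in>I. ssum (B i) v = 0) \<Longrightarrow> bexp (\<lambda>_. p) {..<n} (\<lambda>S. of_bool (ssum S v = 0)) > \<alpha>"
  shows "(\<exists>v :: nat \<Rightarrow> real. spread_vec n \<kappa> v \<and> (\<forall>i\<in>I. ssum (B i) v = 0) \<and> bexp (\<lambda>_. p) {..<n} (\<lambda>S. of_bool (ssum S v = 0)) > \<alpha>)
    \<or> flat_system n k \<kappa> I B"
proof -
  obtain u f where uf: "tri_system {..<n} k u f" "\<forall>i<k. \<forall>r\<in>I. ssum (B r) (u i) = 0"
    using ex_tri_system_kernel[OF I _ k, of B] B by blast
  show ?thesis
  proof (cases "\<forall>i<k. (\<Sum>j<n. \<bar>u i j\<bar>) * sqrt (real n) \<le> \<kappa> * real n * sqrt (\<Sum>j<n. (u i j)\<^sup>2)")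
    case True
    then show ?thesis using uf unfolding flat_system_def by blast
  next
    case False
    then obtain i where i: "i < k" "(\<Sum>j<n. \<bar>u i j\<bar>) * sqrt (real n) > \<kappa> * real n * sqrt (\<Sum>j<n. (u i j)\<^sup>2)"
      by (auto simp: not_le)
    define \<Lambda> where "\<Lambda> = sqrt (\<Sum>j<n. (u i j)\<^sup>2)"
    have f: "f i < n" "u i (f i) = 1" using uf(1) i by (auto simp: tri_system_def)
    have "(u i (f i))\<^sup>2 \<le> (\<Sum>j<n. (u i j)\<^sup>2)" using f by (intro member_le_sum) auto
    then have \<Lambda>: "\<Lambda> > 0" "\<Lambda>\<^sup>2 = (\<Sum>j<n. (u i j)\<^sup>2)" using f by (simp_all add: \<Lambda>_def sum_nonneg)
    define c where "c = sqrt (real n) / \<Lambda>"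
    have c: "c > 0" using \<Lambda> n by (simp add: c_def)
    define v where "v j = c * u i j" for j
    have "spread_vec n \<kappa> v"
      unfolding spread_vec_def
    proof
      have "(\<Sum>j<n. (v j)\<^sup>2) = c\<^sup>2 * (\<Sum>j<n. (u i j)\<^sup>2)" by (simp add: v_def power_mult_distrib sum_distrib_left)
      also have "\<dots> = real n" using \<Lambda> n unfolding \<Lambda>(2)[symmetric] by (simp add: c_def power_divide)
      finally show "(\<Sum>j<n. (v j)\<^sup>2) = real n" .
      have "(\<Sum>j<n. \<bar>v j\<bar>) = c * (\<Sum>j<n. \<bar>u i j\<bar>)" using c by (simp add: v_def abs_mult sum_distrib_left)
      also have "\<dots> = (\<Sum>j<n. \<bar>u i j\<bar>) * sqrt (real n) / \<Lambda>" by (simp add: c_def)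
      also have "\<dots> \<ge> \<kappa> * real n" using i(2) \<Lambda>(1) unfolding \<Lambda>_def[symmetric] by (simp add: field_simps)
      finally show "(\<Sum>j<n. \<bar>v j\<bar>) \<ge> \<kappa> * real n" .
    qed
    moreover have "\<forall>r\<in>I. ssum (B r) v = 0" unfolding v_def ssum_cmult using uf(2) i(1) by simp
    ultimately show ?thesis using small[of v] by blast
  qed
qed

section \<open>Corank and dependent columns\<close>

lemma mexp_Un:
  assumes "finite D" "finite I" "D \<inter> I = {}"
  shows "mexp \<pi> (D \<union> I) J F = mexp \<pi> I J (\<lambda>B. mexp \<pi> D J (\<lambda>C. F (\<lambda>i. if i \<in> D then C i else B i)))"
proof -
  have "mexp \<pi> (D \<union> I) J F = (\<Sum>(C, B)\<in>PiE D (\<lambda>_. Pow J) \<times> PiE I (\<lambda>_. Pow J).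
     mat_weight \<pi> (D \<union> I) J (\<lambda>i. if i \<in> D then C i else B i) * F (\<lambda>i. if i \<in> D then C i else B i))"
    unfolding mexp_def
  proof (rule sum.reindex_bij_witness[of _ "\<lambda>(C, B) i. if i \<in> D then C i else B i" "\<lambda>A. (restrict A D, restrict A I)"])
    fix A assume A: "A \<in> PiE (D \<union> I) (\<lambda>_. Pow J)"
    show e: "(case (restrict A D, restrict A I) of (C, B) \<Rightarrow> (\<lambda>i. if i \<in> D then C i else B i)) = A"
      using A by (intro ext) (auto simp: PiE_def extensional_def)
    show "(restrict A D, restrict A I) \<in> PiE D (\<lambda>_. Pow J) \<times> PiE I (\<lambda>_. Pow J)"
      using A by (auto simp: PiE_iff)
    show "(case (restrict A D, restrict A I) of (C, B) \<Rightarrow> mat_weight \<pi> (D \<union> I) J (\<lambda>i. if i \<in> D then C i else B i) * F (\<lambda>i. if i \<in> D then C i else B i))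
      = mat_weight \<pi> (D \<union> I) J A * F A"
      using e by simp
  next
    fix CB assume CB: "CB \<in> PiE D (\<lambda>_. Pow J) \<times> PiE I (\<lambda>_. Pow J)"
    obtain C B where e: "CB = (C, B)" by (cases CB)
    have C: "C \<in> PiE D (\<lambda>_. Pow J)" and B: "B \<in> PiE I (\<lambda>_. Pow J)" using CB e by auto
    have "restrict (\<lambda>i. if i \<in> D then C i else B i) D = C" using C by (intro ext) (auto simp: PiE_def extensional_def)
    moreover have "restrict (\<lambda>i. if i \<in> D then C i else B i) I = B"
      using B assms(3) by (intro ext) (auto simp: PiE_def extensional_def)
    ultimately show "(restrict (case CB of (C, B) \<Rightarrow> (\<lambda>i. if i \<in> D then C i else B i)) D,
        restrict (case CB of (C, B) \<Rightarrow> (\<lambda>i. if i \<in> D then C i else B i)) I) = CB" by (simp add: e)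
    show "(case CB of (C, B) \<Rightarrow> (\<lambda>i. if i \<in> D then C i else B i)) \<in> PiE (D \<union> I) (\<lambda>_. Pow J)"
      using C B by (auto simp: e PiE_def extensional_def Pi_def)
  qed
  also have "\<dots> = (\<Sum>C\<in>PiE D (\<lambda>_. Pow J). \<Sum>B\<in>PiE I (\<lambda>_. Pow J).
     mat_weight \<pi> I J B * (mat_weight \<pi> D J C * F (\<lambda>i. if i \<in> D then C i else B i)))"
    unfolding sum.cartesian_product
  proof (intro sum.cong refl, clarify)
    fix C B
    have "mat_weight \<pi> (D \<union> I) J (\<lambda>i. if i \<in> D then C i else B i) = mat_weight \<pi> D J C * mat_weight \<pi> I J B"
      unfolding mat_weight_def using assms
      by (subst prod.union_disjoint) (auto intro!: arg_cong2[of _ _ _ _ "(*)"] prod.cong)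
    then show "mat_weight \<pi> (D \<union> I) J (\<lambda>i. if i \<in> D then C i else B i) * F (\<lambda>i. if i \<in> D then C i else B i)
      = mat_weight \<pi> I J B * (mat_weight \<pi> D J C * F (\<lambda>i. if i \<in> D then C i else B i))" by simp
  qed
  also have "\<dots> = mexp \<pi> I J (\<lambda>B. mexp \<pi> D J (\<lambda>C. F (\<lambda>i. if i \<in> D then C i else B i)))"
    unfolding mexp_def sum_distrib_left by (rule sum.swap)
  finally show ?thesis .
qed

text \<open>Dual form of the statement that the columns in \<open>D\<close> lie in the span of the
  others, where \<open>C j\<close> is the support of column j. Left kernel vectors v are all that
  the independence argument uses.\<close>

definition dep_cols :: "nat \<Rightarrow> nat set \<Rightarrow> (nat \<Rightarrow> nat set) \<Rightarrow> bool" where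
  "dep_cols n D C \<longleftrightarrow> (\<forall>v :: nat \<Rightarrow> real. (\<forall>j\<in>{..<n} - D. ssum (C j) v = 0) \<longrightarrow> (\<forall>d\<in>D. ssum (C d) v = 0))"

text \<open>The columns in \<open>D\<close> are independent of the others, hence of any kernel vector of the latter.\<close>

lemma mexp_dep_cols_le:
  fixes p \<alpha> :: real
  assumes p: "0 \<le> p" "p \<le> 1" and n: "n > 0" and D: "D \<subseteq> {..<n}" "card D = k" and \<alpha>: "\<alpha> \<ge> 0"
  defines "I \<equiv> {..<n} - D"
  shows "mexp (\<lambda>_. p) {..<n} {..<n} (\<lambda>C. of_bool (dep_cols n D C)) \<le> \<alpha> ^ k
     + mexp (\<lambda>_. p) I {..<n} (\<lambda>B. of_bool (\<exists>v. spread_vec n \<kappa> v \<and> (\<forall>i\<in>I. ssum (B i) v = 0)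
        \<and> bexp (\<lambda>_. p) {..<n} (\<lambda>S. of_bool (ssum S v = 0)) > \<alpha>))
     + mexp (\<lambda>_. p) I {..<n} (\<lambda>B. of_bool (flat_system n k \<kappa> I B))"
proof -
  have fin: "finite D" "finite I" "D \<inter> I = {}" "D \<union> I = {..<n}"
    using D(1) finite_subset by (auto simp: I_def)
  have "k \<le> n" using card_mono[OF finite_lessThan D(1)] D(2) by simp
  then have cI: "card I + k \<le> n" using D fin by (simp add: I_def card_Diff_subset)
  let ?sp = "\<lambda>B. \<exists>v. spread_vec n \<kappa> v \<and> (\<forall>i\<in>I. ssum (B i) v = 0)
        \<and> bexp (\<lambda>_. p) {..<n} (\<lambda>S. of_bool (ssum S v = 0)) > \<alpha>"
  have "mexp (\<lambda>_. p) (D \<union> I) {..<n} (\<lambda>C. of_bool (dep_cols n D C))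
    = mexp (\<lambda>_. p) I {..<n} (\<lambda>B. mexp (\<lambda>_. p) D {..<n} (\<lambda>C. of_bool (dep_cols n D (\<lambda>i. if i \<in> D then C i else B i))))"
    by (rule mexp_Un[OF fin(1,2,3)])
  also have "\<dots> \<le> mexp (\<lambda>_. p) I {..<n} (\<lambda>B. \<alpha> ^ k + of_bool (?sp B) + of_bool (flat_system n k \<kappa> I B))"
  proof (rule mexp_mono)
    fix B assume B: "B \<in> PiE I (\<lambda>_. Pow {..<n})"
    let ?dep = "\<lambda>C. dep_cols n D (\<lambda>i. if i \<in> D then C i else B i)"
    have one: "mexp (\<lambda>_. p) D {..<n} (\<lambda>C. of_bool (?dep C)) \<le> 1"
    proof -
      have "mexp (\<lambda>_. p) D {..<n} (\<lambda>C. of_bool (?dep C)) \<le> mexp (\<lambda>_. p) D {..<n} (\<lambda>C. 1)"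
        using p by (intro mexp_mono) auto
      then show ?thesis using fin by (simp add: mexp_const)
    qed
    show "mexp (\<lambda>_. p) D {..<n} (\<lambda>C. of_bool (?dep C)) \<le> \<alpha> ^ k + of_bool (?sp B) + of_bool (flat_system n k \<kappa> I B)"
    proof (cases "\<exists>v :: nat \<Rightarrow> real. (\<forall>i\<in>I. ssum (B i) v = 0) \<and> bexp (\<lambda>_. p) {..<n} (\<lambda>S. of_bool (ssum S v = 0)) \<le> \<alpha>")
      case True
      then obtain v :: "nat \<Rightarrow> real" where v: "\<forall>i\<in>I. ssum (B i) v = 0" "bexp (\<lambda>_. p) {..<n} (\<lambda>S. of_bool (ssum S v = 0)) \<le> \<alpha>" by blast
      have "mexp (\<lambda>_. p) D {..<n} (\<lambda>C. of_bool (?dep C)) \<le> mexp (\<lambda>_. p) D {..<n} (\<lambda>C. \<Prod>d\<in>D. of_bool (ssum (C d) v = 0))"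
      proof (rule mexp_mono)
        fix C
        show "of_bool (?dep C) \<le> (\<Prod>d\<in>D. of_bool (ssum (C d) v = 0) :: real)"
        proof (cases "?dep C")
          case True
          moreover have "\<forall>j\<in>{..<n} - D. ssum (if j \<in> D then C j else B j) v = 0" using v(1) by (simp add: I_def)
          ultimately have "\<forall>d\<in>D. ssum (if d \<in> D then C d else B d) v = 0" unfolding dep_cols_def by blast
          then have "\<forall>d\<in>D. ssum (C d) v = 0" by simp
          then show ?thesis using True by simp
        qed (simp add: prod_nonneg)
      qed (use p in auto)
      also have "\<dots> = (\<Prod>d\<in>D. bexp (\<lambda>_. p) {..<n} (\<lambda>S. of_bool (ssum S v = 0)))" by (rule mexp_prod[OF fin(1) finite_lessThan])
      also have "\<dots> \<le> \<alpha> ^ k"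
        using v(2) p D(2) by (simp add: power_mono bexp_nonneg)
      finally show ?thesis by (simp add: add_increasing2)
    next
      case False
      then have "?sp B \<or> flat_system n k \<kappa> I B"
        by (intro unstructured_or_flat[OF p n fin(2) B cI]) (auto simp: not_le)
      then have "1 \<le> (of_bool (?sp B) :: real) + of_bool (flat_system n k \<kappa> I B)" by auto
      then show ?thesis using one zero_le_power[OF \<alpha>, of k] by linarith
    qed
  qed (use p in auto)
  also have "\<dots> = \<alpha> ^ k + mexp (\<lambda>_. p) I {..<n} (\<lambda>B. of_bool (?sp B)) + mexp (\<lambda>_. p) I {..<n} (\<lambda>B. of_bool (flat_system n k \<kappa> I B))"
    by (simp only: mexp_add mexp_const[OF fin(2) finite_lessThan])
  finally show ?thesis by (simp only: fin(4))
qed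

section \<open>Transfer between matrices and families of column supports\<close>

unbundle no vec_syntax

lemma (in vec_space) col_combination_of_maximal:
  assumes A: "A \<in> carrier_mat n nc" and S: "maximal S (\<lambda>T. T \<subseteq> set (cols A) \<and> lin_indpt T)"
    and c: "c \<in> set (cols A)"
  shows "\<exists>a. \<forall>i<n. c $ i = (\<Sum>s\<in>S. a s * s $ i)"
proof -
  have S': "S \<subseteq> set (cols A)" "lin_indpt S" using S by (auto simp: maximal_def)
  have carr: "set (cols A) \<subseteq> carrier_vec n" using A cols_dim by blast
  have fin: "finite S" using S'(1) finite_subset by blast
  have "c \<in> span S"
  proof (cases "c \<in> S")
    case True
    then show ?thesis using in_own_span[of S] S'(1) carr by auto
  next
    case False
    have "lin_dep (S \<union> {c})"
      using S S'(1) c False unfolding maximal_def by blast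
    then show ?thesis using lin_dep_iff_in_span[of S c] S' carr c False by auto
  qed
  then obtain a where "lincomb a S = c" using finite_in_span[OF fin, of c] S'(1) carr by auto
  then show ?thesis using lincomb_index[of _ S a] S'(1) carr by (metis subset_trans)
qed

text \<open>A maximal independent set of columns has at most n - k elements. Choosing one index for
  each leaves at least k indices, and any k of these can form \<open>D\<close>: their columns are
  combinations of the chosen ones, all of which lie outside \<open>D\<close>.\<close>

lemma ex_dep_cols_of_corank:
  fixes f :: "nat \<times> nat \<Rightarrow> bool" and n k :: nat
  defines "A \<equiv> mat n n (\<lambda>(i, j). if f (i, j) then 1 else 0)"
  assumes k: "k \<le> corank n A" "k \<le> n"
  shows "\<exists>D. D \<subseteq> {..<n} \<and> card D = k \<and> dep_cols n D (\<lambda>j. {i\<in>{..<n}. f (i, j)})"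
proof -
  interpret vec_space "TYPE(real)" n .
  have A: "A \<in> carrier_mat n n" by (simp add: A_def)
  obtain S where S: "maximal S (\<lambda>T. T \<subseteq> set (cols A) \<and> lin_indpt T)"
    using maximal_exists_superset[of "set (cols A)" "\<lambda>T. T \<subseteq> set (cols A) \<and> lin_indpt T" "{}"]
    by (auto simp: lin_dep_def)
  have S': "S \<subseteq> set (cols A)" using S by (simp add: maximal_def)
  have finS: "finite S" using S' finite_subset by blast
  have cS: "card S \<le> n - k"
    using k rank_card_indpt[OF A S] rank_le_nc[OF A] A by (simp add: corank_def real_rank_def)
  have "\<forall>s\<in>S. \<exists>j<n. col A j = s" using S' A by (force simp: cols_def)
  \<comment> \<open>Equal columns are one element of \<open>S\<close>; a single index for each lets
    repetitions count as dependent columns.\<close>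
  then obtain g where g: "\<And>s. s \<in> S \<Longrightarrow> g s < n \<and> col A (g s) = s" by metis
  have "card (g ` S) \<le> n - k" using card_image_le[OF finS, of g] cS by simp
  then have "k \<le> card ({..<n} - g ` S)"
    using k(2) g finS by (subst card_Diff_subset) (auto intro: finite_imageI)
  then obtain D where D: "D \<subseteq> {..<n} - g ` S" "card D = k" by (meson obtain_subset_with_card_n)
  have eq: "ssum {i\<in>{..<n}. f (i, j)} v = (\<Sum>i<n. v i * col A j $ i)" if "j < n" for j and v :: "nat \<Rightarrow> real"
    unfolding ssum_def using that by (intro sum.mono_neutral_cong_left) (auto simp: A_def)
  have "dep_cols n D (\<lambda>j. {i\<in>{..<n}. f (i, j)})"
    unfolding dep_cols_def
  proof (intro allI impI ballI)
    fix v :: "nat \<Rightarrow> real" and d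
    assume v: "\<forall>j\<in>{..<n} - D. ssum {i\<in>{..<n}. f (i, j)} v = 0" and d: "d \<in> D"
    then have dn: "d < n" using D by auto
    have z: "(\<Sum>i<n. v i * s $ i) = 0" if "s \<in> S" for s
    proof -
      have "g s \<in> {..<n} - D" using that g D(1) by auto
      then show ?thesis using v eq[of "g s" v] g[OF that] by auto
    qed
    have "col A d \<in> set (cols A)" using dn A by (auto simp: cols_def)
    then obtain a where a: "\<And>i. i < n \<Longrightarrow> col A d $ i = (\<Sum>s\<in>S. a s * s $ i)"
      using col_combination_of_maximal[OF A S] by blast
    have "ssum {i\<in>{..<n}. f (i, d)} v = (\<Sum>i<n. v i * (\<Sum>s\<in>S. a s * s $ i))"
      unfolding eq[OF dn] using a by simp
    also have "\<dots> = (\<Sum>s\<in>S. a s * (\<Sum>i<n. v i * s $ i))"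
      unfolding sum_distrib_left by (subst sum.swap) (simp add: mult_ac)
    also have "\<dots> = 0" using z by simp
    finally show "ssum {i\<in>{..<n}. f (i, d)} v = 0" .
  qed
  then show ?thesis using D by blast
qed

text \<open>The random rows of the earlier sections become the columns of the matrix:
  \<open>C j\<close> is the support of column j, so the family is indexed by columns.\<close>

lemma prob_bernoulli_matrix:
  assumes p: "0 \<le> p" "p \<le> 1"
  shows "measure_pmf.prob (bernoulli_matrix n p) X
    = mexp (\<lambda>_. p) {..<n} {..<n} (\<lambda>C. of_bool (mat n n (\<lambda>(i, j). if i \<in> C j then 1 else 0) \<in> X))"
proof -
  let ?S = "{..<n} \<times> {..<n}"
  let ?P = "Pi_pmf ?S False (\<lambda>_. bernoulli_pmf p)"
  let ?M = "\<lambda>f. mat n n (\<lambda>(i, j). if f (i, j) then 1 else 0) :: real mat"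
  let ?E = "PiE_dflt ?S False (\<lambda>_. UNIV)"
  \<comment> \<open>The inverse of passing to column supports. It is \<open>False\<close> outside
    the square, matching the default value in \<open>Pi_pmf\<close>.\<close>
  let ?f = "\<lambda>C (i, j). i < n \<and> j < n \<and> i \<in> C j"
  have finE: "finite ?E" by (intro finite_PiE_dflt) auto
  have "measure_pmf.prob (bernoulli_matrix n p) X = measure_pmf.prob ?P (?M -` X)"
    by (simp add: bernoulli_matrix_def)
  also have "\<dots> = measure_pmf.prob ?P (?M -` X \<inter> ?E)"
  proof (rule measure_prob_cong_0)
    fix f assume "f \<in> ?M -` X - ?M -` X \<inter> ?E"
    then show "pmf ?P f = 0" by (intro pmf_Pi_outside) (auto simp: PiE_dflt_def)
  qed auto
  also have "\<dots> = (\<Sum>f\<in>?M -` X \<inter> ?E. pmf ?P f)"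
    using finE by (intro measure_measure_pmf_finite) auto
  also have "\<dots> = (\<Sum>f\<in>?E. pmf ?P f * of_bool (?M f \<in> X))"
    using finE by (intro sum.mono_neutral_cong_left) auto
  also have "\<dots> = mexp (\<lambda>_. p) {..<n} {..<n} (\<lambda>C. of_bool (mat n n (\<lambda>(i, j). if i \<in> C j then 1 else 0) \<in> X))"
    unfolding mexp_def
  proof (rule sum.reindex_bij_witness[of _ ?f "\<lambda>f. \<lambda>j\<in>{..<n}. {i\<in>{..<n}. f (i, j)}"])
    fix f assume f: "f \<in> ?E"
    let ?C = "\<lambda>j\<in>{..<n}. {i\<in>{..<n}. f (i, j)}"
    show "?f ?C = f"
      using f by (intro ext) (auto simp: PiE_dflt_def split: prod.splits)
    show "?C \<in> PiE {..<n} (\<lambda>_. Pow {..<n})" by auto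
    have "pmf ?P f = (\<Prod>x\<in>?S. pmf (bernoulli_pmf p) (f x))"
      using f by (intro pmf_Pi') (auto simp: PiE_dflt_def)
    also have "\<dots> = (\<Prod>x\<in>?S. if f x then p else 1 - p)" using p by (intro prod.cong) auto
    also have "\<dots> = (\<Prod>i<n. \<Prod>j<n. if f (i, j) then p else 1 - p)" by (simp add: prod.cartesian_product)
    also have "\<dots> = (\<Prod>j<n. \<Prod>i<n. if f (i, j) then p else 1 - p)" by (rule prod.swap)
    also have "\<dots> = mat_weight (\<lambda>_. p) {..<n} {..<n} ?C"
      unfolding mat_weight_def bern_weight_def by (intro prod.cong) auto
    finally have w: "pmf ?P f = mat_weight (\<lambda>_. p) {..<n} {..<n} ?C" .
    have "mat n n (\<lambda>(i, j). if i \<in> ?C j then 1 else 0) = ?M f"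
      by (intro eq_matI) auto
    with w show "mat_weight (\<lambda>_. p) {..<n} {..<n} ?C
        * of_bool (mat n n (\<lambda>(i, j). if i \<in> ?C j then 1 else 0) \<in> X) = pmf ?P f * of_bool (?M f \<in> X)"
      by simp
  next
    fix C assume C: "C \<in> PiE {..<n} (\<lambda>_. Pow {..<n})"
    show "(\<lambda>j\<in>{..<n}. {i\<in>{..<n}. ?f C (i, j)}) = C"
      using C by (intro ext) (auto simp: PiE_def Pi_def extensional_def)
    show "?f C \<in> ?E" by (auto simp: PiE_dflt_def)
  qed
  finally show ?thesis .
qed

lemma prob_corank_ge_le:
  assumes p: "0 \<le> p" "p \<le> 1" and k: "k \<le> n"
  shows "measure_pmf.prob (bernoulli_matrix n p) {A. k \<le> corank n A}
    \<le> (\<Sum>D\<in>{D. D \<subseteq> {..<n} \<and> card D = k}. mexp (\<lambda>_. p) {..<n} {..<n} (\<lambda>C. of_bool (dep_cols n D C)))"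
proof -
  let ?X = "{D. D \<subseteq> {..<n} \<and> card D = k}"
  let ?A = "\<lambda>C :: nat \<Rightarrow> nat set. mat n n (\<lambda>(i, j). if i \<in> C j then 1 else 0) :: real mat"
  have fin: "finite ?X" by (rule finite_subset[of _ "Pow {..<n}"]) auto
  show ?thesis
    unfolding prob_bernoulli_matrix[OF p]
  proof (rule mexp_ex_le_sum[OF p fin])
    fix C assume C: "C \<in> PiE {..<n} (\<lambda>_. Pow {..<n})" and A: "?A C \<in> {A. k \<le> corank n A}"
    have "k \<le> corank n (mat n n (\<lambda>(i, j). if (\<lambda>(i, j). i \<in> C j) (i, j) then 1 else 0))" using A by simp
    from ex_dep_cols_of_corank[OF this k]
    obtain D where D: "D \<subseteq> {..<n}" "card D = k" "dep_cols n D (\<lambda>j. {i\<in>{..<n}. i \<in> C j})" by auto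
    have "{i\<in>{..<n}. i \<in> C j} = C j" if "j < n" for j using C that by (auto simp: PiE_iff)
    then have "dep_cols n D C" using D(1,3) unfolding dep_cols_def by (auto simp: subset_iff)
    then show "\<exists>D\<in>?X. dep_cols n D C" using D by blast
  qed
qed

theorem theorem1p1:
  fixes p \<epsilon> :: real and k :: nat
  assumes "0 < p" and "p \<le> 1/2" and "k \<ge> 1" and "\<epsilon> > 0"
  shows "\<exists>n0::nat. \<forall>n\<ge>n0.
           measure_pmf.prob (bernoulli_matrix n p) {A. corank n A \<ge> k}
             \<le> (1 - p + \<epsilon>) ^ (k * n)"
proof (cases "\<epsilon> < p")
  \<comment> \<open>Here the right-hand side is at least 1.\<close>
  case False
  then have "1 \<le> (1 - p + \<epsilon>) ^ m" for m by (intro one_le_power) simp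
  then show ?thesis using measure_pmf.prob_le_1 order_trans by blast
next
  case True
  \<comment> \<open>Halfway between 1 - p and the target. The gap below is spent on flat systems and
    spread vectors, the gap above on the factors polynomial in n, through
    \<open>r ^ n\<close>.\<close>
  define \<gamma> where "\<gamma> = 1 - p + \<epsilon> / 2"
  have \<gamma>: "0 < \<gamma>" "1 - p < \<gamma>" "\<gamma> < 1 - p + \<epsilon>" "1 - (p - \<epsilon> / 2) = \<gamma>" using assms True by (auto simp: \<gamma>_def)
  have p01: "0 \<le> p" "p \<le> 1" using assms by auto
  define r where "r = (\<gamma> / (1 - p + \<epsilon>)) ^ k"
  have r: "0 < r" "r < 1" using \<gamma> assms by (auto simp: r_def power_less_one_iff)
  have "(1 - p) ^ k < \<gamma> ^ k" using \<gamma> assms by (intro power_strict_mono) auto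
  then have "0 < \<gamma> ^ k - (1 - p) ^ k" by simp
  from flat_systems_rare[OF assms(1,2) this, of k]
  obtain \<kappa> where \<kappa>: "0 < \<kappa>" "\<kappa> \<le> 1" and flat: "eventually (\<lambda>n. \<forall>I :: nat set. finite I \<longrightarrow> card I = n - k \<longrightarrow>
      mexp (\<lambda>_. p) I {..<n} (\<lambda>B. of_bool (flat_system n k \<kappa> I B)) \<le> (\<gamma> ^ k) ^ n) at_top" by auto
  have spread: "eventually (\<lambda>n. \<forall>I :: nat set. finite I \<longrightarrow> card I = n - k \<longrightarrow>
      mexp (\<lambda>_. p) I {..<n} (\<lambda>B. of_bool (\<exists>v. spread_vec n \<kappa> v \<and> (\<forall>i\<in>I. ssum (B i) v = 0)
        \<and> bexp (\<lambda>_. p) {..<n} (\<lambda>S. of_bool (ssum S v = 0)) > real n * \<gamma> ^ n)) \<le> (1 - p) ^ (k * n)) at_top"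
    using spread_kernel_vectors_rare[of p "p - \<epsilon> / 2" \<kappa> k] assms \<kappa> unfolding \<gamma>(4) by simp
  have "(\<lambda>n. real n ^ k * (real n ^ k + 2) * r ^ n) \<longlonglongrightarrow> 0" using r by real_asymp
  then have ev: "eventually (\<lambda>n. real n ^ k * (real n ^ k + 2) * r ^ n < 1) at_top"
    by (rule order_tendstoD(2)) simp
  have "eventually (\<lambda>n. measure_pmf.prob (bernoulli_matrix n p) {A. k \<le> corank n A} \<le> (1 - p + \<epsilon>) ^ (k * n)) at_top"
    using flat spread ev eventually_ge_at_top[of k] eventually_gt_at_top[of 0]
  proof eventually_elim
    case (elim n)
    let ?X = "{D. D \<subseteq> {..<n} \<and> card D = k}"
    have "measure_pmf.prob (bernoulli_matrix n p) {A. k \<le> corank n A}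
      \<le> (\<Sum>D\<in>?X. mexp (\<lambda>_. p) {..<n} {..<n} (\<lambda>C. of_bool (dep_cols n D C)))"
      by (rule prob_corank_ge_le[OF p01 elim(4)])
    also have "\<dots> \<le> (\<Sum>D\<in>?X. (real n ^ k + 2) * \<gamma> ^ (k * n))"
    proof (rule sum_mono)
      fix D assume "D \<in> ?X"
      then have D: "D \<subseteq> {..<n}" "card D = k" by auto
      let ?I = "{..<n} - D"
      have I: "finite ?I" "card ?I = n - k" using D finite_subset[OF D(1)] by (auto simp: card_Diff_subset)
      have "mexp (\<lambda>_. p) {..<n} {..<n} (\<lambda>C. of_bool (dep_cols n D C))
        \<le> (real n * \<gamma> ^ n) ^ k + (1 - p) ^ (k * n) + (\<gamma> ^ k) ^ n"
        by (rule order_trans[OF mexp_dep_cols_le[OF p01 elim(5) D, where \<kappa> = \<kappa> and \<alpha> = "real n * \<gamma> ^ n"]])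
          (use \<gamma>(1) in \<open>auto intro!: add_mono elim(1,2)[rule_format, OF I]\<close>)
      also have "(1 - p) ^ (k * n) \<le> \<gamma> ^ (k * n)" using \<gamma> p01 by (intro power_mono) auto
      also have "(real n * \<gamma> ^ n) ^ k + \<gamma> ^ (k * n) + (\<gamma> ^ k) ^ n = (real n ^ k + 2) * \<gamma> ^ (k * n)"
        by (simp add: power_mult_distrib power_mult[symmetric] mult.commute[of n k] algebra_simps)
      finally show "mexp (\<lambda>_. p) {..<n} {..<n} (\<lambda>C. of_bool (dep_cols n D C)) \<le> (real n ^ k + 2) * \<gamma> ^ (k * n)"
        by simp
    qed
    also have "\<dots> = real (n choose k) * ((real n ^ k + 2) * \<gamma> ^ (k * n))"
      using n_subsets[of "{..<n}" k] by simp
    also have "\<dots> \<le> real n ^ k * ((real n ^ k + 2) * \<gamma> ^ (k * n))"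
      using binomial_le_pow[OF elim(4)] \<gamma>(1) by (intro mult_right_mono) (auto simp flip: of_nat_power)
    also have "\<dots> = (real n ^ k * (real n ^ k + 2) * r ^ n) * (1 - p + \<epsilon>) ^ (k * n)"
      using \<gamma> by (simp add: r_def power_divide power_mult)
    also have "\<dots> \<le> 1 * (1 - p + \<epsilon>) ^ (k * n)"
      using elim(3) \<gamma> by (intro mult_right_mono) auto
    finally show ?case by simp
  qed
  then show ?thesis by (simp add: eventually_sequentially)
qed

end
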